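(* Let $N\ge 3$, $p>2$, and let $h,V\in C(\mathbb{R}^N)$ with $V^+\not\equiv 0$ and $h^+\not\equiv 0$. Let $\Omega^{-0}=\{x\in\mathbb{R}^N:h(x)\le 0\}$. Then $(P_\lambda)$ does not admit any positive weak solution in $E$ for $\lambda>\lambda_1(\Omega^{-0},V)$. Furthermore, if $\lambda_1(\Omega^{-0},V)<\infty$ is attained and $h\not\equiv 0$, then there is no positive weak solution of $(P_\lambda)$ in $E$ for $\lambda=\lambda_1(\Omega^{-0},V)$.
   Context: Integrals without indicated domain are over $\mathbb{R}^N$ with Lebesgue measure. For a function $f$, $f^+=\max(0,f)$ and $f^-=f^+-f$. $2^*=2N/(N-2)$. $D^{1,2}(\mathbb{R}^N)$ is the closure of $C_c^\infty(\mathbb{R}^N)$ in $L^{2^*}(\mathbb{R}^N)$ with respect to the norm $\|\nabla u\|_2=(\int|\nabla u|^2)^{1/2}$. For measurable $k\ge 0$, $L^q(\Omega,k)$ is the space of measurable $u$ with $\|u\|_{L^q(\Omega,k)}^q=\int_\Omega k|u|^q<\infty$ (functions equal $k\,dx$-a.e. identified). For measurable $\Omega\subset\mathbb{R}^N$, $D^{1,2}(\Omega)=\{u\in D^{1,2}(\mathbb{R}^N): u=0 \text{ a.e. on }\mathbb{R}^N\setminus\Omega\}$. $E:=D^{1,2}(\mathbb{R}^N)\cap L^2(\mathbb{R}^N,|V|)\cap L^p(\mathbb{R}^N,|h|)$. For $\lambda>0$, $(P_\lambda)$ is the problem $-\Delta u-\lambda V(x)u+h(x)u^{p-1}=0$ in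 $\mathbb{R}^N$, $u\in E$, $u\ge 0$, $u\not\equiv 0$. A weak solution satisfies $\int\nabla u\cdot\nabla\varphi-\lambda\int Vu\varphi+\int hu^{p-1}\varphi=0$ for all $\varphi\in C_c^\infty(\mathbb{R}^N)$; it is positive if $u>0$ in $\mathbb{R}^N$. $\lambda_1(\Omega,V)=\inf\{\|\nabla u\|_2^2: u\in D^{1,2}(\Omega)\cap L^2(\mathbb{R}^N,|V|),\ \int V|u|^2=1\}$, equal to $+\infty$ if the infimum is over the empty set; "attained" means that the infimum is a minimum. *)

theory Defs
  imports "HOL-Analysis.Analysis"
begin

text \<open>
  Elements of \<open>L\<^sup>q\<close> and Sobolev spaces are represented by functions rather than by classes
  modulo null sets; every condition imposed on them below is invariant under changes on a
  Lebesgue null set, and pointwise statements about them are read almost everywhere.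
\<close>

definition partial_deriv :: "'n \<Rightarrow> (real^'n \<Rightarrow> real) \<Rightarrow> real^'n::finite \<Rightarrow> real" where
  "partial_deriv i f x = frechet_derivative f (at x) (axis i 1)"

definition classical_grad :: "(real^'n \<Rightarrow> real) \<Rightarrow> real^'n::finite \<Rightarrow> real^'n" where
  "classical_grad f x = (\<chi> i. partial_deriv i f x)"

primrec C_k :: "nat \<Rightarrow> (real^'n::finite \<Rightarrow> real) \<Rightarrow> bool" where
  "C_k 0 f \<longleftrightarrow> continuous_on UNIV f"
| "C_k (Suc k) f \<longleftrightarrow> (\<forall>x. f differentiable (at x)) \<and> (\<forall>i. C_k k (partial_deriv i f))"

definition Cc_infty :: "(real^'n::finite \<Rightarrow> real) set" where
  "Cc_infty = {\<phi>. (\<forall>k. C_k k \<phi>) \<and> compact (closure {x. \<phi> x \<noteq> 0})}"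

definition locally_integrable :: "(real^'n::finite \<Rightarrow> 'b::euclidean_space) \<Rightarrow> bool" where
  "locally_integrable f \<longleftrightarrow> (\<forall>K. compact K \<longrightarrow> f absolutely_integrable_on K)"

definition has_weak_gradient ::
    "(real^'n::finite \<Rightarrow> real) \<Rightarrow> (real^'n \<Rightarrow> real^'n) \<Rightarrow> bool" where
  "has_weak_gradient u G \<longleftrightarrow>
     locally_integrable u \<and> locally_integrable G \<and>
     (\<forall>\<phi>\<in>Cc_infty. \<forall>i.
        (LINT x|lebesgue. u x * partial_deriv i \<phi> x) = - (LINT x|lebesgue. G x $ i * \<phi> x))"

text \<open>The weak gradient is unique up to null sets; we fix one representative.\<close>

definition weak_grad :: "(real^'n::finite \<Rightarrow> real) \<Rightarrow> real^'n \<Rightarrow> real^'n" where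
  "weak_grad u = (SOME G. has_weak_gradient u G)"

text \<open>The space \<open>L\<^sup>q(\<real>\<^sup>N, k)\<close> for a measurable weight \<open>k \<ge> 0\<close>.\<close>

definition weighted_Lq :: "real \<Rightarrow> (real^'n::finite \<Rightarrow> real) \<Rightarrow> (real^'n \<Rightarrow> real) set" where
  "weighted_Lq q k =
     {u. u \<in> borel_measurable lebesgue \<and> integrable lebesgue (\<lambda>x. k x * \<bar>u x\<bar> powr q)}"

definition sobolev_exponent :: "'n::finite itself \<Rightarrow> real" where
  "sobolev_exponent _ = 2 * real CARD('n) / (real CARD('n) - 2)"

definition dirichlet_energy :: "(real^'n::finite \<Rightarrow> real) \<Rightarrow> real" where
  "dirichlet_energy u = (LINT x|lebesgue. (norm (weak_grad u x))\<^sup>2)"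

text \<open>
  The closure of \<open>C\<^sub>c\<^sup>\<infinity>\<close> in \<open>L\<^sup>2\<^sup>*\<close> with respect to the norm of the gradient in \<open>L\<^sup>2\<close>. Without the
  explicit integrability condition, the Bochner integrals in the limit could be the default
  value \<open>0\<close>.
\<close>

definition D12 :: "(real^'n::finite \<Rightarrow> real) set" where
  "D12 =
     {u \<in> weighted_Lq (sobolev_exponent TYPE('n)) (\<lambda>_. 1).
        (\<exists>G. has_weak_gradient u G) \<and>
        integrable lebesgue (\<lambda>x. (norm (weak_grad u x))\<^sup>2) \<and>
        (\<exists>\<phi>. (\<forall>n::nat. \<phi> n \<in> Cc_infty) \<and>
             (\<lambda>n. LINT x|lebesgue. (norm (weak_grad u x - classical_grad (\<phi> n) x))\<^sup>2)
               \<longlonglongrightarrow> 0)}"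

definition D12_on :: "(real^'n::finite) set \<Rightarrow> (real^'n \<Rightarrow> real) set" where
  "D12_on \<Omega> = {u \<in> D12. AE x in lebesgue. x \<notin> \<Omega> \<longrightarrow> u x = 0}"

definition energy_space ::
    "real \<Rightarrow> (real^'n::finite \<Rightarrow> real) \<Rightarrow> (real^'n \<Rightarrow> real) \<Rightarrow> (real^'n \<Rightarrow> real) set" where
  "energy_space p V h =
     D12 \<inter> weighted_Lq 2 (\<lambda>x. \<bar>V x\<bar>) \<inter> weighted_Lq p (\<lambda>x. \<bar>h x\<bar>)"

text \<open>
  Weak solutions of \<open>-\<Delta>u - l V u + h u\<^sup>p\<^sup>-\<^sup>1 = 0\<close> in \<open>\<real>\<^sup>N\<close>, \<open>u \<ge> 0\<close>, \<open>u \<noteq> 0\<close>.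
\<close>

definition weak_solution ::
    "real \<Rightarrow> (real^'n::finite \<Rightarrow> real) \<Rightarrow> (real^'n \<Rightarrow> real) \<Rightarrow> real \<Rightarrow> (real^'n \<Rightarrow> real) \<Rightarrow> bool" where
  "weak_solution p V h l u \<longleftrightarrow>
     u \<in> energy_space p V h \<and>
     (AE x in lebesgue. 0 \<le> u x) \<and> \<not> (AE x in lebesgue. u x = 0) \<and>
     (\<forall>\<phi>\<in>Cc_infty.
        (LINT x|lebesgue. weak_grad u x \<bullet> classical_grad \<phi> x)
        - l * (LINT x|lebesgue. V x * u x * \<phi> x)
        + (LINT x|lebesgue. h x * u x powr (p - 1) * \<phi> x) = 0)"

definition positive_weak_solution ::
    "real \<Rightarrow> (real^'n::finite \<Rightarrow> real) \<Rightarrow> (real^'n \<Rightarrow> real) \<Rightarrow> real \<Rightarrow> (real^'n \<Rightarrow> real) \<Rightarrow> bool" where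
  "positive_weak_solution p V h l u \<longleftrightarrow>
     weak_solution p V h l u \<and> (AE x in lebesgue. 0 < u x)"

definition lambda1_admissible ::
    "(real^'n::finite) set \<Rightarrow> (real^'n \<Rightarrow> real) \<Rightarrow> (real^'n \<Rightarrow> real) set" where
  "lambda1_admissible \<Omega> V =
     {u \<in> D12_on \<Omega> \<inter> weighted_Lq 2 (\<lambda>x. \<bar>V x\<bar>). (LINT x|lebesgue. V x * \<bar>u x\<bar>\<^sup>2) = 1}"

text \<open>In \<^typ>\<open>ereal\<close> the infimum over the empty set is \<open>\<infinity>\<close>.\<close>

definition lambda1 :: "(real^'n::finite) set \<Rightarrow> (real^'n \<Rightarrow> real) \<Rightarrow> ereal" where
  "lambda1 \<Omega> V = (INF u\<in>lambda1_admissible \<Omega> V. ereal (dirichlet_energy u))"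

definition lambda1_attained :: "(real^'n::finite) set \<Rightarrow> (real^'n \<Rightarrow> real) \<Rightarrow> bool" where
  "lambda1_attained \<Omega> V \<longleftrightarrow>
     (\<exists>u\<in>lambda1_admissible \<Omega> V. ereal (dirichlet_energy u) = lambda1 \<Omega> V)"

end

theory Submission
  imports Defs
begin

text \<open>
  The theorem is Picone's identity, applied to a positive weak solution \<open>u\<close> and a competitor \<open>w\<close>
  in the definition of \<open>\<lambda>\<^sub>1\<close>, which vanishes wherever \<open>h > 0\<close>. Testing the equation with \<open>w\<^sup>2/u\<close> gives,
  formally,
  \<open>\<integral>|\<nabla>w|\<^sup>2 - \<integral>|\<nabla>w - (w/u)\<nabla>u|\<^sup>2 = l \<integral>V w\<^sup>2 - \<integral>h u\<^sup>p\<^sup>-\<^sup>2 w\<^sup>2 \<ge> l \<integral>V w\<^sup>2 = l\<close>,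
  because \<open>h \<le> 0\<close> wherever \<open>w \<noteq> 0\<close>. So \<open>l\<close> is at most the energy of every competitor, that is
  \<open>l \<le> \<lambda>\<^sub>1\<close>. If \<open>l = \<lambda>\<^sub>1\<close> is the energy of \<open>w\<close>, then the subtracted defect vanishes, so
  \<open>\<nabla>w = (w/u)\<nabla>u\<close> and \<open>w/u\<close> is constant. But \<open>w\<close> vanishes on the nonempty open set \<open>{h > 0}\<close> and
  \<open>u\<close> does not, so \<open>w = 0\<close>, against \<open>\<integral>V w\<^sup>2 = 1\<close>.
  
  Since \<open>w\<^sup>2/u\<close> is not a test function, it is replaced by \<open>(\<eta> T(w))\<^sup>2/(u + \<epsilon>)\<close> with a cutoff \<open>\<eta>\<close> and a
  bounded smooth \<open>T\<close>. If \<open>u\<close> and \<open>w\<close> are mollified, this becomes a member of \<open>C\<^sub>c\<^sup>\<infinity>\<close>, because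
  mollification preserves \<open>u \<ge> 0\<close>; hence no chain rule for weak derivatives is needed, only the
  convergence of mollified functions and gradients in \<open>L\<^sup>2\<close>. The result is \<open>picone_identity\<close>. For
  \<open>energy_ge\<close> all regularizations are removed at once, with \<open>\<eta>\<close> spread over a ball of radius \<open>k\<close>,
  \<open>T(t) = k sin(t/k)\<close> and \<open>\<epsilon> = 1/k\<close>. The one term that needs care is \<open>T(w)\<nabla>\<eta>\<close>, which tends to \<open>0\<close> in
  \<open>L\<^sup>2\<close> because \<open>w\<close> lies in \<open>L\<^sup>2\<^sup>*\<close> (\<open>cutoff_grad_tendsto\<close>).
  
  In the equality case (\<open>energy_eq_imp_grad\<close>) the quotient \<open>w/u\<close> is replaced by the bounded function
  \<open>w\<^sup>2/(u\<^sup>2 + w\<^sup>2)\<close>. Its weak gradient is \<open>0\<close> (\<open>quotient_zero_weak_gradient\<close>): with \<open>u + \<epsilon>\<close> in place of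
  \<open>u\<close> the gradient is dominated by \<open>|\<nabla>u|/u\<close>, and this is locally square integrable by Picone's
  identity with a cutoff alone in the place of \<open>w\<close> (\<open>log_gradient_square_integrable\<close>). A
  nonnegative function with weak gradient \<open>0\<close> that vanishes on a nonempty open set vanishes almost
  everywhere (\<open>zero_weak_gradient_vanishes\<close>).
\<close>

section \<open>Smooth functions\<close>

definition smooth :: "(real^'n::finite \<Rightarrow> real) \<Rightarrow> bool" where
  "smooth f \<longleftrightarrow> (\<forall>k. C_k k f)"

lemma partial_deriv_eq:
  assumes "(f has_derivative D) (at x)"
  shows "partial_deriv i f x = D (axis i 1)"
  using frechet_derivative_at[OF assms] by (simp add: partial_deriv_def)

lemma has_derivative_classical_grad:
  fixes f :: "real^'n::finite \<Rightarrow> real"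
  assumes "f differentiable (at x)"
  shows "(f has_derivative (\<lambda>h. classical_grad f x \<bullet> h)) (at x)"
proof -
  let ?D = "frechet_derivative f (at x)"
  have D: "(f has_derivative ?D) (at x)"
    using assms by (simp add: frechet_derivative_works)
  interpret bounded_linear ?D by (rule has_derivative_bounded_linear[OF D])
  have "?D h = classical_grad f x \<bullet> h" for h
  proof -
    have "?D h = ?D (\<Sum>i\<in>UNIV. (h $ i) *\<^sub>R axis i 1)"
      by (metis (no_types, lifting) basis_expansion scalar_mult_eq_scaleR sum.cong)
    also have "\<dots> = (\<Sum>i\<in>UNIV. (h $ i) * ?D (axis i 1))"
      by (simp add: sum scaleR)
    finally show ?thesis
      by (simp add: classical_grad_def partial_deriv_def inner_vec_def mult.commute)
  qed
  then show ?thesis using D by presburger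
qed

lemma classical_grad_eq:
  assumes "(f has_derivative (\<lambda>h. g \<bullet> h)) (at x)"
  shows "classical_grad f x = g"
  by (simp add: classical_grad_def partial_deriv_eq[OF assms] vec_eq_iff inner_axis)

lemma C_k_Suc_imp: "C_k (Suc k) f \<Longrightarrow> C_k k f"
proof (induction k arbitrary: f)
  case 0
  then show ?case
    by (auto intro!: continuous_at_imp_continuous_on differentiable_imp_continuous_within)
next
  case (Suc k)
  then show ?case by (metis C_k.simps(2))
qed

lemma C_k_imp_continuous: "C_k k f \<Longrightarrow> continuous_on UNIV f"
  by (induction k) (use C_k_Suc_imp in auto)

lemma partial_deriv_const: "partial_deriv i (\<lambda>_. c) = (\<lambda>_. 0)"
  by (rule ext, rule partial_deriv_eq) auto

lemma C_k_const: "C_k k (\<lambda>_. c)"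
  by (induction k arbitrary: c) (auto simp: partial_deriv_const)

lemma partial_deriv_add:
  assumes "f differentiable (at x)" "g differentiable (at x)"
  shows "partial_deriv i (\<lambda>x. f x + g x) x = partial_deriv i f x + partial_deriv i g x"
  using partial_deriv_eq[OF has_derivative_add[OF has_derivative_classical_grad[OF assms(1)]
        has_derivative_classical_grad[OF assms(2)]]]
  by (simp add: inner_axis classical_grad_def)

lemma partial_deriv_mult:
  assumes "f differentiable (at x)" "g differentiable (at x)"
  shows "partial_deriv i (\<lambda>x. f x * g x) x
    = f x * partial_deriv i g x + partial_deriv i f x * g x"
  using partial_deriv_eq[OF has_derivative_mult[OF has_derivative_classical_grad[OF assms(1)]
        has_derivative_classical_grad[OF assms(2)]]]
  by (simp add: inner_axis classical_grad_def)

lemma C_k_add: "C_k k f \<Longrightarrow> C_k k g \<Longrightarrow> C_k k (\<lambda>x. f x + g x)"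
proof (induction k arbitrary: f g)
  case (Suc k)
  then have "partial_deriv i (\<lambda>x. f x + g x) = (\<lambda>x. partial_deriv i f x + partial_deriv i g x)" for i
    by (intro ext partial_deriv_add) auto
  then show ?case using Suc by auto
qed (auto intro: continuous_intros)

lemma C_k_mult: "C_k k f \<Longrightarrow> C_k k g \<Longrightarrow> C_k k (\<lambda>x. f x * g x)"
proof (induction k arbitrary: f g)
  case (Suc k)
  then have "partial_deriv i (\<lambda>x. f x * g x)
      = (\<lambda>x. f x * partial_deriv i g x + partial_deriv i f x * g x)" for i
    by (intro ext partial_deriv_mult) auto
  moreover have "C_k k f" "C_k k g" using Suc.prems C_k_Suc_imp by blast+
  ultimately show ?case using Suc by (auto intro!: C_k_add)
qed (auto intro: continuous_intros)

text \<open>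
  The outer function is given with all its derivatives \<open>G 0, G 1, \<dots>\<close>, because the induction needs
  the statement for the composition with each of them.
\<close>

lemma C_k_compose:
  assumes G: "\<And>j t. t \<in> S \<Longrightarrow> (G j has_real_derivative G (Suc j) t) (at t)"
    and S: "\<And>x. f x \<in> S"
  shows "C_k k f \<Longrightarrow> C_k k (\<lambda>x. G j (f x))"
proof (induction k arbitrary: j)
  case 0
  have "continuous_on S (G j)"
    by (meson G DERIV_isCont continuous_at_imp_continuous_on)
  then show ?case using 0 S
    by (auto intro: continuous_on_compose2)
next
  case (Suc k)
  have D: "((\<lambda>x. G j (f x)) has_derivative
      (\<lambda>h. G (Suc j) (f x) * (classical_grad f x \<bullet> h))) (at x)" for x
    using has_derivative_compose[OF has_derivative_classical_grad
        G[OF S, unfolded has_field_derivative_def]] Suc.prems by fastforce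
  then have "partial_deriv i (\<lambda>x. G j (f x)) = (\<lambda>x. G (Suc j) (f x) * partial_deriv i f x)" for i
    by (intro ext) (simp add: partial_deriv_eq[OF D] inner_axis classical_grad_def)
  moreover have "C_k k (\<lambda>x. G (Suc j) (f x) * partial_deriv i f x)" for i
    using Suc C_k_Suc_imp by (intro C_k_mult) auto
  ultimately show ?case using D by (auto simp: differentiable_def)
qed

lemma C_k_affine: "C_k k f \<Longrightarrow> C_k k (\<lambda>x. f (a + c *\<^sub>R x))"
proof (induction k arbitrary: f)
  case 0
  then show ?case by (auto intro!: continuous_intros continuous_on_compose2[of UNIV f])
next
  case (Suc k)
  have D: "((\<lambda>x. f (a + c *\<^sub>R x)) has_derivative
      (\<lambda>h. classical_grad f (a + c *\<^sub>R x) \<bullet> (c *\<^sub>R h))) (at x)" for x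
    by (rule has_derivative_compose[of _ _ _ _ f, OF _ has_derivative_classical_grad])
      (use Suc.prems in \<open>auto intro!: derivative_eq_intros\<close>)
  then have "partial_deriv i (\<lambda>x. f (a + c *\<^sub>R x)) = (\<lambda>x. c * partial_deriv i f (a + c *\<^sub>R x))" for i
    by (intro ext) (simp add: partial_deriv_eq[OF D] inner_axis classical_grad_def)
  moreover have "C_k k (\<lambda>x. c * partial_deriv i f (a + c *\<^sub>R x))" for i
    using Suc by (intro C_k_mult C_k_const) auto
  ultimately show ?case using D by (auto simp: differentiable_def)
qed

lemma C_k_component: "C_k k (\<lambda>x::real^'n::finite. x $ i)"
proof (cases k)
  case (Suc m)
  have D: "((\<lambda>x::real^'n. x $ i) has_derivative (\<lambda>h. h $ i)) (at x)" for x
    by (rule bounded_linear_imp_has_derivative) (rule bounded_linear_vec_nth)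
  then have "partial_deriv j (\<lambda>x::real^'n. x $ i) = (\<lambda>_. axis j 1 $ i)" for j :: 'n
    by (intro ext) (simp add: partial_deriv_eq[OF D])
  then show ?thesis using D by (auto simp: Suc differentiable_def C_k_const)
qed (auto intro: continuous_intros)

lemma smooth_const [intro, simp]: "smooth (\<lambda>_. c)"
  by (simp add: smooth_def C_k_const)

lemma smooth_add: "smooth f \<Longrightarrow> smooth g \<Longrightarrow> smooth (\<lambda>x. f x + g x)"
  by (simp add: smooth_def C_k_add)

lemma smooth_mult: "smooth f \<Longrightarrow> smooth g \<Longrightarrow> smooth (\<lambda>x. f x * g x)"
  by (simp add: smooth_def C_k_mult)

lemma smooth_power: "smooth f \<Longrightarrow> smooth (\<lambda>x. f x ^ m)"
  by (induction m) (auto intro: smooth_mult)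

lemma smooth_affine: "smooth f \<Longrightarrow> smooth (\<lambda>x. f (a + c *\<^sub>R x))"
  by (simp add: smooth_def C_k_affine)

lemma smooth_component: "smooth (\<lambda>x. x $ i)"
  by (simp add: smooth_def C_k_component)

lemma smooth_sum: "finite I \<Longrightarrow> (\<And>i. i \<in> I \<Longrightarrow> smooth (f i)) \<Longrightarrow> smooth (\<lambda>x. \<Sum>i\<in>I. f i x)"
  by (induction I rule: finite_induct) (auto intro: smooth_add)

lemma smooth_norm_power2: "smooth (\<lambda>x. (norm x)\<^sup>2)"
proof -
  have "smooth (\<lambda>x::real^'n. \<Sum>i\<in>UNIV. x $ i * x $ i)"
    by (intro smooth_sum smooth_mult smooth_component) auto
  then show ?thesis
    by (simp add: power2_norm_eq_inner inner_vec_def)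
qed

lemma smooth_partial_deriv: "smooth f \<Longrightarrow> smooth (partial_deriv i f)"
  unfolding smooth_def by (metis C_k.simps(2))

lemma smooth_imp_differentiable: "smooth f \<Longrightarrow> f differentiable (at x)"
  unfolding smooth_def by (metis C_k.simps(2))

lemma smooth_imp_continuous: "smooth f \<Longrightarrow> continuous_on UNIV f"
  unfolding smooth_def by (metis C_k_imp_continuous)

lemma smooth_has_derivative:
  "smooth f \<Longrightarrow> (f has_derivative (\<lambda>h. classical_grad f x \<bullet> h)) (at x)"
  by (simp add: has_derivative_classical_grad smooth_imp_differentiable)

lemma smooth_compose:
  assumes "\<And>j t. t \<in> S \<Longrightarrow> (G j has_real_derivative G (Suc j) t) (at t)"
    and "\<And>x. f x \<in> S" and "smooth f"
  shows "smooth (\<lambda>x. G j (f x))"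
  using assms unfolding smooth_def by (metis C_k_compose)

lemma smooth_inverse:
  assumes f: "smooth f" and pos: "\<And>x. f x > 0"
  shows "smooth (\<lambda>x. inverse (f x))"
proof -
  let ?G = "\<lambda>j t. (-1) ^ j * fact j * inverse (t ^ Suc j) :: real"
  have "(?G j has_real_derivative ?G (Suc j) t) (at t)" if "t \<in> {0<..}" for j t
  proof -
    have "((\<lambda>t. inverse (t ^ Suc j)) has_real_derivative
        - (inverse (t ^ Suc j) * (real (Suc j) * t ^ j) * inverse (t ^ Suc j))) (at t)"
      using that DERIV_pow[of "Suc j" t UNIV] by (intro DERIV_inverse') auto
    also have "- (inverse (t ^ Suc j) * (real (Suc j) * t ^ j) * inverse (t ^ Suc j))
        = - real (Suc j) * inverse (t ^ Suc (Suc j))"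
      using that by (simp add: divide_simps)
    finally show ?thesis
      by (rule DERIV_cong[OF DERIV_cmult]) (simp add: algebra_simps)
  qed
  from smooth_compose[where G = ?G and j = 0 and S = "{0<..}", OF this _ f] show ?thesis
    using pos by simp
qed

text \<open>
  The functions \<open>P(1/t) exp(-1/t)\<close> on \<open>t > 0\<close>, extended by \<open>0\<close>, form a family that is closed under
  differentiation: on \<open>t > 0\<close> this is the chain rule, and at \<open>0\<close> the exponential beats every
  polynomial in \<open>1/t\<close>. So all of them are smooth; \<open>P = 1\<close> gives the usual bump function.
\<close>

definition flat :: "real poly \<Rightarrow> real \<Rightarrow> real" where
  "flat P t = (if t > 0 then poly P (inverse t) * exp (- inverse t) else 0)"

definition flat_deriv :: "real poly \<Rightarrow> real poly" where
  "flat_deriv P = monom 1 2 * (P - pderiv P)"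

lemma poly_times_exp_tendsto_0: "((\<lambda>s::real. poly P s * exp (- s)) \<longlongrightarrow> 0) at_top"
proof -
  have "((\<lambda>s::real. \<Sum>i\<le>degree P. coeff P i * (s ^ i / exp s)) \<longlongrightarrow> (\<Sum>i\<le>degree P. coeff P i * 0)) at_top"
    by (intro tendsto_sum tendsto_mult tendsto_const tendsto_power_div_exp_0)
  then show ?thesis
    by (simp add: poly_altdef sum_distrib_right exp_minus divide_inverse mult.assoc)
qed

lemma flat_has_derivative: "(flat P has_real_derivative flat (flat_deriv P) t) (at t)"
proof -
  consider "t > 0" | "t < 0" | "t = 0" by linarith
  then show ?thesis
  proof cases
    case 1
    have "((\<lambda>t. poly P (inverse t) * exp (- inverse t)) has_real_derivative flat (flat_deriv P) t) (at t)"
      using 1 by (auto intro!: derivative_eq_intros DERIV_chain'[OF _ poly_DERIV]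
          simp: flat_def flat_deriv_def poly_monom field_simps power2_eq_square)
    then show ?thesis
      by (rule has_field_derivative_transform_within_open[of _ _ _ "{0<..}"])
        (use 1 in \<open>auto simp: flat_def\<close>)
  next
    case 2
    have "((\<lambda>t. 0) has_real_derivative flat (flat_deriv P) t) (at t)"
      using 2 by (auto simp: flat_def)
    then show ?thesis
      by (rule has_field_derivative_transform_within_open[of _ _ _ "{..<0}"])
        (use 2 in \<open>auto simp: flat_def\<close>)
  next
    case 3
    have R: "((\<lambda>h. flat P h / h) \<longlongrightarrow> 0) (at_right 0)"
    proof -
      have "((\<lambda>h. poly (P * monom 1 1) (inverse h) * exp (- inverse h)) \<longlongrightarrow> 0) (at_right (0::real))"
        using filterlim_compose[OF poly_times_exp_tendsto_0 filterlim_inverse_at_top_right] .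
      moreover have "\<forall>\<^sub>F h in at_right 0.
          poly (P * monom 1 1) (inverse h) * exp (- inverse h) = flat P h / h"
        unfolding eventually_at_right_field
        by (intro exI[of _ 1]) (auto simp: flat_def poly_monom field_simps)
      ultimately show ?thesis by (rule Lim_transform_eventually)
    qed
    have L: "((\<lambda>h. flat P h / h) \<longlongrightarrow> 0) (at_left 0)"
    proof -
      have "\<forall>\<^sub>F h in at_left 0. 0 = flat P h / h"
        unfolding eventually_at_left_field
        by (intro exI[of _ "-1"]) (auto simp: flat_def)
      then show ?thesis by (rule Lim_transform_eventually[OF tendsto_const])
    qed
    have "((\<lambda>h. flat P h / h) \<longlongrightarrow> 0) (at 0)"
      using L R by (rule filterlim_split_at)
    then show ?thesis
      using 3 by (simp add: has_field_derivative_iff flat_def)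
  qed
qed

lemma smooth_flat:
  assumes "smooth f"
  shows "smooth (\<lambda>x. flat 1 (f x))"
proof -
  let ?G = "\<lambda>j. flat ((flat_deriv ^^ j) 1)"
  have "(?G j has_real_derivative ?G (Suc j) t) (at t)" if "t \<in> UNIV" for j t
    using flat_has_derivative by simp
  from smooth_compose[where G = ?G and j = 0 and S = UNIV, OF this _ assms] show ?thesis by simp
qed

definition bump :: "real^'n::finite \<Rightarrow> real" where
  "bump x = flat 1 (1 - (norm x)\<^sup>2)"

lemma smooth_bump: "smooth bump"
proof -
  have "smooth (\<lambda>x::real^'n. 1 + (-1) * (norm x)\<^sup>2)"
    by (intro smooth_add smooth_mult smooth_const smooth_norm_power2)
  from smooth_flat[OF this] show ?thesis by (simp add: bump_def[abs_def])
qed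

lemma bump_nonneg: "bump x \<ge> 0"
  and bump_le: "bump x \<le> bump 0"
  and bump_pos_iff: "bump x > 0 \<longleftrightarrow> norm x < 1"
  and bump_zero: "norm x \<ge> 1 \<Longrightarrow> bump x = 0"
  and bump_minus: "bump (- x) = bump x"
proof -
  have "norm x < 1 \<longleftrightarrow> (norm x)\<^sup>2 < 1"
    by (simp add: abs_square_less_1)
  then show "bump x > 0 \<longleftrightarrow> norm x < 1" and "bump x \<ge> 0"
    by (auto simp: bump_def flat_def)
  show "norm x \<ge> 1 \<Longrightarrow> bump x = 0" using \<open>norm x < 1 \<longleftrightarrow> (norm x)\<^sup>2 < 1\<close>
    by (auto simp: bump_def flat_def)
  have "inverse (1 - (norm x)\<^sup>2) \<ge> 1" if "(norm x)\<^sup>2 < 1"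
    using that one_le_inverse[of "1 - (norm x)\<^sup>2"] by simp
  then show "bump x \<le> bump 0"
    by (auto simp: bump_def flat_def)
  show "bump (- x) = bump x" by (simp add: bump_def)
qed

lemma Cc_inftyI:
  assumes "smooth f" "\<And>x. norm x > R \<Longrightarrow> f x = 0"
  shows "f \<in> Cc_infty"
proof -
  have "closure {x. f x \<noteq> 0} \<subseteq> cball 0 R"
    by (rule closure_minimal) (use assms(2) in \<open>auto simp: not_less[symmetric]\<close>)
  then have "compact (closure {x. f x \<noteq> 0})"
    by (metis bounded_cball bounded_subset closed_closure compact_eq_bounded_closed)
  then show ?thesis using assms(1) by (simp add: Cc_infty_def smooth_def)
qed

lemma Cc_infty_smooth: "f \<in> Cc_infty \<Longrightarrow> smooth f"
  by (simp add: Cc_infty_def smooth_def)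

lemma Cc_infty_support:
  assumes "f \<in> Cc_infty"
  obtains R where "R > 0" "\<And>x. norm x > R \<Longrightarrow> f x = 0"
proof -
  have "bounded (closure {x. f x \<noteq> 0})"
    using assms by (auto simp: Cc_infty_def compact_imp_bounded)
  then obtain R where "R > 0" "\<And>x. x \<in> closure {x. f x \<noteq> 0} \<Longrightarrow> norm x \<le> R"
    by (auto simp: bounded_pos)
  then have "f x = 0" if "norm x > R" for x
    using that closure_subset[of "{x. f x \<noteq> 0}"] by (meson mem_Collect_eq not_le subsetD)
  then show ?thesis using that \<open>R > 0\<close> by blast
qed

lemma partial_deriv_zero_outside:
  assumes "\<And>x. norm x > R \<Longrightarrow> f x = 0" "norm x > R"
  shows "partial_deriv i f x = 0"
proof -
  have "((\<lambda>x. 0) has_derivative (\<lambda>h. 0)) (at x)" by simp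
  then have "(f has_derivative (\<lambda>h. 0)) (at x)"
    by (rule has_derivative_transform_within_open[of _ _ _ _ "- cball 0 R"]) (use assms in auto)
  from partial_deriv_eq[OF this] show ?thesis by simp
qed

lemma Cc_infty_partial_deriv:
  assumes f: "f \<in> Cc_infty"
  shows "partial_deriv i f \<in> Cc_infty"
proof -
  obtain R where R: "\<And>x. norm x > R \<Longrightarrow> f x = 0"
    using Cc_infty_support[OF f] by metis
  show ?thesis
    by (rule Cc_inftyI[where R = R])
      (simp_all add: smooth_partial_deriv Cc_infty_smooth f partial_deriv_zero_outside[of R f] R)
qed

lemma Cc_infty_mult:
  assumes f: "f \<in> Cc_infty" and g: "smooth g"
  shows "(\<lambda>x. f x * g x) \<in> Cc_infty"
proof -
  obtain R where R: "\<And>x. norm x > R \<Longrightarrow> f x = 0"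
    using Cc_infty_support[OF f] by metis
  show ?thesis
    by (rule Cc_inftyI[where R = R]) (simp_all add: smooth_mult Cc_infty_smooth f g R)
qed

lemma Cc_infty_affine:
  assumes f: "f \<in> Cc_infty" and c: "c \<noteq> 0"
  shows "(\<lambda>x. f (a + c *\<^sub>R x)) \<in> Cc_infty"
proof -
  obtain R where R: "\<And>x. norm x > R \<Longrightarrow> f x = 0"
    using Cc_infty_support[OF f] by metis
  show ?thesis
  proof (rule Cc_inftyI)
    show "smooth (\<lambda>x. f (a + c *\<^sub>R x))" by (intro smooth_affine Cc_infty_smooth f)
    show "f (a + c *\<^sub>R x) = 0" if "norm x > (R + norm a) / \<bar>c\<bar>" for x
    proof (rule R)
      have "R + norm a < norm (c *\<^sub>R x)" using that c by (simp add: field_simps)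
      also have "\<dots> \<le> norm (a + c *\<^sub>R x) + norm a"
        using norm_triangle_ineq4[of "a + c *\<^sub>R x" a] by simp
      finally show "R < norm (a + c *\<^sub>R x)" by simp
    qed
  qed
qed

lemma Cc_infty_continuous: "f \<in> Cc_infty \<Longrightarrow> continuous_on UNIV f"
  by (simp add: Cc_infty_smooth smooth_imp_continuous)

lemma smooth_continuous_grad: "smooth f \<Longrightarrow> continuous_on UNIV (classical_grad f)"
  unfolding classical_grad_def
  by (intro continuous_on_vec_lambda smooth_imp_continuous smooth_partial_deriv)

lemma compact_support_bounded:
  fixes f :: "real^'n::finite \<Rightarrow> 'b::real_normed_vector"
  assumes "continuous_on UNIV f" "\<And>x. norm x > R \<Longrightarrow> f x = 0"
  obtains B where "B > 0" "\<And>x. norm (f x) \<le> B"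
proof -
  have "bounded (f ` cball 0 R)"
    using assms(1) by (meson compact_cball compact_continuous_image compact_imp_bounded
        continuous_on_subset top_greatest)
  then obtain B where B: "B > 0" "\<And>x. x \<in> cball 0 R \<Longrightarrow> norm (f x) \<le> B"
    by (auto simp: bounded_pos)
  have "norm (f x) \<le> B" for x
    using B assms(2)[of x] by (cases "norm x \<le> R") auto
  then show ?thesis using that B(1) by blast
qed

lemma bump_Cc_infty: "bump \<in> Cc_infty"
  by (rule Cc_inftyI[where R = 1]) (auto simp: smooth_bump bump_zero)

section \<open>Square integrable functions\<close>

lemma continuous_lebesgue_measurable:
  fixes f :: "real^'n::finite \<Rightarrow> 'b::euclidean_space"
  assumes "continuous_on UNIV f"
  shows "f \<in> borel_measurable lebesgue" "f \<in> borel_measurable lborel"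
  using assms by (auto intro!: measurable_completion borel_measurable_continuous_onI)

lemma integrable_bounded_mult:
  fixes f g :: "'a \<Rightarrow> real"
  assumes f: "integrable M f" and g: "g \<in> borel_measurable M" "AE x in M. \<bar>g x\<bar> \<le> B"
  shows "integrable M (\<lambda>x. g x * f x)"
proof (rule Bochner_Integration.integrable_bound)
  show "integrable M (\<lambda>x. B * \<bar>f x\<bar>)" using f by simp
  show "(\<lambda>x. g x * f x) \<in> borel_measurable M" using f g by measurable
  show "AE x in M. norm (g x * f x) \<le> norm (B * \<bar>f x\<bar>)"
    using g(2)
  proof eventually_elim
    case (elim x)
    then have "B \<ge> 0" by linarith
    with elim show ?case by (simp add: abs_mult mult_right_mono)
  qed
qed

lemma norm_add_power2_le:
  fixes a b :: "'a::real_inner"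
  shows "(norm (a + b))\<^sup>2 \<le> 2 * (norm a)\<^sup>2 + 2 * (norm b)\<^sup>2"
proof -
  have "0 \<le> (norm (a - b))\<^sup>2" by simp
  then show ?thesis
    by (simp add: power2_norm_eq_inner inner_diff_left inner_diff_right inner_add_left
        inner_add_right inner_commute)
qed

lemma abs_inner_le_power2:
  fixes a b :: "'a::real_inner"
  shows "\<bar>a \<bullet> b\<bar> \<le> (norm a)\<^sup>2 + (norm b)\<^sup>2"
proof -
  have "\<bar>a \<bullet> b\<bar> \<le> norm a * norm b" by (rule Cauchy_Schwarz_ineq2)
  also have "\<dots> \<le> (norm a)\<^sup>2 + (norm b)\<^sup>2"
    using sum_squares_bound[of "norm a" "norm b"] mult_nonneg_nonneg[of "norm a" "norm b", OF norm_ge_zero norm_ge_zero]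
    by linarith
  finally show ?thesis .
qed

definition square_integrable :: "(real^'n::finite \<Rightarrow> 'b::euclidean_space) \<Rightarrow> bool" where
  "square_integrable f \<longleftrightarrow>
     f \<in> borel_measurable lebesgue \<and> integrable lebesgue (\<lambda>x. (norm (f x))\<^sup>2)"

lemma square_integrable_measurable [measurable_dest]:
  "square_integrable f \<Longrightarrow> f \<in> borel_measurable lebesgue"
  by (simp add: square_integrable_def)

lemma square_integrable_integrable:
  "square_integrable f \<Longrightarrow> integrable lebesgue (\<lambda>x. (norm (f x))\<^sup>2)"
  by (simp add: square_integrable_def)

lemma square_integrable_bound:
  fixes f :: "real^'n::finite \<Rightarrow> 'b::euclidean_space"
  assumes "f \<in> borel_measurable lebesgue" "integrable lebesgue g"
    and "AE x in lebesgue. (norm (f x))\<^sup>2 \<le> g x"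
  shows "square_integrable f"
  unfolding square_integrable_def
proof
  have "AE x in lebesgue. norm ((norm (f x))\<^sup>2) \<le> norm (g x)"
    using assms(3) by eventually_elim simp
  then show "integrable lebesgue (\<lambda>x. (norm (f x))\<^sup>2)"
    using assms(1) by (intro Bochner_Integration.integrable_bound[OF assms(2)]) measurable
qed (rule assms)

lemma square_integrable_add:
  assumes f: "square_integrable f" and g: "square_integrable g"
  shows "square_integrable (\<lambda>x. f x + g x)"
proof (rule square_integrable_bound)
  show "integrable lebesgue (\<lambda>x. 2 * (norm (f x))\<^sup>2 + 2 * (norm (g x))\<^sup>2)"
    using square_integrable_integrable[OF f] square_integrable_integrable[OF g] by simp
  show "(\<lambda>x. f x + g x) \<in> borel_measurable lebesgue"
    using square_integrable_measurable[OF f] square_integrable_measurable[OF g] by measurable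
qed (simp add: norm_add_power2_le)

lemma square_integrable_bounded_scaleR:
  fixes f :: "real^'n::finite \<Rightarrow> 'b::euclidean_space"
  assumes f: "square_integrable f" and a: "a \<in> borel_measurable lebesgue"
    and B: "AE x in lebesgue. \<bar>a x\<bar> \<le> B"
  shows "square_integrable (\<lambda>x. a x *\<^sub>R f x)"
proof (rule square_integrable_bound)
  show "integrable lebesgue (\<lambda>x. B\<^sup>2 * (norm (f x))\<^sup>2)"
    using square_integrable_integrable[OF f] by simp
  show "(\<lambda>x. a x *\<^sub>R f x) \<in> borel_measurable lebesgue"
    using square_integrable_measurable[OF f] a by measurable
  show "AE x in lebesgue. (norm (a x *\<^sub>R f x))\<^sup>2 \<le> B\<^sup>2 * (norm (f x))\<^sup>2"
    using B
  proof eventually_elim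
    case (elim x)
    then have "\<bar>a x\<bar>\<^sup>2 \<le> B\<^sup>2" by (intro power_mono) auto
    then show ?case by (simp add: power_mult_distrib mult_right_mono)
  qed
qed

lemma square_integrable_uminus: "square_integrable f \<Longrightarrow> square_integrable (\<lambda>x. - f x)"
  by (simp add: square_integrable_def)

lemma square_integrable_diff:
  assumes "square_integrable f" "square_integrable g"
  shows "square_integrable (\<lambda>x. f x - g x)"
  using square_integrable_add[OF assms(1) square_integrable_uminus[OF assms(2)]] by simp

lemma square_integrable_inner:
  assumes f: "square_integrable f" and g: "square_integrable g"
  shows "integrable lebesgue (\<lambda>x. f x \<bullet> g x)"
proof (rule Bochner_Integration.integrable_bound)
  show "integrable lebesgue (\<lambda>x. (norm (f x))\<^sup>2 + (norm (g x))\<^sup>2)"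
    using square_integrable_integrable[OF f] square_integrable_integrable[OF g] by simp
  show "(\<lambda>x. f x \<bullet> g x) \<in> borel_measurable lebesgue"
    using square_integrable_measurable[OF f] square_integrable_measurable[OF g] by measurable
  show "AE x in lebesgue. norm (f x \<bullet> g x) \<le> norm ((norm (f x))\<^sup>2 + (norm (g x))\<^sup>2)"
    by (simp add: abs_inner_le_power2)
qed

lemma continuous_compact_support_integrable:
  fixes f :: "real^'n::finite \<Rightarrow> 'b::euclidean_space"
  assumes f: "continuous_on UNIV f" "\<And>x. norm x > R \<Longrightarrow> f x = 0"
  shows "integrable lebesgue f"
proof -
  have "integrable lborel (\<lambda>x. indicator (cball 0 R) x *\<^sub>R f x)"
    by (intro borel_integrable_compact) (use f(1) continuous_on_subset in auto)
  then have "integrable lebesgue (\<lambda>x. indicator (cball 0 R) x *\<^sub>R f x)"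
    by (subst integrable_completion) auto
  moreover have "(\<lambda>x. indicator (cball 0 R) x *\<^sub>R f x) = f"
    by (rule ext) (use f(2) in \<open>auto simp: indicator_def\<close>)
  ultimately show ?thesis by simp
qed

lemma continuous_compact_support_square_integrable:
  fixes f :: "real^'n::finite \<Rightarrow> 'b::euclidean_space"
  assumes f: "continuous_on UNIV f" "\<And>x. norm x > R \<Longrightarrow> f x = 0"
  shows "square_integrable f"
  unfolding square_integrable_def
  using assms by (intro conjI continuous_lebesgue_measurable
      continuous_compact_support_integrable[where R = R])
    (auto intro!: continuous_intros)

lemma indicator_cball_integrable:
  "integrable lebesgue (indicat_real (cball (a :: real^'n::finite) R))"
  using lmeasurable_cball lmeasurable_iff_integrable by blast

text \<open>
  Local integrability only speaks of the functions cut off to compact sets; these are measurable and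
  converge pointwise.
\<close>

lemma locally_integrable_measurable:
  fixes f :: "real^'n::finite \<Rightarrow> 'b::euclidean_space"
  assumes "locally_integrable f"
  shows "f \<in> borel_measurable lebesgue"
proof (rule borel_measurable_LIMSEQ_metric)
  show "(\<lambda>x. indicat_real (cball 0 (real n)) x *\<^sub>R f x) \<in> borel_measurable lebesgue" for n
    using assms unfolding locally_integrable_def set_integrable_def
    by (meson borel_measurable_integrable compact_cball)
  show "(\<lambda>n. indicat_real (cball 0 (real n)) x *\<^sub>R f x) \<longlonglongrightarrow> f x" for x
  proof (rule tendsto_eventually)
    obtain m :: nat where "norm x \<le> real m" using real_arch_simple by blast
    then show "\<forall>\<^sub>F n in sequentially. indicat_real (cball 0 (real n)) x *\<^sub>R f x = f x"
      by (intro eventually_sequentiallyI[of m]) (auto simp: indicator_def)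
  qed
qed

lemma locally_integrable_mult_integrable:
  fixes f :: "real^'n::finite \<Rightarrow> real"
  assumes f: "locally_integrable f" and g: "g \<in> borel_measurable lebesgue"
    and B: "\<And>x. \<bar>g x\<bar> \<le> B" and R: "\<And>x. norm x > R \<Longrightarrow> g x = 0"
  shows "integrable lebesgue (\<lambda>x. g x * f x)"
proof -
  have "integrable lebesgue (\<lambda>x. indicator (cball 0 R) x *\<^sub>R f x)"
    using f unfolding locally_integrable_def set_integrable_def by simp
  from integrable_bounded_mult[OF this g] B
  have "integrable lebesgue (\<lambda>x. g x * (indicator (cball 0 R) x *\<^sub>R f x))" by auto
  moreover have "(\<lambda>x. g x * (indicator (cball 0 R) x *\<^sub>R f x)) = (\<lambda>x. g x * f x)"
    by (rule ext) (use R in \<open>auto simp: indicator_def\<close>)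
  ultimately show ?thesis by simp
qed

lemma locally_integrable_Cc_mult:
  fixes f :: "real^'n::finite \<Rightarrow> real"
  assumes f: "locally_integrable f" and g: "g \<in> Cc_infty"
  shows "integrable lebesgue (\<lambda>x. g x * f x)"
proof -
  obtain R where R: "\<And>x. norm x > R \<Longrightarrow> g x = 0"
    using Cc_infty_support[OF g] by metis
  obtain B where "\<And>x. norm (g x) \<le> B"
    using compact_support_bounded[OF Cc_infty_continuous[OF g] R] by metis
  then show ?thesis
    using continuous_lebesgue_measurable(1)[OF Cc_infty_continuous[OF g]] R
    by (intro locally_integrable_mult_integrable[OF f, of g B R]) auto
qed

lemma locally_integrable_dominated:
  fixes f :: "real^'n::finite \<Rightarrow> 'b::euclidean_space" and k g :: "real^'n \<Rightarrow> real"
  assumes f: "f \<in> borel_measurable lebesgue" and k: "locally_integrable k" and g: "integrable lebesgue g"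
    and le: "AE x in lebesgue. norm (f x) \<le> \<bar>k x\<bar> + \<bar>g x\<bar>"
  shows "locally_integrable f"
  unfolding locally_integrable_def set_integrable_def
proof (intro allI impI)
  fix K :: "(real^'n) set" assume K: "compact K"
  have kK: "integrable lebesgue (\<lambda>x. indicat_real K x *\<^sub>R k x)"
    using k K by (simp add: locally_integrable_def set_integrable_def)
  show "integrable lebesgue (\<lambda>x. indicat_real K x *\<^sub>R f x)"
  proof (rule Bochner_Integration.integrable_bound)
    show "integrable lebesgue (\<lambda>x. \<bar>indicat_real K x *\<^sub>R k x\<bar> + \<bar>g x\<bar>)"
      using integrable_abs[OF kK] integrable_abs[OF g] by (rule Bochner_Integration.integrable_add)
    show "(\<lambda>x. indicat_real K x *\<^sub>R f x) \<in> borel_measurable lebesgue"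
      using f K by (intro borel_measurable_scaleR borel_measurable_indicator)
        (auto intro: lmeasurable_compact fmeasurableD)
    show "AE x in lebesgue. norm (indicat_real K x *\<^sub>R f x) \<le> norm (\<bar>indicat_real K x *\<^sub>R k x\<bar> + \<bar>g x\<bar>)"
      using le by eventually_elim (auto simp: indicator_def)
  qed
qed

lemma locally_integrable_continuous:
  fixes f :: "real^'n::finite \<Rightarrow> real"
  assumes "continuous_on UNIV f"
  shows "locally_integrable f"
  unfolding locally_integrable_def set_integrable_def
proof (intro allI impI)
  fix K :: "(real^'n) set" assume K: "compact K"
  have "integrable lborel (\<lambda>x. indicator K x *\<^sub>R f x)"
    by (intro borel_integrable_compact K continuous_on_subset[OF assms]) auto
  then show "integrable lebesgue (\<lambda>x. indicat_real K x *\<^sub>R f x)"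
    using K by (subst integrable_completion) (auto dest: borel_measurable_integrable)
qed

lemma locally_integrable_const: "locally_integrable (\<lambda>_::real^'n::finite. c::real)"
  by (rule locally_integrable_continuous) simp

lemma integrable_locally_integrable:
  fixes f :: "real^'n::finite \<Rightarrow> real"
  assumes "integrable lebesgue f"
  shows "locally_integrable f"
  by (rule locally_integrable_dominated[OF _ locally_integrable_const[of 0] assms]) (use assms in auto)

lemma square_integrable_locally_integrable:
  fixes f :: "real^'n::finite \<Rightarrow> 'b::euclidean_space"
  assumes "square_integrable f"
  shows "locally_integrable f"
proof (rule locally_integrable_dominated[OF _ locally_integrable_const[of 1]])
  show "f \<in> borel_measurable lebesgue" "integrable lebesgue (\<lambda>x. (norm (f x))\<^sup>2)"
    using square_integrable_measurable[OF assms] square_integrable_integrable[OF assms] by auto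
  have "norm (f x) \<le> 1 + (norm (f x))\<^sup>2" for x
    using sum_squares_bound[of 1 "norm (f x)"] norm_ge_zero[of "f x"]
    unfolding one_power2 mult_1_right by linarith
  then show "AE x in lebesgue. norm (f x) \<le> \<bar>1\<bar> + \<bar>(norm (f x))\<^sup>2\<bar>" by simp
qed

section \<open>Convolution with test functions\<close>

definition conv :: "(real^'n::finite \<Rightarrow> real) \<Rightarrow> (real^'n \<Rightarrow> real) \<Rightarrow> real^'n \<Rightarrow> real" where
  "conv r f x = (LINT y|lebesgue. r (x - y) * f y)"

lemma Cc_infty_reflect: "r \<in> Cc_infty \<Longrightarrow> (\<lambda>y. r (x - y)) \<in> Cc_infty"
  using Cc_infty_affine[of r "-1" x] by simp

lemma conv_integrable:
  assumes "r \<in> Cc_infty" "locally_integrable f"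
  shows "integrable lebesgue (\<lambda>y. r (x - y) * f y)"
  using locally_integrable_Cc_mult[OF assms(2) Cc_infty_reflect[OF assms(1)]] .

lemma compact_support_uniformly_continuous:
  fixes f :: "real^'n::finite \<Rightarrow> 'b::real_normed_vector"
  assumes f: "continuous_on UNIV f" "\<And>x. norm x > R \<Longrightarrow> f x = 0" and e: "e > 0"
  obtains d where "d > 0" "d \<le> 1" "\<And>x y. norm (x - y) < d \<Longrightarrow> norm (f x - f y) < e"
proof -
  have "uniformly_continuous_on (cball 0 (R + 1)) f"
    using f(1) by (meson compact_cball compact_uniformly_continuous continuous_on_subset top_greatest)
  then obtain d where d: "d > 0"
    "\<And>x y. x \<in> cball 0 (R + 1) \<Longrightarrow> y \<in> cball 0 (R + 1) \<Longrightarrow> dist x y < d \<Longrightarrow> dist (f x) (f y) < e"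
    unfolding uniformly_continuous_on_def using e by metis
  have "norm (f x - f y) < e" if "norm (x - y) < min d 1" for x y
  proof (cases "norm x \<le> R + 1 \<and> norm y \<le> R + 1")
    case True
    then show ?thesis using d(2)[of x y] that by (auto simp: dist_norm)
  next
    case False
    then have "norm x > R" "norm y > R"
      using that norm_triangle_ineq3[of x y] by auto
    then show ?thesis using f(2) e by simp
  qed
  then show ?thesis using that[of "min d 1"] d(1) by auto
qed

text \<open>
  The gradient of a test function is uniformly continuous, so the first-order Taylor remainder is
  small relative to \<open>h\<close> uniformly in the base point. This is what makes differentiation under the
  convolution integral work.
\<close>

lemma Cc_infty_linearization:
  fixes r :: "real^'n::finite \<Rightarrow> real"
  assumes r: "r \<in> Cc_infty" and e: "e > 0"
  obtains d where "d > 0" "d \<le> 1"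
    "\<And>z h. norm h < d \<Longrightarrow> \<bar>r (z + h) - r z - classical_grad r z \<bullet> h\<bar> \<le> e * norm h"
proof -
  obtain R where R: "\<And>x. norm x > R \<Longrightarrow> r x = 0"
    using Cc_infty_support[OF r] by metis
  have "classical_grad r x = 0" if "norm x > R" for x
    using partial_deriv_zero_outside[OF R that] by (simp add: classical_grad_def vec_eq_iff)
  then obtain d where d: "d > 0" "d \<le> 1"
    "\<And>x y. norm (x - y) < d \<Longrightarrow> norm (classical_grad r x - classical_grad r y) < e"
    using compact_support_uniformly_continuous[OF smooth_continuous_grad[OF Cc_infty_smooth[OF r]] _ e]
    by metis
  have "\<bar>r (z + h) - r z - classical_grad r z \<bullet> h\<bar> \<le> e * norm h" if h: "norm h < d" for z h
  proof -
    have "norm (r (z + h) - r z - classical_grad r z \<bullet> ((z + h) - z)) \<le> norm ((z + h) - z) * e"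
    proof (rule differentiable_bound_linearization[where S = "ball z d"
          and f' = "\<lambda>x h. classical_grad r x \<bullet> h"])
      show "z + t *\<^sub>R (z + h - z) \<in> ball z d" if "t \<in> {0..1}" for t
      proof -
        have "norm (t *\<^sub>R h) \<le> 1 * norm h"
          using that by (auto intro!: mult_left_le_one_le)
        then show ?thesis using h by (simp add: dist_norm)
      qed
      show "(r has_derivative (\<lambda>h. classical_grad r x \<bullet> h)) (at x within ball z d)" for x
        using smooth_has_derivative[OF Cc_infty_smooth[OF r]] has_derivative_at_withinI by blast
      show "onorm ((\<lambda>h. classical_grad r x \<bullet> h) - (\<lambda>h. classical_grad r z \<bullet> h)) \<le> e"
        if "x \<in> ball z d" for x
      proof (rule onorm_le)
        fix v
        have "norm (((\<lambda>h. classical_grad r x \<bullet> h) - (\<lambda>h. classical_grad r z \<bullet> h)) v)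
            = \<bar>(classical_grad r x - classical_grad r z) \<bullet> v\<bar>"
          by (simp add: inner_diff_left)
        also have "\<dots> \<le> norm (classical_grad r x - classical_grad r z) * norm v"
          by (rule Cauchy_Schwarz_ineq2)
        also have "\<dots> \<le> e * norm v"
          using d(3)[of x z] that by (intro mult_right_mono) (auto simp: dist_norm norm_minus_commute)
        finally show "norm (((\<lambda>h. classical_grad r x \<bullet> h) - (\<lambda>h. classical_grad r z \<bullet> h)) v) \<le> e * norm v" .
      qed
      show "z \<in> ball z d" using d(1) by simp
    qed
    then show ?thesis by (simp add: mult.commute)
  qed
  then show ?thesis using that d by blast
qed

text \<open>
  For \<open>|h| \<le> 1\<close> the difference \<open>r (x + h - y) - r (x - y) - \<nabla>r (x - y) \<bullet> h\<close> is uniformly small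
  relative to \<open>h\<close> and vanishes for \<open>y\<close> outside a fixed ball, on which \<open>f\<close> is integrable.
\<close>

lemma conv_has_derivative:
  fixes r f :: "real^'n::finite \<Rightarrow> real"
  assumes r: "r \<in> Cc_infty" and f: "locally_integrable f"
  shows "(conv r f has_derivative (\<lambda>h. (\<chi> i. conv (partial_deriv i r) f x) \<bullet> h)) (at x)"
proof -
  obtain R where R: "R > 0" "\<And>x. norm x > R \<Longrightarrow> r x = 0"
    using Cc_infty_support[OF r] by metis
  let ?g = "classical_grad r"
  let ?K = "cball 0 (norm x + R + 1) :: (real^'n) set"
  have gh: "(\<lambda>y. (?g (x - y) \<bullet> h) * f y) = (\<lambda>y. \<Sum>i\<in>UNIV. h $ i * (partial_deriv i r (x - y) * f y))" for h
    by (simp add: classical_grad_def inner_vec_def sum_distrib_left sum_distrib_right mult_ac)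
  have ig: "integrable lebesgue (\<lambda>y. (?g (x - y) \<bullet> h) * f y)" for h
    unfolding gh by (intro Bochner_Integration.integrable_sum integrable_mult_right
        conv_integrable Cc_infty_partial_deriv r f)
  have D: "(\<chi> i. conv (partial_deriv i r) f x) \<bullet> h = (LINT y|lebesgue. (?g (x - y) \<bullet> h) * f y)" for h
  proof -
    have "integrable lebesgue (\<lambda>y. h $ i * (partial_deriv i r (x - y) * f y))" for i
      by (intro integrable_mult_right conv_integrable Cc_infty_partial_deriv r f)
    then show ?thesis
      unfolding gh
      by (subst Bochner_Integration.integral_sum) (simp_all add: conv_def inner_vec_def mult.commute)
  qed
  have iK: "integrable lebesgue (\<lambda>y. indicator ?K y * \<bar>f y\<bar>)"
  proof -
    have "integrable lebesgue (\<lambda>y. indicator ?K y *\<^sub>R f y)"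
      using f by (simp add: locally_integrable_def set_integrable_def)
    from integrable_abs[OF this] show ?thesis by (simp add: abs_mult)
  qed
  define I where "I = (LINT y|lebesgue. indicator ?K y * \<bar>f y\<bar>)"
  have I: "I \<ge> 0" unfolding I_def by (intro integral_nonneg_AE) auto
  show ?thesis
    unfolding has_derivative_at_alt
  proof (intro conjI allI impI)
    show "bounded_linear (\<lambda>h. (\<chi> i. conv (partial_deriv i r) f x) \<bullet> h)"
      by (rule bounded_linear_inner_right)
    fix e :: real assume e: "e > 0"
    then have e': "e / (I + 1) > 0" using I by simp
    obtain d where d: "d > 0" "d \<le> 1"
      "\<And>z h. norm h < d \<Longrightarrow> \<bar>r (z + h) - r z - ?g z \<bullet> h\<bar> \<le> e / (I + 1) * norm h"
      using Cc_infty_linearization[OF r e'] by metis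
    have "norm (conv r f x' - conv r f x - (\<chi> i. conv (partial_deriv i r) f x) \<bullet> (x' - x))
        \<le> e * norm (x' - x)" if x': "norm (x' - x) < d" for x'
    proof -
      let ?h = "x' - x"
      let ?F = "\<lambda>y. (r (x - y + ?h) - r (x - y) - ?g (x - y) \<bullet> ?h) * f y"
      have F: "?F = (\<lambda>y. r (x' - y) * f y - r (x - y) * f y - (?g (x - y) \<bullet> ?h) * f y)"
        by (simp add: algebra_simps)
      have "integral\<^sup>L lebesgue ?F = conv r f x' - conv r f x - (LINT y|lebesgue. (?g (x - y) \<bullet> ?h) * f y)"
        unfolding F conv_def by (simp add: conv_integrable[OF r f] ig)
      then have "conv r f x' - conv r f x - (\<chi> i. conv (partial_deriv i r) f x) \<bullet> ?h = integral\<^sup>L lebesgue ?F"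
        by (simp only: D)
      also have "norm \<dots> \<le> (LINT y|lebesgue. (e / (I + 1) * norm ?h) * (indicator ?K y * \<bar>f y\<bar>))"
      proof (rule Bochner_Integration.integral_norm_bound_integral)
        show "integrable lebesgue ?F"
          unfolding F by (simp add: conv_integrable[OF r f] ig)
        show "integrable lebesgue (\<lambda>y. (e / (I + 1) * norm ?h) * (indicator ?K y * \<bar>f y\<bar>))"
          using iK by simp
        show "norm (?F y) \<le> (e / (I + 1) * norm ?h) * (indicator ?K y * \<bar>f y\<bar>)" for y
        proof (cases "y \<in> ?K")
          case True
          have "\<bar>r (x - y + ?h) - r (x - y) - ?g (x - y) \<bullet> ?h\<bar> * \<bar>f y\<bar> \<le> (e / (I + 1) * norm ?h) * \<bar>f y\<bar>"
            by (intro mult_right_mono d(3)[OF x']) simp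
          then show ?thesis using True unfolding real_norm_def abs_mult by simp
        next
          case False
          have "norm (x - y) > R + 1"
            using False norm_triangle_ineq2[of y x] by (simp add: norm_minus_commute)
          moreover have "norm (x - y + ?h) > R"
            using calculation x' d(2) norm_triangle_ineq4[of "x - y + ?h" ?h] by simp
          moreover have "?g (x - y) = 0"
            using partial_deriv_zero_outside[of R r "x - y", OF R(2)] calculation(1)
            by (simp add: classical_grad_def vec_eq_iff)
          ultimately show ?thesis using R(2)[of "x - y"] R(2)[of "x - y + ?h"] False by simp
        qed
      qed
      also have "\<dots> = (e / (I + 1) * norm ?h) * I" by (simp add: I_def)
      also have "\<dots> = (e * norm ?h) * (I / (I + 1))" by simp
      also have "\<dots> \<le> (e * norm ?h) * 1" using e I by (intro mult_left_mono) auto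
      finally show ?thesis by simp
    qed
    then show "\<exists>d>0. \<forall>x'. norm (x' - x) < d \<longrightarrow>
        norm (conv r f x' - conv r f x - (\<chi> i. conv (partial_deriv i r) f x) \<bullet> (x' - x))
        \<le> e * norm (x' - x)"
      using d(1) by blast
  qed
qed

lemma classical_grad_conv:
  assumes "r \<in> Cc_infty" "locally_integrable f"
  shows "classical_grad (conv r f) x = (\<chi> i. conv (partial_deriv i r) f x)"
  by (rule classical_grad_eq[OF conv_has_derivative[OF assms]])

lemma partial_deriv_conv:
  assumes "r \<in> Cc_infty" "locally_integrable f"
  shows "partial_deriv i (conv r f) = conv (partial_deriv i r) f"
  by (rule ext) (use classical_grad_conv[OF assms] in \<open>simp add: classical_grad_def vec_eq_iff\<close>)

lemma smooth_conv:
  assumes r: "r \<in> Cc_infty" and f: "locally_integrable f"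
  shows "smooth (conv r f)"
proof -
  have "C_k k (conv r f)" for k
    using r
  proof (induction k arbitrary: r)
    case 0
    then show ?case
      using conv_has_derivative[OF _ f]
      by (auto intro!: continuous_at_imp_continuous_on has_derivative_continuous)
  next
    case (Suc k)
    then show ?case
      using conv_has_derivative[OF Suc.prems f] Cc_infty_partial_deriv
      by (auto simp: partial_deriv_conv[OF Suc.prems f] differentiable_def)
  qed
  then show ?thesis by (simp add: smooth_def)
qed

text \<open>
  The function \<open>y \<mapsto> r (x - y)\<close> is a test function, so the derivative that falls on the kernel can be
  moved to \<open>u\<close> by the definition of the weak gradient.
\<close>

lemma conv_weak_gradient:
  assumes r: "r \<in> Cc_infty" and u: "has_weak_gradient u G"
  shows "classical_grad (conv r u) x = (\<chi> i. conv r (\<lambda>y. G y $ i) x)"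
proof -
  have "conv (partial_deriv i r) u x = conv r (\<lambda>y. G y $ i) x" for i
  proof -
    let ?\<phi> = "\<lambda>y. r (x - y)"
    have "partial_deriv i ?\<phi> y = - partial_deriv i r (x - y)" for y
    proof -
      have "(?\<phi> has_derivative (\<lambda>h. classical_grad r (x - y) \<bullet> (- h))) (at y)"
        by (rule has_derivative_compose[of _ _ _ _ r, OF _ smooth_has_derivative])
          (auto intro!: derivative_eq_intros Cc_infty_smooth r)
      from partial_deriv_eq[OF this] show ?thesis
        by (simp add: inner_axis classical_grad_def)
    qed
    moreover have "(LINT y|lebesgue. u y * partial_deriv i ?\<phi> y) = - (LINT y|lebesgue. G y $ i * ?\<phi> y)"
      using u Cc_infty_reflect[OF r] by (auto simp: has_weak_gradient_def)
    ultimately show ?thesis by (simp add: conv_def mult.commute)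
  qed
  moreover have "locally_integrable u" using u by (simp add: has_weak_gradient_def)
  ultimately show ?thesis using r by (simp add: classical_grad_conv)
qed

text \<open>
  Lebesgue measure is invariant under \<open>y \<mapsto> x - y\<close>.
\<close>

lemma conv_1:
  assumes r: "r \<in> Cc_infty"
  shows "conv r (\<lambda>_. 1) x = (LINT y|lebesgue. r y)"
proof -
  have [measurable]: "r \<in> borel_measurable borel"
    using continuous_lebesgue_measurable(2)[OF Cc_infty_continuous[OF r]] by simp
  have "(LINT y|lborel. r y) = (LINT y|density (distr lborel borel (\<lambda>y. x + (-1) *\<^sub>R y)) (\<lambda>_. 1). r y)"
    using lborel_affine[of "-1" x] by simp
  also have "\<dots> = (LINT y|lborel. r (x - y))"
    by (simp add: density_1 integral_distr)
  finally show ?thesis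
    by (simp add: conv_def integral_completion)
qed

text \<open>
  The convolution of a test function with \<open>1\<close> is constant by translation invariance, and its
  derivative is the integral of the derivative.
\<close>

lemma integral_partial_deriv_Cc:
  assumes r: "r \<in> Cc_infty"
  shows "(LINT x|lebesgue. partial_deriv i r x) = 0"
proof -
  have "conv r (\<lambda>_. 1) = (\<lambda>_. LINT y|lebesgue. r y)"
    by (rule ext, rule conv_1[OF r])
  then have "partial_deriv i (conv r (\<lambda>_. 1)) 0 = 0"
    by (simp add: partial_deriv_const)
  moreover have "(LINT x|lebesgue. partial_deriv i r x) = partial_deriv i (conv r (\<lambda>_. 1)) 0"
    by (simp add: partial_deriv_conv[OF r locally_integrable_const]
        conv_1[OF Cc_infty_partial_deriv[OF r]])
  ultimately show ?thesis by simp
qed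

lemma integration_by_parts:
  assumes f: "smooth f" and r: "r \<in> Cc_infty"
  shows "(LINT x|lebesgue. f x * partial_deriv i r x) = - (LINT x|lebesgue. partial_deriv i f x * r x)"
proof -
  have fr: "(\<lambda>x. r x * f x) \<in> Cc_infty" by (rule Cc_infty_mult[OF r f])
  have int: "integrable lebesgue (\<lambda>x. r x * partial_deriv i f x)"
       "integrable lebesgue (\<lambda>x. partial_deriv i r x * f x)"
    using locally_integrable_Cc_mult[OF locally_integrable_const[of 1]
        Cc_infty_mult[OF r smooth_partial_deriv[OF f]]]
      locally_integrable_Cc_mult[OF locally_integrable_const[of 1]
        Cc_infty_mult[OF Cc_infty_partial_deriv[OF r] f]] by auto
  have "0 = (LINT x|lebesgue. r x * partial_deriv i f x + partial_deriv i r x * f x)"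
    using integral_partial_deriv_Cc[OF fr, of i]
    by (simp add: partial_deriv_mult smooth_imp_differentiable Cc_infty_smooth r f)
  also have "\<dots> = (LINT x|lebesgue. r x * partial_deriv i f x) + (LINT x|lebesgue. partial_deriv i r x * f x)"
    using int by simp
  finally show ?thesis by (simp add: mult.commute)
qed

section \<open>Mollification\<close>

text \<open>
  Jensen's inequality for the probability density \<open>y \<mapsto> r (x - y)\<close>: the variance
  \<open>\<integral> r (x - y) (f y - a)\<^sup>2 dy\<close> about the mean \<open>a\<close> is nonnegative.
\<close>

lemma conv_power2_le:
  fixes f r :: "real^'n::finite \<Rightarrow> real"
  assumes r: "r \<in> Cc_infty" "\<And>x. r x \<ge> 0" "(LINT x|lebesgue. r x) = 1"
    and f: "square_integrable f"
  shows "(conv r f x)\<^sup>2 \<le> conv r (\<lambda>y. (f y)\<^sup>2) x"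
proof -
  have f2: "integrable lebesgue (\<lambda>y. (f y)\<^sup>2)"
    using square_integrable_integrable[OF f] by simp
  have "locally_integrable (\<lambda>y. (f y)\<^sup>2)"
    by (rule integrable_locally_integrable[OF f2])
  note int = conv_integrable[OF r(1) this, of x]
    conv_integrable[OF r(1) square_integrable_locally_integrable[OF f], of x]
    conv_integrable[OF r(1) locally_integrable_const, of x 1]
  define a where "a = conv r f x"
  have eq: "(\<lambda>y. r (x - y) * (f y - a)\<^sup>2)
      = (\<lambda>y. r (x - y) * (f y)\<^sup>2 - 2 * a * (r (x - y) * f y) + a\<^sup>2 * (r (x - y) * 1))"
    by (simp add: power2_eq_square algebra_simps)
  have "0 \<le> (LINT y|lebesgue. r (x - y) * (f y - a)\<^sup>2)"
    by (intro integral_nonneg_AE) (simp add: r(2))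
  also have "\<dots> = conv r (\<lambda>y. (f y)\<^sup>2) x - 2 * a * conv r f x + a\<^sup>2 * conv r (\<lambda>_. 1) x"
    unfolding eq conv_def
    by (subst Bochner_Integration.integral_add Bochner_Integration.integral_diff
        integral_mult_right_zero; use int in simp)+
  also have "\<dots> = conv r (\<lambda>y. (f y)\<^sup>2) x - a\<^sup>2"
    by (simp add: conv_1 r a_def power2_eq_square)
  finally show ?thesis by (simp add: a_def)
qed

text \<open>
  Convolution with an even probability density contracts \<open>L\<^sup>2\<close>: after Jensen's inequality, Tonelli's
  theorem lets the kernel be integrated in the other variable. As \<open>f\<close> is only Lebesgue measurable,
  Tonelli's theorem is applied to a Borel representative of it.
\<close>

lemma conv_nn_integral_le:
  fixes f r :: "real^'n::finite \<Rightarrow> real"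
  assumes r: "r \<in> Cc_infty" "\<And>x. r x \<ge> 0" "\<And>x. r (- x) = r x" "(LINT x|lebesgue. r x) = 1"
    and f: "square_integrable f"
  shows "(\<integral>\<^sup>+ x. ennreal ((conv r f x)\<^sup>2) \<partial>lebesgue) \<le> (\<integral>\<^sup>+ x. ennreal ((f x)\<^sup>2) \<partial>lebesgue)"
proof -
  have f2: "integrable lebesgue (\<lambda>y. (f y)\<^sup>2)"
    using square_integrable_integrable[OF f] by simp
  have lf2: "locally_integrable (\<lambda>y. (f y)\<^sup>2)"
    by (rule integrable_locally_integrable[OF f2])
  obtain g where g[measurable]: "g \<in> borel_measurable lborel" and fg: "AE x in lborel. f x = g x"
    using completion_ex_borel_measurable_real[OF square_integrable_measurable[OF f]] by auto
  have [measurable]: "r \<in> borel_measurable borel"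
    using continuous_lebesgue_measurable(2)[OF Cc_infty_continuous[OF r(1)]] by simp
  have "(\<integral>\<^sup>+ x. ennreal ((conv r f x)\<^sup>2) \<partial>lebesgue) \<le> (\<integral>\<^sup>+ x. ennreal (conv r (\<lambda>y. (f y)\<^sup>2) x) \<partial>lebesgue)"
    by (intro nn_integral_mono ennreal_leI conv_power2_le r f)
  also have "\<dots> = (\<integral>\<^sup>+ x. \<integral>\<^sup>+ y. ennreal (r (x - y) * (g y)\<^sup>2) \<partial>lborel \<partial>lborel)"
  proof (subst nn_integral_completion, rule nn_integral_cong)
    fix x
    have "ennreal (conv r (\<lambda>y. (f y)\<^sup>2) x) = (\<integral>\<^sup>+ y. ennreal (r (x - y) * (f y)\<^sup>2) \<partial>lebesgue)"
      unfolding conv_def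
      by (rule nn_integral_eq_integral[symmetric, OF conv_integrable[OF r(1) lf2]])
        (simp add: r)
    also have "\<dots> = (\<integral>\<^sup>+ y. ennreal (r (x - y) * (g y)\<^sup>2) \<partial>lborel)"
      unfolding nn_integral_completion using fg
      by (intro nn_integral_cong_AE) (auto elim!: eventually_mono)
    finally show "ennreal (conv r (\<lambda>y. (f y)\<^sup>2) x) = \<dots>" .
  qed
  also have "\<dots> = (\<integral>\<^sup>+ y. \<integral>\<^sup>+ x. ennreal (r (x - y) * (g y)\<^sup>2) \<partial>lborel \<partial>lborel)"
    by (rule lborel_pair.Fubini'[symmetric]) simp
  also have "\<dots> = (\<integral>\<^sup>+ y. ennreal ((g y)\<^sup>2) \<partial>lborel)"
  proof (rule nn_integral_cong)
    fix y
    have "(\<integral>\<^sup>+ x. ennreal (r (x - y) * (g y)\<^sup>2) \<partial>lborel)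
        = (\<integral>\<^sup>+ x. ennreal (r (y - x) * 1) * ennreal ((g y)\<^sup>2) \<partial>lborel)"
      by (intro nn_integral_cong) (simp add: ennreal_mult r r(3)[of "y - _", simplified])
    also have "\<dots> = (\<integral>\<^sup>+ x. ennreal (r (y - x) * 1) \<partial>lborel) * ennreal ((g y)\<^sup>2)"
      by (rule nn_integral_multc) simp
    also have "(\<integral>\<^sup>+ x. ennreal (r (y - x) * 1) \<partial>lborel) = (\<integral>\<^sup>+ x. ennreal (r (y - x) * 1) \<partial>lebesgue)"
      by (simp only: nn_integral_completion)
    also have "\<dots> = ennreal (conv r (\<lambda>_. 1) y)"
      unfolding conv_def
      by (rule nn_integral_eq_integral[OF conv_integrable[OF r(1) locally_integrable_const]])
        (simp add: r)
    finally show "(\<integral>\<^sup>+ x. ennreal (r (x - y) * (g y)\<^sup>2) \<partial>lborel) = ennreal ((g y)\<^sup>2)"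
      by (simp add: conv_1 r)
  qed
  also have "\<dots> = (\<integral>\<^sup>+ y. ennreal ((f y)\<^sup>2) \<partial>lebesgue)"
    unfolding nn_integral_completion using fg
    by (intro nn_integral_cong_AE) (auto elim!: eventually_mono)
  finally show ?thesis .
qed

lemma
  fixes f r :: "real^'n::finite \<Rightarrow> real"
  assumes r: "r \<in> Cc_infty" "\<And>x. r x \<ge> 0" "\<And>x. r (- x) = r x" "(LINT x|lebesgue. r x) = 1"
    and f: "square_integrable f"
  shows square_integrable_conv: "square_integrable (conv r f)"
    and conv_integral_power2_le: "(LINT x|lebesgue. (conv r f x)\<^sup>2) \<le> (LINT x|lebesgue. (f x)\<^sup>2)"
proof -
  have f2: "integrable lebesgue (\<lambda>y. (f y)\<^sup>2)"
    using square_integrable_integrable[OF f] by simp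
  have le: "(\<integral>\<^sup>+ x. ennreal ((conv r f x)\<^sup>2) \<partial>lebesgue) \<le> ennreal (LINT x|lebesgue. (f x)\<^sup>2)"
    using conv_nn_integral_le[OF r f] nn_integral_eq_integral[OF f2] by simp
  have m: "conv r f \<in> borel_measurable lebesgue"
    by (intro continuous_lebesgue_measurable smooth_imp_continuous smooth_conv r
        square_integrable_locally_integrable f)
  have i: "integrable lebesgue (\<lambda>x. (conv r f x)\<^sup>2)"
    by (rule integrableI_nonneg) (use m le in \<open>auto intro: le_less_trans\<close>)
  then show "square_integrable (conv r f)"
    using m by (simp add: square_integrable_def)
  show "(LINT x|lebesgue. (conv r f x)\<^sup>2) \<le> (LINT x|lebesgue. (f x)\<^sup>2)"
    using le nn_integral_eq_integral[OF i] by (simp add: integral_nonneg_AE)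
qed

definition mollifier :: "nat \<Rightarrow> real^'n::finite \<Rightarrow> real" where
  "mollifier n x = bump (real (Suc n) *\<^sub>R x) / (LINT y|lebesgue. bump (real (Suc n) *\<^sub>R (y :: real^'n)))"

lemma bump_scaled_Cc: "c \<noteq> 0 \<Longrightarrow> (\<lambda>x. bump (c *\<^sub>R x)) \<in> Cc_infty"
  using Cc_infty_affine[OF bump_Cc_infty, of c 0] by simp

lemma Cc_infty_integrable:
  assumes "f \<in> Cc_infty"
  shows "integrable lebesgue f"
  using locally_integrable_Cc_mult[OF locally_integrable_const[of 1] assms] by simp

lemma bump_scaled_integral_pos:
  assumes "c > 0"
  shows "(LINT y|lebesgue. bump (c *\<^sub>R (y :: real^'n::finite))) > 0"
proof (rule ccontr)
  assume "\<not> ?thesis"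
  moreover have "(LINT y|lebesgue. bump (c *\<^sub>R (y :: real^'n))) \<ge> 0"
    by (intro integral_nonneg_AE AE_I2 bump_nonneg)
  ultimately have "(LINT y|lebesgue. bump (c *\<^sub>R (y :: real^'n))) = 0" by linarith
  moreover have "integrable lebesgue (\<lambda>y. bump (c *\<^sub>R (y :: real^'n)))"
    using assms by (intro Cc_infty_integrable bump_scaled_Cc) simp
  ultimately have "AE y in lebesgue. bump (c *\<^sub>R (y :: real^'n)) = 0"
    using integral_nonneg_eq_0_iff_AE[of lebesgue "\<lambda>y. bump (c *\<^sub>R (y :: real^'n))"]
    by (simp add: bump_nonneg)
  then obtain N where N: "negligible N" "{y. bump (c *\<^sub>R (y :: real^'n)) \<noteq> 0} \<subseteq> N"
    by (auto simp: eventually_ae_filter_negligible)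
  have "ball (0 :: real^'n) (1 / c) \<subseteq> N"
  proof
    fix y :: "real^'n" assume "y \<in> ball 0 (1 / c)"
    then have "norm (c *\<^sub>R y) < 1" using assms by (simp add: field_simps)
    then have "bump (c *\<^sub>R y) > 0" by (simp only: bump_pos_iff)
    then show "y \<in> N" using N by auto
  qed
  then have "negligible (ball (0 :: real^'n) (1 / c))" using N negligible_subset by blast
  then show False using assms open_not_negligible[of "ball (0 :: real^'n) (1 / c)"] by auto
qed

lemma mollifier_Cc: "mollifier n \<in> Cc_infty"
  unfolding mollifier_def[abs_def] divide_inverse
  by (rule Cc_infty_mult[OF bump_scaled_Cc smooth_const]) simp

lemma mollifier_nonneg: "mollifier n x \<ge> 0"
  unfolding mollifier_def
  by (intro divide_nonneg_nonneg bump_nonneg less_imp_le[OF bump_scaled_integral_pos]) simp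

lemma mollifier_minus: "mollifier n (- x) = mollifier n x"
  by (simp add: mollifier_def bump_minus)

lemma mollifier_integral: "(LINT x|lebesgue. mollifier n (x :: real^'n::finite)) = 1"
  using bump_scaled_integral_pos[of "real (Suc n)", where 'n = 'n]
  by (simp add: mollifier_def)

lemma mollifier_zero:
  assumes "norm x \<ge> 1 / real (Suc n)"
  shows "mollifier n x = 0"
proof -
  have "norm (real (Suc n) *\<^sub>R x) \<ge> 1"
    using assms by (simp add: field_simps del: of_nat_Suc)
  then show ?thesis unfolding mollifier_def by (simp only: bump_zero div_0)
qed

lemma conv_mollifier_1: "conv (mollifier n) (\<lambda>_. 1) x = 1"
  by (simp add: conv_1 mollifier_Cc mollifier_integral)

lemma conv_mollifier_diff_le:
  assumes g: "locally_integrable g"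
    and e: "\<And>y. norm (x - y) < 1 / real (Suc n) \<Longrightarrow> \<bar>g y - g x\<bar> \<le> e"
  shows "\<bar>conv (mollifier n) g x - g x\<bar> \<le> e"
proof -
  let ?r = "mollifier n"
  note int = conv_integrable[OF mollifier_Cc g, of n x]
    conv_integrable[OF mollifier_Cc locally_integrable_const, of n x 1]
  have "conv ?r g x - g x * conv ?r (\<lambda>_. 1) x = (LINT y|lebesgue. ?r (x - y) * g y - g x * (?r (x - y) * 1))"
    unfolding conv_def using int by simp
  also have "norm \<dots> \<le> (LINT y|lebesgue. e * (?r (x - y) * 1))"
  proof (rule Bochner_Integration.integral_norm_bound_integral)
    show "norm (?r (x - y) * g y - g x * (?r (x - y) * 1)) \<le> e * (?r (x - y) * 1)" for y
    proof (cases "norm (x - y) < 1 / real (Suc n)")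
      case True
      have "norm (?r (x - y) * g y - g x * (?r (x - y) * 1)) = ?r (x - y) * \<bar>g y - g x\<bar>"
      proof -
        have "?r (x - y) * g y - g x * (?r (x - y) * 1) = ?r (x - y) * (g y - g x)"
          by (simp add: algebra_simps)
        then show ?thesis by (simp only: real_norm_def abs_mult abs_of_nonneg[OF mollifier_nonneg])
      qed
      then show ?thesis
        using mult_right_mono[OF e[OF True] mollifier_nonneg[of n "x - y"]]
        by (simp only: mult.commute mult_1_right)
    qed (use mollifier_zero[of n "x - y"] in auto)
  qed (use int in simp_all)
  also have "\<dots> = e * conv ?r (\<lambda>_. 1) x" by (simp add: conv_def)
  finally show ?thesis by (simp add: conv_mollifier_1)
qed

text \<open>
  For continuous \<open>g\<close> of compact support the mollifications converge uniformly and live in a fixed ball.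
\<close>

lemma conv_mollifier_tendsto_continuous:
  fixes g :: "real^'n::finite \<Rightarrow> real"
  assumes g: "continuous_on UNIV g" "\<And>x. norm x > R \<Longrightarrow> g x = 0"
  shows "(\<lambda>n. LINT x|lebesgue. (conv (mollifier n) g x - g x)\<^sup>2) \<longlonglongrightarrow> 0"
proof -
  obtain B where B: "B > 0" "\<And>x. norm (g x) \<le> B"
    using compact_support_bounded[OF g] by metis
  have lg: "locally_integrable g"
    by (intro square_integrable_locally_integrable continuous_compact_support_square_integrable g)
  have m: "(\<lambda>x. (conv (mollifier n) g x - g x)\<^sup>2) \<in> borel_measurable lebesgue" for n
    by (intro continuous_lebesgue_measurable continuous_intros smooth_imp_continuous
        smooth_conv mollifier_Cc lg g)
  have bound: "\<bar>conv (mollifier n) g x - g x\<bar> \<le> 2 * B * indicator (cball 0 (R + 1)) x" for n x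
  proof (rule conv_mollifier_diff_le[OF lg])
    fix y assume y: "norm (x - y) < 1 / real (Suc n)"
    also have "\<dots> \<le> 1" by simp
    finally have "norm x < norm y + 1" using norm_triangle_ineq2[of x y] by simp
    then show "\<bar>g y - g x\<bar> \<le> 2 * B * indicator (cball 0 (R + 1)) x"
      using B(2)[of x] B(2)[of y] g(2)[of x] g(2)[of y] by (auto simp: indicator_def)
  qed
  have "(\<lambda>n. LINT x|lebesgue. (conv (mollifier n) g x - g x)\<^sup>2) \<longlonglongrightarrow> (LINT x|(lebesgue::(real^'n) measure). 0)"
  proof (rule integral_dominated_convergence)
    show "integrable lebesgue (\<lambda>x::real^'n. (2 * B)\<^sup>2 * indicator (cball 0 (R + 1)) x)"
      using indicator_cball_integrable[of "0 :: real^'n" "R + 1"] by simp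
    have sq: "(conv (mollifier n) g x - g x)\<^sup>2 \<le> (2 * B * indicator (cball 0 (R + 1)) x)\<^sup>2" for n x
      using power_mono[OF bound[of n x], of 2] by simp
    then show "AE x in lebesgue. norm ((conv (mollifier n) g x - g x)\<^sup>2)
        \<le> (2 * B)\<^sup>2 * indicator (cball 0 (R + 1)) x" for n
    proof (intro AE_I2)
      fix x
      show "norm ((conv (mollifier n) g x - g x)\<^sup>2) \<le> (2 * B)\<^sup>2 * indicator (cball 0 (R + 1)) x"
        using sq[of n x] by (cases "x \<in> cball 0 (R + 1)") auto
    qed
    have "(\<lambda>n. conv (mollifier n) g x - g x) \<longlonglongrightarrow> 0" for x
    proof (rule LIMSEQ_I)
      fix e :: real assume "e > 0"
      then obtain d where d: "d > 0" "\<And>x y. norm (x - y) < d \<Longrightarrow> norm (g x - g y) < e / 2"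
        using compact_support_uniformly_continuous[OF g half_gt_zero[OF \<open>e > 0\<close>]] by metis
      obtain N where N: "1 / real (Suc N) < d"
        using d(1) by (metis nat_approx_posE)
      have "norm (conv (mollifier n) g x - g x - 0) < e" if "n \<ge> N" for n
      proof -
        have "1 / real (Suc n) \<le> 1 / real (Suc N)"
          using that by (intro divide_left_mono) auto
        then have "\<bar>conv (mollifier n) g x - g x\<bar> \<le> e / 2"
        proof (intro conv_mollifier_diff_le[OF lg])
          fix y assume "norm (x - y) < 1 / real (Suc n)"
          then have "norm (y - x) < d"
            using \<open>1 / real (Suc n) \<le> 1 / real (Suc N)\<close> N by (simp add: norm_minus_commute)
          then show "\<bar>g y - g x\<bar> \<le> e / 2" using d(2)[of y x] by simp
        qed
        then show ?thesis using \<open>e > 0\<close> by simp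
      qed
      then show "\<exists>N. \<forall>n\<ge>N. norm (conv (mollifier n) g x - g x - 0) < e" by blast
    qed
    from tendsto_power[OF this, of _ 2]
    show "AE x in lebesgue. (\<lambda>n. (conv (mollifier n) g x - g x)\<^sup>2) \<longlonglongrightarrow> 0"
      by simp
  qed (use m in auto)
  then show ?thesis by simp
qed

text \<open>Every measurable function is a limit of continuous ones almost everywhere; truncation in
  range and domain turns this into convergence in \<open>L\<^sup>2\<close>.\<close>

lemma continuous_dense_square_integrable:
  fixes f :: "real^'n::finite \<Rightarrow> real"
  assumes f: "square_integrable f" and e: "e > 0"
  obtains g R where "continuous_on UNIV g" "\<And>x. norm x > R \<Longrightarrow> g x = 0"
    "(LINT x|lebesgue. (f x - g x)\<^sup>2) < e"
proof -
  note [measurable] = square_integrable_measurable[OF f]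
  define cut where "cut k x = max 0 (min 1 (real k + 1 - norm x))" for k and x :: "real^'n"
  define clamp where "clamp k t = max (- real k) (min (real k) t)" for k and t :: real
  have cut: "0 \<le> cut k x" "cut k x \<le> 1" "cut k x \<le> indicator (cball 0 (real k + 1)) x" for k x
    by (auto simp: cut_def indicator_def)
  have cut_cont: "continuous_on UNIV (cut k)" for k
    unfolding cut_def by (intro continuous_intros)
  have [measurable]: "cut k \<in> borel_measurable lebesgue" for k
    by (rule continuous_lebesgue_measurable[OF cut_cont])
  have clamp_cont: "continuous_on UNIV (clamp k)" for k
    unfolding clamp_def by (intro continuous_intros)
  have [measurable]: "clamp k \<in> borel_measurable borel" for k
    by (rule borel_measurable_continuous_onI[OF clamp_cont])
  have clamp: "\<bar>clamp k t\<bar> \<le> real k" "\<bar>clamp k t\<bar> \<le> \<bar>t\<bar>" for k t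
    by (auto simp: clamp_def)
  have "(\<lambda>k. LINT x|lebesgue. (f x - clamp k (f x) * cut k x)\<^sup>2) \<longlonglongrightarrow> (LINT x|(lebesgue::(real^'n) measure). 0)"
  proof (rule integral_dominated_convergence)
    show "integrable lebesgue (\<lambda>x. 4 * (f x)\<^sup>2)"
      using square_integrable_integrable[OF f] by simp
    have "\<bar>f x - clamp k (f x) * cut k x\<bar> \<le> 2 * \<bar>f x\<bar>" for k x
    proof -
      have "\<bar>clamp k (f x) * cut k x\<bar> \<le> \<bar>f x\<bar> * 1"
        unfolding abs_mult by (intro mult_mono) (use cut clamp in auto)
      then show ?thesis by linarith
    qed
    from power_mono[OF this, where n = 2]
    show "AE x in lebesgue. norm ((f x - clamp k (f x) * cut k x)\<^sup>2) \<le> 4 * (f x)\<^sup>2" for k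
      by (simp add: power_mult_distrib)
    show "AE x in lebesgue. (\<lambda>k. (f x - clamp k (f x) * cut k x)\<^sup>2) \<longlonglongrightarrow> 0"
    proof (intro AE_I2 tendsto_eventually)
      fix x
      obtain m :: nat where "norm x + \<bar>f x\<bar> \<le> real m" using real_arch_simple by blast
      then have m: "norm x \<le> real m" "\<bar>f x\<bar> \<le> real m" using norm_ge_zero[of x] by linarith+
      have "(f x - clamp k (f x) * cut k x)\<^sup>2 = 0" if "m \<le> k" for k
      proof -
        have "norm x \<le> real k" "\<bar>f x\<bar> \<le> real k" using m that by linarith+
        then have "clamp k (f x) = f x" "cut k x = 1" by (auto simp: clamp_def cut_def)
        then show ?thesis by simp
      qed
      then show "\<forall>\<^sub>F k in sequentially. (f x - clamp k (f x) * cut k x)\<^sup>2 = 0"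
        by (rule eventually_sequentiallyI)
    qed
  qed auto
  then have "\<forall>\<^sub>F k in sequentially. (LINT x|lebesgue. (f x - clamp k (f x) * cut k x)\<^sup>2) < e / 4"
    using e by (intro order_tendstoD(2)[where y = 0]) auto
  then obtain k where k: "(LINT x|lebesgue. (f x - clamp k (f x) * cut k x)\<^sup>2) < e / 4"
    by (auto simp: eventually_sequentially)
  have "f measurable_on UNIV"
    by (rule lebesgue_measurable_imp_measurable_on) auto
  then obtain N g where N: "negligible N" and g: "\<And>n. continuous_on UNIV (g n)"
    and lim: "\<And>x. x \<notin> N \<Longrightarrow> (\<lambda>n. g n x) \<longlonglongrightarrow> f x"
    by (auto simp: measurable_on_def)
  have [measurable]: "g n \<in> borel_measurable lebesgue" for n
    by (rule continuous_lebesgue_measurable[OF g])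
  let ?h = "\<lambda>n x. clamp k (g n x) * cut k x"
  let ?F = "\<lambda>x. clamp k (f x) * cut k x"
  have b2: "(clamp k s * cut k x - clamp k t * cut k x)\<^sup>2 \<le> (2 * real k)\<^sup>2 * indicator (cball 0 (real k + 1)) x" for s t x
  proof -
    have "\<bar>clamp k s * cut k x - clamp k t * cut k x\<bar> = \<bar>clamp k s - clamp k t\<bar> * cut k x"
      using cut(1)[of k x] by (simp add: abs_mult flip: left_diff_distrib)
    also have "\<dots> \<le> (2 * real k) * indicator (cball 0 (real k + 1)) x"
      using cut[of k x] clamp(1)[of k s] clamp(1)[of k t] by (intro mult_mono) auto
    finally have "\<bar>clamp k s * cut k x - clamp k t * cut k x\<bar>\<^sup>2 \<le> ((2 * real k) * indicator (cball 0 (real k + 1)) x)\<^sup>2"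
      by (rule power_mono) simp
    then show ?thesis by (cases "x \<in> cball 0 (real k + 1)") auto
  qed
  have "(\<lambda>n. LINT x|lebesgue. (?F x - ?h n x)\<^sup>2) \<longlonglongrightarrow> (LINT x|(lebesgue::(real^'n) measure). 0)"
  proof (rule integral_dominated_convergence)
    show "integrable lebesgue (\<lambda>x::real^'n. (2 * real k)\<^sup>2 * indicator (cball 0 (real k + 1)) x)"
      using indicator_cball_integrable[of "0 :: real^'n" "real k + 1"] by simp
    show "AE x in lebesgue. norm ((?F x - ?h n x)\<^sup>2) \<le> (2 * real k)\<^sup>2 * indicator (cball 0 (real k + 1)) x" for n
      using b2 by simp
    have "(\<lambda>n. (?F x - ?h n x)\<^sup>2) \<longlonglongrightarrow> 0" if "x \<notin> N" for x
    proof -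
      have "(\<lambda>n. clamp k (g n x)) \<longlonglongrightarrow> clamp k (f x)"
        using continuous_on_tendsto_compose[OF clamp_cont lim[OF that]] by auto
      then have "(\<lambda>n. (?F x - ?h n x)\<^sup>2) \<longlonglongrightarrow> (?F x - ?F x)\<^sup>2"
        by (intro tendsto_intros)
      then show ?thesis by simp
    qed
    then show "AE x in lebesgue. (\<lambda>n. (?F x - ?h n x)\<^sup>2) \<longlonglongrightarrow> 0"
      using N unfolding eventually_ae_filter_negligible by blast
  qed auto
  then have "\<forall>\<^sub>F n in sequentially. (LINT x|lebesgue. (?F x - ?h n x)\<^sup>2) < e / 4"
    using e by (intro order_tendstoD(2)[where y = 0]) auto
  then obtain n where n: "(LINT x|lebesgue. (?F x - ?h n x)\<^sup>2) < e / 4"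
    by (auto simp: eventually_sequentially)
  have hcont: "continuous_on UNIV (?h n)"
    by (intro continuous_on_mult cut_cont continuous_on_compose2[OF clamp_cont g]) auto
  have hsupp: "?h n x = 0" if "norm x > real k + 1" for x
    using that by (simp add: cut_def)
  have sqF: "square_integrable ?F"
  proof (rule square_integrable_bound[where g = "\<lambda>x. (f x)\<^sup>2"])
    have "\<bar>clamp k (f x) * cut k x\<bar> \<le> \<bar>f x\<bar> * 1" for x
      unfolding abs_mult by (intro mult_mono) (use cut clamp in auto)
    from power_mono[OF this, where n = 2] show "AE x in lebesgue. (norm (?F x))\<^sup>2 \<le> (f x)\<^sup>2" by simp
  qed (use square_integrable_integrable[OF f] in auto)
  have sqh: "square_integrable (?h n)"
    by (rule continuous_compact_support_square_integrable[OF hcont hsupp])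
  have i: "integrable lebesgue (\<lambda>x. (f x - ?F x)\<^sup>2)" "integrable lebesgue (\<lambda>x. (?F x - ?h n x)\<^sup>2)"
    "integrable lebesgue (\<lambda>x. (f x - ?h n x)\<^sup>2)"
    using square_integrable_integrable[OF square_integrable_diff[OF f sqF]]
      square_integrable_integrable[OF square_integrable_diff[OF sqF sqh]]
      square_integrable_integrable[OF square_integrable_diff[OF f sqh]] by auto
  have "(LINT x|lebesgue. (f x - ?h n x)\<^sup>2) \<le> (LINT x|lebesgue. 2 * (f x - ?F x)\<^sup>2 + 2 * (?F x - ?h n x)\<^sup>2)"
  proof (rule integral_mono)
    show "(f x - ?h n x)\<^sup>2 \<le> 2 * (f x - ?F x)\<^sup>2 + 2 * (?F x - ?h n x)\<^sup>2" for x
      using norm_add_power2_le[of "f x - ?F x" "?F x - ?h n x"] by simp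
  qed (use i in auto)
  also have "\<dots> = 2 * (LINT x|lebesgue. (f x - ?F x)\<^sup>2) + 2 * (LINT x|lebesgue. (?F x - ?h n x)\<^sup>2)"
    using i by simp
  also have "\<dots> < e" using k n by simp
  finally show ?thesis using that[OF hcont hsupp] by blast
qed

lemma conv_diff:
  assumes "r \<in> Cc_infty" "locally_integrable f" "locally_integrable g"
  shows "conv r (\<lambda>x. f x - g x) x = conv r f x - conv r g x"
  using conv_integrable[OF assms(1,2)] conv_integrable[OF assms(1,3)]
  by (simp add: conv_def right_diff_distrib)

text \<open>
  The contraction property reduces the convergence in \<open>L\<^sup>2\<close> to the dense class of continuous functions
  of compact support.
\<close>

lemma conv_mollifier_tendsto:
  fixes f :: "real^'n::finite \<Rightarrow> real"
  assumes f: "square_integrable f"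
  shows "(\<lambda>n. LINT x|lebesgue. (conv (mollifier n) f x - f x)\<^sup>2) \<longlonglongrightarrow> 0"
proof (rule LIMSEQ_I)
  fix e :: real assume e: "e > 0"
  then have e16: "e / 16 > 0" by simp
  \<comment> \<open>the three errors below enter with the factors \<open>4\<close>, \<open>4\<close> and \<open>2\<close>\<close>
  obtain g R where g: "continuous_on UNIV g" "\<And>x. norm x > R \<Longrightarrow> g x = 0"
    and fg: "(LINT x|lebesgue. (f x - g x)\<^sup>2) < e / 16"
    using continuous_dense_square_integrable[OF f e16] by metis
  have sg: "square_integrable g"
    by (rule continuous_compact_support_square_integrable[OF g])
  note lf = square_integrable_locally_integrable[OF f] and lg = square_integrable_locally_integrable[OF sg]
  note sfg = square_integrable_diff[OF f sg]
  note mol = mollifier_Cc mollifier_nonneg mollifier_minus mollifier_integral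
  have "\<forall>\<^sub>F n in sequentially. (LINT x|lebesgue. (conv (mollifier n) g x - g x)\<^sup>2) < e / 16"
    using e by (intro order_tendstoD(2)[OF conv_mollifier_tendsto_continuous[OF g]]) auto
  then obtain N where N: "\<And>n. n \<ge> N \<Longrightarrow> (LINT x|lebesgue. (conv (mollifier n) g x - g x)\<^sup>2) < e / 16"
    by (auto simp: eventually_sequentially)
  have "norm ((LINT x|lebesgue. (conv (mollifier n) f x - f x)\<^sup>2) - 0) < e" if "n \<ge> N" for n
  proof -
    let ?r = "mollifier n"
    let ?a = "conv ?r (\<lambda>x. f x - g x)" and ?b = "\<lambda>x. conv ?r g x - g x" and ?c = "\<lambda>x. f x - g x"
    have sa: "square_integrable ?a" by (rule square_integrable_conv[OF mol sfg])
    have sb: "square_integrable ?b" by (intro square_integrable_diff square_integrable_conv mol sg)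
    note i = square_integrable_integrable[OF sa] square_integrable_integrable[OF sb]
      square_integrable_integrable[OF sfg]
      square_integrable_integrable[OF square_integrable_diff[OF square_integrable_conv[OF mol f] f]]
    have "(LINT x|lebesgue. (conv ?r f x - f x)\<^sup>2)
        \<le> (LINT x|lebesgue. 4 * (?a x)\<^sup>2 + 4 * (?b x)\<^sup>2 + 2 * (?c x)\<^sup>2)"
    proof (rule integral_mono)
      show "integrable lebesgue (\<lambda>x. (conv ?r f x - f x)\<^sup>2)" using i(4) by simp
      show "integrable lebesgue (\<lambda>x. 4 * (?a x)\<^sup>2 + 4 * (?b x)\<^sup>2 + 2 * (?c x)\<^sup>2)"
        using i(1-3) by simp
      fix x
      have "(conv ?r f x - f x)\<^sup>2 = (norm ((?a x + ?b x) + - ?c x))\<^sup>2"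
        by (simp add: conv_diff[OF mollifier_Cc lf lg])
      also have "\<dots> \<le> 2 * (norm (?a x + ?b x))\<^sup>2 + 2 * (norm (- ?c x))\<^sup>2" by (rule norm_add_power2_le)
      also have "\<dots> \<le> 2 * (2 * (norm (?a x))\<^sup>2 + 2 * (norm (?b x))\<^sup>2) + 2 * (norm (- ?c x))\<^sup>2"
        using norm_add_power2_le[of "?a x" "?b x"] by simp
      finally show "(conv ?r f x - f x)\<^sup>2 \<le> 4 * (?a x)\<^sup>2 + 4 * (?b x)\<^sup>2 + 2 * (?c x)\<^sup>2"
        by (simp add: power2_commute)
    qed
    also have "\<dots> = 4 * (LINT x|lebesgue. (?a x)\<^sup>2) + 4 * (LINT x|lebesgue. (?b x)\<^sup>2) + 2 * (LINT x|lebesgue. (?c x)\<^sup>2)"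
      using i(1-3) by simp
    also have "\<dots> < e"
      using conv_integral_power2_le[OF mol sfg, of n] fg N[OF that] e by linarith
    finally show ?thesis using i(4) by (simp add: integral_nonneg_AE)
  qed
  then show "\<exists>N. \<forall>n\<ge>N. norm ((LINT x|lebesgue. (conv (mollifier n) f x - f x)\<^sup>2) - 0) < e" by blast
qed

section \<open>Smooth approximation of functions of finite energy\<close>

text \<open>
  The local square integrability of \<open>u\<close> itself is what turns convergence of its mollifications into
  convergence almost everywhere along a subsequence.
\<close>

definition finite_energy :: "(real^'n::finite \<Rightarrow> real) \<Rightarrow> (real^'n \<Rightarrow> real^'n) \<Rightarrow> bool" where
  "finite_energy u G \<longleftrightarrow> has_weak_gradient u G \<and> square_integrable G \<and>
     (\<forall>R. square_integrable (\<lambda>x. indicator (cball 0 R) x * u x))"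

lemma square_integrable_component:
  fixes G :: "real^'n::finite \<Rightarrow> real^'n"
  assumes G: "square_integrable G"
  shows "square_integrable (\<lambda>x. G x $ i)"
proof (rule square_integrable_bound)
  show "integrable lebesgue (\<lambda>x. (norm (G x))\<^sup>2)" using G by (rule square_integrable_integrable)
  have "(\<lambda>x. G x \<bullet> axis i 1) \<in> borel_measurable lebesgue"
    using square_integrable_measurable[OF G] by measurable
  then show "(\<lambda>x. G x $ i) \<in> borel_measurable lebesgue" by (simp add: inner_axis)
  show "AE x in lebesgue. (norm (G x $ i))\<^sup>2 \<le> (norm (G x))\<^sup>2"
    by (intro AE_I2 power_mono Finite_Cartesian_Product.norm_nth_le) simp
qed

lemma norm_power2_vec: "(norm v)\<^sup>2 = (\<Sum>i\<in>UNIV. (v $ i)\<^sup>2)" for v :: "real^'n::finite"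
  unfolding power2_norm_eq_inner inner_vec_def by (simp add: power2_eq_square)

lemma
  fixes u :: "real^'n::finite \<Rightarrow> real"
  assumes u: "finite_energy u G"
  shows square_integrable_grad_conv: "square_integrable (classical_grad (conv (mollifier n) u))"
    and grad_conv_tendsto:
      "(\<lambda>n. LINT x|lebesgue. (norm (classical_grad (conv (mollifier n) u) x - G x))\<^sup>2) \<longlonglongrightarrow> 0"
proof -
  let ?U = "\<lambda>n. conv (mollifier n) u"
  have wg: "has_weak_gradient u G" and G: "square_integrable G"
    using u by (auto simp: finite_energy_def)
  note mol = mollifier_Cc mollifier_nonneg mollifier_minus mollifier_integral
  note Gi = square_integrable_component[OF G]
  have grad: "classical_grad (?U n) x $ i = conv (mollifier n) (\<lambda>y. G y $ i) x" for n x i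
    by (simp add: conv_weak_gradient[OF mollifier_Cc wg])
  show sq: "square_integrable (classical_grad (?U n))" for n
    unfolding square_integrable_def
  proof
    show "classical_grad (?U n) \<in> borel_measurable lebesgue"
      using wg by (intro continuous_lebesgue_measurable smooth_continuous_grad smooth_conv mollifier_Cc)
        (simp add: has_weak_gradient_def)
    have "integrable lebesgue (\<lambda>x. (conv (mollifier n) (\<lambda>y. G y $ i) x)\<^sup>2)" for i
      using square_integrable_integrable[OF square_integrable_conv[OF mol Gi]] by simp
    then show "integrable lebesgue (\<lambda>x. (norm (classical_grad (?U n) x))\<^sup>2)"
      unfolding norm_power2_vec grad by (intro Bochner_Integration.integrable_sum)
  qed
  have i: "integrable lebesgue (\<lambda>x. (conv (mollifier n) (\<lambda>y. G y $ i) x - G x $ i)\<^sup>2)" for i n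
    using square_integrable_integrable[OF square_integrable_diff[OF square_integrable_conv[OF mol Gi] Gi]]
    by simp
  have "(LINT x|lebesgue. (norm (classical_grad (?U n) x - G x))\<^sup>2)
      = (\<Sum>i\<in>UNIV. LINT x|lebesgue. (conv (mollifier n) (\<lambda>y. G y $ i) x - G x $ i)\<^sup>2)" for n
    unfolding norm_power2_vec vector_minus_component grad
    by (rule Bochner_Integration.integral_sum) (rule i)
  moreover have "(\<lambda>n. \<Sum>i\<in>UNIV. LINT x|lebesgue. (conv (mollifier n) (\<lambda>y. G y $ i) x - G x $ i)\<^sup>2)
      \<longlonglongrightarrow> (\<Sum>i\<in>(UNIV :: 'n set). 0)"
    by (intro tendsto_sum conv_mollifier_tendsto Gi)
  ultimately show "(\<lambda>n. LINT x|lebesgue. (norm (classical_grad (?U n) x - G x))\<^sup>2) \<longlonglongrightarrow> 0"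
    by simp
qed

lemma conv_nonneg:
  assumes "AE x in lebesgue. 0 \<le> u x"
  shows "conv (mollifier n) u x \<ge> 0"
  unfolding conv_def using assms
  by (intro integral_nonneg_AE) (auto elim!: eventually_mono intro: mult_nonneg_nonneg mollifier_nonneg)

text \<open>
  On a ball the mollifications only see \<open>u\<close> on a slightly larger ball, and there \<open>u\<close> is square
  integrable.
\<close>

lemma conv_tendsto_local:
  fixes u :: "real^'n::finite \<Rightarrow> real"
  assumes u: "finite_energy u G"
  shows "integrable lebesgue (\<lambda>x. indicator (cball 0 R) x * (conv (mollifier n) u x - u x)\<^sup>2)"
    and "(\<lambda>n. LINT x|lebesgue. indicator (cball 0 R) x * (conv (mollifier n) u x - u x)\<^sup>2) \<longlonglongrightarrow> 0"
proof -
  define v where "v x = indicator (cball 0 (R + 1)) x * u x" for x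
  have v: "square_integrable v"
    using u unfolding v_def finite_energy_def by blast
  have lu: "locally_integrable u" using u by (simp add: finite_energy_def has_weak_gradient_def)
  note mol = mollifier_Cc mollifier_nonneg mollifier_minus mollifier_integral
  have [measurable]: "u \<in> borel_measurable lebesgue" "conv (mollifier n) u \<in> borel_measurable lebesgue" for n
    by (intro locally_integrable_measurable lu continuous_lebesgue_measurable
        smooth_imp_continuous smooth_conv mollifier_Cc)+
  have eq: "conv (mollifier n) u x = conv (mollifier n) v x" if "x \<in> cball 0 R" for n x
  proof -
    have "mollifier n (x - y) * u y = mollifier n (x - y) * v y" for y
    proof (cases "norm (x - y) < 1 / real (Suc n)")
      case True
      also have "1 / real (Suc n) \<le> 1" by simp
      finally have "norm y \<le> R + 1" using that norm_triangle_ineq2[of y x]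
        by (simp add: norm_minus_commute)
      then show ?thesis by (simp add: v_def)
    qed (use mollifier_zero[of n "x - y"] in auto)
    then show ?thesis unfolding conv_def by (intro Bochner_Integration.integral_cong refl)
  qed
  have le: "indicator (cball 0 R) x * (conv (mollifier n) u x - u x)\<^sup>2 \<le> (conv (mollifier n) v x - v x)\<^sup>2" for n x
    by (cases "x \<in> cball 0 R") (use eq in \<open>auto simp: v_def\<close>)
  have iv: "integrable lebesgue (\<lambda>x. (conv (mollifier n) v x - v x)\<^sup>2)" for n
    using square_integrable_integrable[OF square_integrable_diff[OF square_integrable_conv[OF mol v] v]]
    by simp
  show i: "integrable lebesgue (\<lambda>x. indicator (cball 0 R) x * (conv (mollifier n) u x - u x)\<^sup>2)" for n
  proof (rule Bochner_Integration.integrable_bound[OF iv[of n]])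
    show "(\<lambda>x. indicator (cball 0 R) x * (conv (mollifier n) u x - u x)\<^sup>2) \<in> borel_measurable lebesgue"
      by (intro borel_measurable_times borel_measurable_indicator fmeasurableD lmeasurable_cball) measurable
  qed (use le in \<open>auto simp: abs_mult\<close>)
  show "(\<lambda>n. LINT x|lebesgue. indicator (cball 0 R) x * (conv (mollifier n) u x - u x)\<^sup>2) \<longlonglongrightarrow> 0"
  proof (rule tendsto_sandwich[OF _ _ tendsto_const conv_mollifier_tendsto[OF v]])
    show "\<forall>\<^sub>F n in sequentially. 0 \<le> (LINT x|lebesgue. indicator (cball 0 R) x * (conv (mollifier n) u x - u x)\<^sup>2)"
      by (intro always_eventually allI integral_nonneg_AE) auto
    show "\<forall>\<^sub>F n in sequentially. (LINT x|lebesgue. indicator (cball 0 R) x * (conv (mollifier n) u x - u x)\<^sup>2)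
        \<le> (LINT x|lebesgue. (conv (mollifier n) v x - v x)\<^sup>2)"
      by (intro always_eventually allI integral_mono i iv le)
  qed
qed

lemma power2_tendsto_0D:
  fixes f :: "nat \<Rightarrow> real"
  assumes "(\<lambda>n. (f n)\<^sup>2) \<longlonglongrightarrow> 0"
  shows "f \<longlonglongrightarrow> 0"
  using tendsto_real_sqrt[OF assms] by (simp add: tendsto_rabs_zero_iff)

text \<open>
  One sequence of mollifiers serves both functions; passing to a subsequence twice gives convergence
  almost everywhere on the ball. The approximations of \<open>u\<close> inherit its sign everywhere, so that
  \<open>U n + \<epsilon>\<close> may appear in a denominator.
\<close>

lemma smooth_approximations:
  fixes u w :: "real^'n::finite \<Rightarrow> real"
  assumes u: "finite_energy u Gu" "AE x in lebesgue. 0 \<le> u x" and w: "finite_energy w Gw"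
  obtains U W :: "nat \<Rightarrow> real^'n \<Rightarrow> real" where
    "\<And>n. smooth (U n)" "\<And>n x. U n x \<ge> 0" "\<And>n. smooth (W n)"
    "\<And>n. square_integrable (classical_grad (U n))" "\<And>n. square_integrable (classical_grad (W n))"
    "(\<lambda>n. LINT x|lebesgue. (norm (classical_grad (U n) x - Gu x))\<^sup>2) \<longlonglongrightarrow> 0"
    "(\<lambda>n. LINT x|lebesgue. (norm (classical_grad (W n) x - Gw x))\<^sup>2) \<longlonglongrightarrow> 0"
    "AE x in lebesgue. norm x \<le> R \<longrightarrow> (\<lambda>n. U n x) \<longlonglongrightarrow> u x \<and> (\<lambda>n. W n x) \<longlonglongrightarrow> w x"
proof -
  let ?d = "\<lambda>u n x. indicator (cball 0 R) x * (conv (mollifier n) u x - u x)\<^sup>2"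
  have n: "(\<lambda>n. LINT x|lebesgue. norm (?d u n x)) \<longlonglongrightarrow> 0" if "finite_energy u Gu" for u and Gu :: "real^'n \<Rightarrow> real^'n"
    using conv_tendsto_local(2)[OF that, of R] by (simp add: abs_mult)
  obtain s where s: "strict_mono s" "AE x in lebesgue. (\<lambda>n. ?d u (s n) x) \<longlonglongrightarrow> 0"
    using tendsto_L1_AE_subseq[OF conv_tendsto_local(1)[OF u(1)] n[OF u(1)]] by blast
  have "(\<lambda>n. LINT x|lebesgue. norm (?d w (s n) x)) \<longlonglongrightarrow> 0"
    using LIMSEQ_subseq_LIMSEQ[OF n[OF w] s(1)] by (simp add: o_def)
  then obtain t where t: "strict_mono t" "AE x in lebesgue. (\<lambda>n. ?d w (s (t n)) x) \<longlonglongrightarrow> 0"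
    using tendsto_L1_AE_subseq[of lebesgue "\<lambda>n. ?d w (s n)", OF conv_tendsto_local(1)[OF w]] by blast
  define r where "r n = s (t n)" for n
  have r: "strict_mono r" using s(1) t(1) by (simp add: strict_mono_def r_def)
  have D: "(\<lambda>n. conv (mollifier (r n)) f x) \<longlonglongrightarrow> f x"
    if "(\<lambda>n. ?d f (r n) x) \<longlonglongrightarrow> 0" "norm x \<le> R" for f x
  proof -
    have "(\<lambda>n. conv (mollifier (r n)) f x - f x) \<longlonglongrightarrow> 0"
      by (rule power2_tendsto_0D) (use that in simp)
    then show ?thesis by (simp add: LIM_zero_iff)
  qed
  have "AE x in lebesgue. norm x \<le> R \<longrightarrow>
     (\<lambda>n. conv (mollifier (r n)) u x) \<longlonglongrightarrow> u x \<and> (\<lambda>n. conv (mollifier (r n)) w x) \<longlonglongrightarrow> w x"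
    using s(2) t(2)
  proof eventually_elim
    case (elim x)
    have "(\<lambda>n. ?d u (r n) x) \<longlonglongrightarrow> 0" "(\<lambda>n. ?d w (r n) x) \<longlonglongrightarrow> 0"
      using LIMSEQ_subseq_LIMSEQ[OF elim(1) t(1)] elim(2) by (simp_all add: o_def r_def)
    then show ?case using D by blast
  qed
  moreover have "smooth (conv (mollifier n) f)" if "finite_energy f G" for n f and G :: "real^'n \<Rightarrow> real^'n"
    using that by (auto simp: finite_energy_def has_weak_gradient_def intro!: smooth_conv mollifier_Cc)
  moreover have "(\<lambda>n. LINT x|lebesgue. (norm (classical_grad (conv (mollifier (r n)) f) x - G x))\<^sup>2) \<longlonglongrightarrow> 0"
    if "finite_energy f G" for f and G :: "real^'n \<Rightarrow> real^'n"
    using LIMSEQ_subseq_LIMSEQ[OF grad_conv_tendsto[OF that] r] by (simp add: o_def)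
  ultimately show ?thesis
    using u w by (intro that[of "\<lambda>n. conv (mollifier (r n)) u" "\<lambda>n. conv (mollifier (r n)) w"])
      (blast intro: conv_nonneg square_integrable_grad_conv)+
qed

text \<open>
  Bounded times fixed \<open>L\<^sup>2\<close> function times \<open>L\<^sup>2\<close>-null sequence: the weighted inequality
  \<open>|g \<bullet> d| \<le> t |g|\<^sup>2 + |d|\<^sup>2/t\<close> with a small constant \<open>t\<close> replaces the Cauchy-Schwarz inequality for
  integrals.
\<close>

lemma integral_inner_tendsto_0:
  fixes g :: "real^'n::finite \<Rightarrow> 'b::euclidean_space"
  assumes g: "square_integrable g" and d: "\<And>n. square_integrable (d n)"
    and lim: "(\<lambda>n. LINT x|lebesgue. (norm (d n x))\<^sup>2) \<longlonglongrightarrow> 0"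
    and a: "\<And>n. a n \<in> borel_measurable lebesgue" "\<And>n x. \<bar>a n x\<bar> \<le> K"
  shows "(\<lambda>n. LINT x|lebesgue. a n x * (g x \<bullet> d n x)) \<longlonglongrightarrow> 0"
proof (rule LIMSEQ_I)
  fix e :: real assume e: "e > 0"
  define A where "A = (LINT x|lebesgue. (norm (g x))\<^sup>2)"
  have A: "A \<ge> 0" unfolding A_def by (intro integral_nonneg_AE) auto
  have K: "K \<ge> 0" using a(2)[of 0 0] by linarith
  \<comment> \<open>\<open>t\<close> makes the term with \<open>g\<close> at most \<open>e/4\<close>; the addition of \<open>1\<close> only avoids division by \<open>0\<close>\<close>
  define t where "t = e / (4 * (K + 1) * (A + 1))"
  have t: "t > 0" using e A K by (simp add: t_def)
  have "\<forall>\<^sub>F n in sequentially. (LINT x|lebesgue. (norm (d n x))\<^sup>2) < t * e / (4 * (K + 1))"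
    using t e K by (intro order_tendstoD(2)[OF lim]) auto
  then obtain N where N: "\<And>n. n \<ge> N \<Longrightarrow> (LINT x|lebesgue. (norm (d n x))\<^sup>2) < t * e / (4 * (K + 1))"
    by (auto simp: eventually_sequentially)
  have "norm ((LINT x|lebesgue. a n x * (g x \<bullet> d n x)) - 0) < e" if "n \<ge> N" for n
  proof -
    note i = square_integrable_integrable[OF g] square_integrable_integrable[OF d[of n]]
    have "norm (LINT x|lebesgue. a n x * (g x \<bullet> d n x))
        \<le> (LINT x|lebesgue. (K + 1) * (t * (norm (g x))\<^sup>2 + (norm (d n x))\<^sup>2 / t))"
    proof (rule Bochner_Integration.integral_norm_bound_integral)
      show "integrable lebesgue (\<lambda>x. a n x * (g x \<bullet> d n x))"
        by (rule integrable_bounded_mult[OF square_integrable_inner[OF g d] a(1)]) (use a(2) in auto)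
      show "integrable lebesgue (\<lambda>x. (K + 1) * (t * (norm (g x))\<^sup>2 + (norm (d n x))\<^sup>2 / t))"
        using i by simp
      fix x
      have "\<bar>g x \<bullet> d n x\<bar> = \<bar>(sqrt t *\<^sub>R g x) \<bullet> ((1 / sqrt t) *\<^sub>R d n x)\<bar>"
        using t by simp
      also have "\<dots> \<le> (norm (sqrt t *\<^sub>R g x))\<^sup>2 + (norm ((1 / sqrt t) *\<^sub>R d n x))\<^sup>2"
        by (rule abs_inner_le_power2)
      also have "\<dots> = t * (norm (g x))\<^sup>2 + (norm (d n x))\<^sup>2 / t"
        using t by (simp add: power_mult_distrib power_divide)
      finally have "\<bar>a n x\<bar> * \<bar>g x \<bullet> d n x\<bar> \<le> (K + 1) * (t * (norm (g x))\<^sup>2 + (norm (d n x))\<^sup>2 / t)"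
        using a(2)[of n x] K by (intro mult_mono) auto
      then show "norm (a n x * (g x \<bullet> d n x)) \<le> (K + 1) * (t * (norm (g x))\<^sup>2 + (norm (d n x))\<^sup>2 / t)"
        by (simp add: abs_mult)
    qed
    also have "\<dots> = (K + 1) * (t * A) + (K + 1) / t * (LINT x|lebesgue. (norm (d n x))\<^sup>2)"
      using i by (simp add: A_def ring_distribs)
    also have "\<dots> \<le> e / 4 + (K + 1) / t * (t * e / (4 * (K + 1)))"
    proof (rule add_mono)
      have "(K + 1) * (t * A) = e / 4 * (A / (A + 1))"
      proof -
        have "K + 1 \<noteq> 0" "A + 1 \<noteq> 0" using K A by linarith+
        then show ?thesis unfolding t_def by (simp add: divide_simps) (simp add: algebra_simps)
      qed
      also have "\<dots> \<le> e / 4 * 1" using A e by (intro mult_left_mono) auto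
      finally show "(K + 1) * (t * A) \<le> e / 4" by simp
      show "(K + 1) / t * (LINT x|lebesgue. (norm (d n x))\<^sup>2) \<le> (K + 1) / t * (t * e / (4 * (K + 1)))"
        using N[OF that] K t by (intro mult_left_mono) auto
    qed
    also have "(K + 1) / t * (t * e / (4 * (K + 1))) = e / 4"
    proof -
      have "K + 1 \<noteq> 0" using K by linarith
      then show ?thesis using t by (simp add: divide_simps)
    qed
    also have "e / 4 + e / 4 < e" using e by simp
    finally show ?thesis by simp
  qed
  then show "\<exists>N. \<forall>n\<ge>N. norm ((LINT x|lebesgue. a n x * (g x \<bullet> d n x)) - 0) < e" by blast
qed

text \<open>
  The form in which all limits of mollified gradients are taken: the coefficients converge almost
  everywhere and boundedly, the gradients in \<open>L\<^sup>2\<close>, and \<open>g\<close> is fixed.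
\<close>

lemma integral_inner_tendsto:
  fixes g G :: "real^'n::finite \<Rightarrow> 'b::euclidean_space"
  assumes g: "square_integrable g" and G: "square_integrable G" and Gn: "\<And>n. square_integrable (Gn n)"
    and lim: "(\<lambda>n. LINT x|lebesgue. (norm (Gn n x - G x))\<^sup>2) \<longlonglongrightarrow> 0"
    and a: "\<And>n. an n \<in> borel_measurable lebesgue" "\<And>n x. \<bar>an n x\<bar> \<le> K"
    and a': "a \<in> borel_measurable lebesgue" "AE x in lebesgue. (\<lambda>n. an n x) \<longlonglongrightarrow> a x"
  shows "(\<lambda>n. LINT x|lebesgue. an n x * (g x \<bullet> Gn n x)) \<longlonglongrightarrow> (LINT x|lebesgue. a x * (g x \<bullet> G x))"
proof -
  note gG = square_integrable_inner[OF g G]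
  have i: "integrable lebesgue (\<lambda>x. an n x * (g x \<bullet> d x))" if "square_integrable d" for n d
    by (rule integrable_bounded_mult[OF square_integrable_inner[OF g that] a(1)]) (use a(2) in auto)
  have 1: "(\<lambda>n. LINT x|lebesgue. an n x * (g x \<bullet> (Gn n x - G x))) \<longlonglongrightarrow> 0"
    by (rule integral_inner_tendsto_0[OF g square_integrable_diff[OF Gn G] lim a])
  have 2: "(\<lambda>n. LINT x|lebesgue. an n x * (g x \<bullet> G x)) \<longlonglongrightarrow> (LINT x|lebesgue. a x * (g x \<bullet> G x))"
  proof (rule integral_dominated_convergence)
    show "integrable lebesgue (\<lambda>x. K * \<bar>g x \<bullet> G x\<bar>)" using gG by simp
    show "AE x in lebesgue. (\<lambda>n. an n x * (g x \<bullet> G x)) \<longlonglongrightarrow> a x * (g x \<bullet> G x)"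
      using a'(2) by eventually_elim (intro tendsto_intros)
    show "AE x in lebesgue. norm (an n x * (g x \<bullet> G x)) \<le> K * \<bar>g x \<bullet> G x\<bar>" for n
      using a(2) by (intro AE_I2) (simp add: abs_mult mult_right_mono)
  qed (use a(1) a'(1) borel_measurable_integrable[OF gG] in auto)
  have "(LINT x|lebesgue. an n x * (g x \<bullet> Gn n x))
      = (LINT x|lebesgue. an n x * (g x \<bullet> (Gn n x - G x))) + (LINT x|lebesgue. an n x * (g x \<bullet> G x))" for n
    using i[OF square_integrable_diff[OF Gn G], of n n] i[OF G, of n]
    by (subst Bochner_Integration.integral_add[symmetric]) (simp_all add: inner_diff_right right_diff_distrib)
  then show ?thesis using tendsto_add[OF 1 2] by simp
qed

section \<open>Picone's identity for weak solutions\<close>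

text \<open>
  A sequence \<open>T\<close> of successive derivatives of a bounded function \<open>T 0\<close> with bounded derivative. All
  derivatives are carried along so that \<open>T 0\<close> may be composed with smooth functions.
\<close>

definition truncation_derivs :: "real \<Rightarrow> (nat \<Rightarrow> real \<Rightarrow> real) \<Rightarrow> bool" where
  "truncation_derivs K T \<longleftrightarrow> (\<forall>j t. (T j has_real_derivative T (Suc j) t) (at t)) \<and>
     (\<forall>t. \<bar>T 0 t\<bar> \<le> K \<and> \<bar>T 1 t\<bar> \<le> K)"

lemma truncation_derivs_continuous:
  assumes "truncation_derivs K T"
  shows "continuous_on UNIV (T j)"
  using assms unfolding truncation_derivs_def
  by (meson DERIV_isCont continuous_at_imp_continuous_on)

lemma truncation_derivs_const: "truncation_derivs 1 (\<lambda>j t. if j = 0 then 1 else 0)"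
  by (auto simp: truncation_derivs_def)

text \<open>
  The shift by \<open>j \<pi>/2\<close> differentiates the sine \<open>j\<close> times.
\<close>

lemma truncation_derivs_sin:
  assumes "k \<ge> 1"
  shows "truncation_derivs k (\<lambda>j t. k * (1 / k) ^ j * sin (t / k + of_nat j * (pi / 2)))"
proof -
  have 1: "sin (t / k + of_nat (Suc j) * (pi / 2)) = cos (t / k + of_nat j * (pi / 2))" for j t
    using sin_add[of "t / k + of_nat j * (pi / 2)" "pi / 2"]
    by (simp add: algebra_simps add_divide_distrib)
  have "((\<lambda>t. k * (1 / k) ^ j * sin (t / k + of_nat j * (pi / 2))) has_real_derivative
      k * (1 / k) ^ Suc j * sin (t / k + of_nat (Suc j) * (pi / 2))) (at t)" for j t
    unfolding 1 using assms by (auto intro!: derivative_eq_intros)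
  moreover have "\<bar>k * (1 / k) ^ 0 * sin s\<bar> \<le> k" "\<bar>k * (1 / k) ^ 1 * sin s\<bar> \<le> k" for s
  proof -
    have "\<bar>k * (1 / k) ^ 0 * sin s\<bar> = k * \<bar>sin s\<bar>" using assms by (simp add: abs_mult)
    also have "\<dots> \<le> k * 1" using assms abs_sin_le_one[of s] by (intro mult_left_mono) auto
    finally show "\<bar>k * (1 / k) ^ 0 * sin s\<bar> \<le> k" by simp
    show "\<bar>k * (1 / k) ^ 1 * sin s\<bar> \<le> k"
      using assms order_trans[OF abs_sin_le_one[of s], of k] by simp
  qed
  ultimately show ?thesis unfolding truncation_derivs_def by blast
qed

text \<open>
  The candidate \<open>(\<eta> T(W))\<^sup>2/(U + \<epsilon>)\<close> is admissible in the weak equation because \<open>U + \<epsilon>\<close> is smooth and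
  bounded below. In terms of \<open>c = \<eta> T(W)/(U + \<epsilon>)\<close> its gradient has the coefficients
  \<open>2 T(W) c\<close>, \<open>2 \<eta> T'(W) c\<close> and \<open>- c\<^sup>2\<close>, all bounded, which is what the passage to the limit needs.
\<close>

lemma picone_test_function:
  fixes U W \<eta> :: "real^'n::finite \<Rightarrow> real"
  assumes \<eta>: "\<eta> \<in> Cc_infty" and U: "smooth U" "\<And>x. U x \<ge> 0" and W: "smooth W"
    and T: "truncation_derivs K T" and e: "\<epsilon> > 0"
  defines "\<phi> \<equiv> \<lambda>x. (\<eta> x * T 0 (W x))\<^sup>2 / (U x + \<epsilon>)"
    and "c \<equiv> \<lambda>x. \<eta> x * T 0 (W x) / (U x + \<epsilon>)"
  shows "\<phi> \<in> Cc_infty"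
    and "classical_grad \<phi> x = (2 * T 0 (W x) * c x) *\<^sub>R classical_grad \<eta> x
      + (2 * \<eta> x * T 1 (W x) * c x) *\<^sub>R classical_grad W x - (c x)\<^sup>2 *\<^sub>R classical_grad U x"
proof -
  have pos: "U x + \<epsilon> > 0" for x using U(2)[of x] e by linarith
  have Td: "(T j has_real_derivative T (Suc j) t) (at t)" for j t
    using T by (simp add: truncation_derivs_def)
  have TW: "smooth (\<lambda>x. T 0 (W x))"
    by (rule smooth_compose[where S = UNIV and G = T and j = 0, OF Td _ W]) simp
  have "(\<lambda>x. \<eta> x * (\<eta> x * (T 0 (W x))\<^sup>2 * inverse (U x + \<epsilon>))) \<in> Cc_infty"
    by (intro Cc_infty_mult[OF \<eta>] smooth_mult smooth_power TW smooth_inverse smooth_add U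
        smooth_const Cc_infty_smooth[OF \<eta>] pos)
  then show "\<phi> \<in> Cc_infty"
    by (simp add: \<phi>_def field_simps power2_eq_square)
  have dN: "((\<lambda>x. \<eta> x * T 0 (W x)) has_derivative
      (\<lambda>h. \<eta> x * ((classical_grad W x \<bullet> h) * T 1 (W x)) + (classical_grad \<eta> x \<bullet> h) * T 0 (W x))) (at x)"
    using has_derivative_mult[OF smooth_has_derivative[OF Cc_infty_smooth[OF \<eta>]]
        DERIV_compose_FDERIV[OF Td[of 0] smooth_has_derivative[OF W]]] by simp
  have dU: "((\<lambda>x. U x + \<epsilon>) has_derivative (\<lambda>h. classical_grad U x \<bullet> h)) (at x)"
    using has_derivative_add[OF smooth_has_derivative[OF U(1)] has_derivative_const[of \<epsilon>]] by simp
  have "(\<phi> has_derivative (\<lambda>h. ((2 * T 0 (W x) * c x) *\<^sub>R classical_grad \<eta> x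
      + (2 * \<eta> x * T 1 (W x) * c x) *\<^sub>R classical_grad W x - (c x)\<^sup>2 *\<^sub>R classical_grad U x) \<bullet> h)) (at x)"
    unfolding \<phi>_def power2_eq_square
  proof (rule has_derivative_eq_rhs[OF has_derivative_divide'[OF has_derivative_mult[OF dN dN] dU]])
    show "U x + \<epsilon> \<noteq> 0" using pos[of x] by simp
    have alg: "((e * t * (e * (b * t') + a * t) + (e * (b * t') + a * t) * (e * t)) * s - e * t * (e * t) * v) / (s * s)
        = 2 * t * (e * t / s) * a + 2 * e * t' * (e * t / s) * b - e * t / s * (e * t / s) * v"
      if "s \<noteq> 0" for a b t t' e s v :: real
      using that by (simp add: field_simps)
    show "(\<lambda>h. ((\<eta> x * T 0 (W x) * (\<eta> x * ((classical_grad W x \<bullet> h) * T 1 (W x)) + (classical_grad \<eta> x \<bullet> h) * T 0 (W x))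
          + (\<eta> x * ((classical_grad W x \<bullet> h) * T 1 (W x)) + (classical_grad \<eta> x \<bullet> h) * T 0 (W x)) * (\<eta> x * T 0 (W x))) * (U x + \<epsilon>)
          - \<eta> x * T 0 (W x) * (\<eta> x * T 0 (W x)) * (classical_grad U x \<bullet> h)) / ((U x + \<epsilon>) * (U x + \<epsilon>)))
      = (\<lambda>h. ((2 * T 0 (W x) * c x) *\<^sub>R classical_grad \<eta> x
          + (2 * \<eta> x * T 1 (W x) * c x) *\<^sub>R classical_grad W x - (c x * c x) *\<^sub>R classical_grad U x) \<bullet> h)"
      unfolding c_def inner_add_left inner_diff_left inner_scaleR_left
      using pos[of x] by (intro ext alg) simp
  qed
  then show "classical_grad \<phi> x = (2 * T 0 (W x) * c x) *\<^sub>R classical_grad \<eta> x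
      + (2 * \<eta> x * T 1 (W x) * c x) *\<^sub>R classical_grad W x - (c x)\<^sup>2 *\<^sub>R classical_grad U x"
    by (rule classical_grad_eq)
qed

lemma finite_energy_measurable:
  assumes "finite_energy u G"
  shows "u \<in> borel_measurable lebesgue"
  using assms by (auto simp: finite_energy_def has_weak_gradient_def intro: locally_integrable_measurable)

text \<open>
  The algebra behind Picone's identity: completing the square in \<open>c g\<close>.
\<close>

lemma norm_diff_picone:
  fixes a b g :: "'a::real_inner"
  shows "(norm (t *\<^sub>R a + s *\<^sub>R b))\<^sup>2 - (norm (t *\<^sub>R a + s *\<^sub>R b - c *\<^sub>R g))\<^sup>2
    = 2 * t * c * (g \<bullet> a) + 2 * s * c * (g \<bullet> b) - c\<^sup>2 * (g \<bullet> g)"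
  unfolding power2_norm_eq_inner
  by (simp add: inner_diff_left inner_diff_right inner_add_left inner_add_right
      inner_commute power2_eq_square algebra_simps)

lemma grad_Cc_square_integrable:
  assumes \<eta>: "\<eta> \<in> Cc_infty"
  shows "square_integrable (classical_grad \<eta>)"
proof -
  obtain R where R: "\<And>x. norm x > R \<Longrightarrow> \<eta> x = 0"
    using Cc_infty_support[OF \<eta>] by metis
  have "classical_grad \<eta> x = 0" if "norm x > R" for x
    using partial_deriv_zero_outside[OF R that] by (simp add: classical_grad_def vec_eq_iff)
  then show ?thesis
    by (rule continuous_compact_support_square_integrable[OF smooth_continuous_grad[OF Cc_infty_smooth[OF \<eta>]]])
qed

lemma Cc_infty_bounded:
  assumes \<eta>: "\<eta> \<in> Cc_infty"
  obtains B where "B > 0" "\<And>x. \<bar>\<eta> x\<bar> \<le> B"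
proof -
  obtain R where R: "\<And>x. norm x > R \<Longrightarrow> \<eta> x = 0"
    using Cc_infty_support[OF \<eta>] by metis
  obtain B where "B > 0" "\<And>x. norm (\<eta> x) \<le> B"
    using compact_support_bounded[OF Cc_infty_continuous[OF \<eta>] R] by metis
  then show ?thesis using that[of B] by simp
qed

lemma Cc_infty_borel: "\<eta> \<in> Cc_infty \<Longrightarrow> \<eta> \<in> borel_measurable lebesgue"
  by (intro continuous_lebesgue_measurable Cc_infty_continuous)

text \<open>
  Picone's identity for a distributional solution of \<open>-\<Delta>u = q\<close> with \<open>u \<ge> 0\<close>. Here \<open>Z\<close> is the gradient
  of \<open>\<eta> T(w)\<close>, and the second integral measures how far \<open>\<eta> T(w)\<close> is from being proportional to
  \<open>u + \<epsilon>\<close>. The equation is tested with the smooth functions of \<open>picone_test_function\<close> built from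
  mollifications of \<open>u\<close> and \<open>w\<close>; the three coefficients of the gradient converge boundedly almost
  everywhere, the mollified gradients converge in \<open>L\<^sup>2\<close>, and the right-hand side converges by
  dominated convergence, since \<open>q\<close> is integrable on the support of \<open>\<eta>\<close>.
\<close>

lemma
  fixes u w q \<eta> :: "real^'n::finite \<Rightarrow> real" and Gu Gw :: "real^'n \<Rightarrow> real^'n"
  assumes u: "finite_energy u Gu" "AE x in lebesgue. 0 \<le> u x"
    and w: "finite_energy w Gw" and \<eta>: "\<eta> \<in> Cc_infty"
    and T: "truncation_derivs K T" and e: "\<epsilon> > 0"
    and q: "locally_integrable q"
    and eq: "\<And>\<phi>. \<phi> \<in> Cc_infty \<Longrightarrow>
      (LINT x|lebesgue. Gu x \<bullet> classical_grad \<phi> x) = (LINT x|lebesgue. q x * \<phi> x)"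
  defines "Z \<equiv> \<lambda>x. T 0 (w x) *\<^sub>R classical_grad \<eta> x + (\<eta> x * T 1 (w x)) *\<^sub>R Gw x"
    and "c \<equiv> \<lambda>x. \<eta> x * T 0 (w x) / (u x + \<epsilon>)"
  shows picone_identity:
      "(LINT x|lebesgue. (norm (Z x))\<^sup>2) - (LINT x|lebesgue. (norm (Z x - c x *\<^sub>R Gu x))\<^sup>2)
       = (LINT x|lebesgue. q x * ((\<eta> x * T 0 (w x))\<^sup>2 / (u x + \<epsilon>)))"
    and picone_square_integrable: "square_integrable Z"
    and picone_defect_square_integrable: "square_integrable (\<lambda>x. Z x - c x *\<^sub>R Gu x)"
proof -
  obtain R where R: "\<And>x. norm x > R \<Longrightarrow> \<eta> x = 0"
    using Cc_infty_support[OF \<eta>] by metis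
  obtain B where B: "B > 0" "\<And>x. \<bar>\<eta> x\<bar> \<le> B"
    using Cc_infty_bounded[OF \<eta>] by metis
  have Gu: "square_integrable Gu" and Gw: "square_integrable Gw"
    using u(1) w by (auto simp: finite_energy_def)
  note g\<eta> = grad_Cc_square_integrable[OF \<eta>]
  note [measurable] = finite_energy_measurable[OF u(1)] finite_energy_measurable[OF w]
    Cc_infty_borel[OF \<eta>] locally_integrable_measurable[OF q]
  have TK: "\<bar>T 0 t\<bar> \<le> K" "\<bar>T 1 t\<bar> \<le> K" for t using T by (auto simp: truncation_derivs_def)
  then have K: "K \<ge> 0" by (meson abs_ge_zero order_trans)
  have [measurable]: "T j \<in> borel_measurable borel" for j
    by (rule borel_measurable_continuous_onI[OF truncation_derivs_continuous[OF T]])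
  define C where "C x a b = \<eta> x * T 0 b / (a + \<epsilon>)" for x a b
  have Cb: "\<bar>C x a b\<bar> \<le> B * K / \<epsilon>" if "a \<ge> 0" for x a b
  proof -
    have "\<bar>C x a b\<bar> = (\<bar>\<eta> x\<bar> * \<bar>T 0 b\<bar>) / (a + \<epsilon>)"
      using that e by (simp add: C_def abs_mult)
    also have "\<dots> \<le> (B * K) / \<epsilon>"
      using that e B(1) K by (intro frac_le mult_mono B TK) auto
    finally show ?thesis .
  qed
  have bnd: "\<bar>2 * T 0 b * C x a b\<bar> \<le> 2 * K * (B * K / \<epsilon>)"
    "\<bar>2 * \<eta> x * T 1 b * C x a b\<bar> \<le> 2 * B * K * (B * K / \<epsilon>)"
    "\<bar>(C x a b)\<^sup>2\<bar> \<le> (B * K / \<epsilon>)\<^sup>2" if "a \<ge> 0" for x a b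
  proof -
    show "\<bar>2 * T 0 b * C x a b\<bar> \<le> 2 * K * (B * K / \<epsilon>)"
      unfolding abs_mult using K by (intro mult_mono Cb[OF that] TK) auto
    show "\<bar>2 * \<eta> x * T 1 b * C x a b\<bar> \<le> 2 * B * K * (B * K / \<epsilon>)"
      unfolding abs_mult using K B(1) by (intro mult_mono Cb[OF that] TK B) auto
    show "\<bar>(C x a b)\<^sup>2\<bar> \<le> (B * K / \<epsilon>)\<^sup>2"
      using power_mono[OF Cb[OF that, of x b], where n = 2] by simp
  qed
  have c: "c x = C x (u x) (w x)" for x by (simp add: c_def C_def)
  have [measurable]: "c \<in> borel_measurable lebesgue" unfolding c_def by measurable
  have AEc: "AE x in lebesgue. \<bar>c x\<bar> \<le> B * K / \<epsilon>"
    using u(2) by eventually_elim (simp add: c Cb)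
  show sZ: "square_integrable Z"
    unfolding Z_def
  proof (intro square_integrable_add square_integrable_bounded_scaleR g\<eta> Gw)
    show "AE x in lebesgue. \<bar>T 0 (w x)\<bar> \<le> K" using TK by simp
    show "AE x in lebesgue. \<bar>\<eta> x * T 1 (w x)\<bar> \<le> B * K"
      unfolding abs_mult using B K by (intro AE_I2 mult_mono TK) auto
  qed measurable
  have scGu: "square_integrable (\<lambda>x. c x *\<^sub>R Gu x)"
    by (rule square_integrable_bounded_scaleR[OF Gu _ AEc]) measurable
  show sD: "square_integrable (\<lambda>x. Z x - c x *\<^sub>R Gu x)"
    by (rule square_integrable_diff[OF sZ scGu])
  obtain U W where U: "\<And>n. smooth (U n)" "\<And>n x. U n x \<ge> 0" and W: "\<And>n. smooth (W n)"
    and sU: "\<And>n. square_integrable (classical_grad (U n))" and sW: "\<And>n. square_integrable (classical_grad (W n))"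
    and limU: "(\<lambda>n. LINT x|lebesgue. (norm (classical_grad (U n) x - Gu x))\<^sup>2) \<longlonglongrightarrow> 0"
    and limW: "(\<lambda>n. LINT x|lebesgue. (norm (classical_grad (W n) x - Gw x))\<^sup>2) \<longlonglongrightarrow> 0"
    and lim: "AE x in lebesgue. norm x \<le> R \<longrightarrow> (\<lambda>n. U n x) \<longlonglongrightarrow> u x \<and> (\<lambda>n. W n x) \<longlonglongrightarrow> w x"
    by (rule smooth_approximations[OF u w, where R = R]) blast
  note [measurable] = continuous_lebesgue_measurable(1)[OF smooth_imp_continuous[OF U(1)]]
    continuous_lebesgue_measurable(1)[OF smooth_imp_continuous[OF W]]
  define cn where "cn n x = C x (U n x) (W n x)" for n x
  have [measurable]: "cn n \<in> borel_measurable lebesgue" for n unfolding cn_def C_def by measurable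
  have lims: "AE x in lebesgue. 0 \<le> u x \<and> (\<lambda>n. T 0 (W n x) * \<eta> x) \<longlonglongrightarrow> T 0 (w x) * \<eta> x \<and>
      (\<lambda>n. T 0 (W n x) * cn n x) \<longlonglongrightarrow> T 0 (w x) * c x \<and>
      (\<lambda>n. \<eta> x * T 1 (W n x) * cn n x) \<longlonglongrightarrow> \<eta> x * T 1 (w x) * c x \<and> (\<lambda>n. cn n x) \<longlonglongrightarrow> c x"
    using lim u(2)
  proof eventually_elim
    case (elim x)
    show ?case
    proof (cases "norm x \<le> R")
      case True
      then have l: "(\<lambda>n. U n x) \<longlonglongrightarrow> u x" "(\<lambda>n. W n x) \<longlonglongrightarrow> w x"
        using elim(1) by auto
      have t: "(\<lambda>n. T j (W n x)) \<longlonglongrightarrow> T j (w x)" for j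
        using continuous_on_tendsto_compose[OF truncation_derivs_continuous[OF T] l(2)] by auto
      have cl: "(\<lambda>n. cn n x) \<longlonglongrightarrow> c x"
        unfolding cn_def c C_def using elim(2) e by (intro tendsto_intros t l) auto
      show ?thesis using elim(2) by (intro conjI tendsto_intros t cl)
    qed (use elim(2) in \<open>simp add: c cn_def C_def R\<close>)
  qed
  define \<phi> where "\<phi> n x = (\<eta> x * T 0 (W n x))\<^sup>2 / (U n x + \<epsilon>)" for n x
  have \<phi>: "\<phi> n \<in> Cc_infty" for n
    unfolding \<phi>_def[abs_def] by (rule picone_test_function(1)[OF \<eta> U W T e])
  have grad: "classical_grad (\<phi> n) x = (2 * T 0 (W n x) * cn n x) *\<^sub>R classical_grad \<eta> x
      + (2 * \<eta> x * T 1 (W n x) * cn n x) *\<^sub>R classical_grad (W n) x - (cn n x)\<^sup>2 *\<^sub>R classical_grad (U n) x" for n x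
    unfolding \<phi>_def[abs_def] cn_def C_def by (rule picone_test_function(2)[OF \<eta> U W T e])
  have bn: "\<bar>2 * T 0 (W n x) * cn n x\<bar> \<le> 2 * K * (B * K / \<epsilon>)"
    "\<bar>2 * \<eta> x * T 1 (W n x) * cn n x\<bar> \<le> 2 * B * K * (B * K / \<epsilon>)"
    "\<bar>(cn n x)\<^sup>2\<bar> \<le> (B * K / \<epsilon>)\<^sup>2" for n x
    unfolding cn_def by (intro bnd U)+
  have b: "AE x in lebesgue. \<bar>2 * T 0 (w x) * c x\<bar> \<le> 2 * K * (B * K / \<epsilon>)"
    "AE x in lebesgue. \<bar>2 * \<eta> x * T 1 (w x) * c x\<bar> \<le> 2 * B * K * (B * K / \<epsilon>)"
    "AE x in lebesgue. \<bar>(c x)\<^sup>2\<bar> \<le> (B * K / \<epsilon>)\<^sup>2"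
    unfolding c by (rule eventually_mono[OF u(2)], erule bnd)+
  have "(\<lambda>n. (LINT x|lebesgue. (2 * T 0 (W n x) * cn n x) * (Gu x \<bullet> classical_grad \<eta> x))
        + (LINT x|lebesgue. (2 * \<eta> x * T 1 (W n x) * cn n x) * (Gu x \<bullet> classical_grad (W n) x))
        - (LINT x|lebesgue. (cn n x)\<^sup>2 * (Gu x \<bullet> classical_grad (U n) x)))
      \<longlonglongrightarrow> (LINT x|lebesgue. (2 * T 0 (w x) * c x) * (Gu x \<bullet> classical_grad \<eta> x))
        + (LINT x|lebesgue. (2 * \<eta> x * T 1 (w x) * c x) * (Gu x \<bullet> Gw x))
        - (LINT x|lebesgue. (c x)\<^sup>2 * (Gu x \<bullet> Gu x))"
  proof (intro tendsto_diff tendsto_add)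
    show "(\<lambda>n. LINT x|lebesgue. (2 * T 0 (W n x) * cn n x) * (Gu x \<bullet> classical_grad \<eta> x))
        \<longlonglongrightarrow> (LINT x|lebesgue. (2 * T 0 (w x) * c x) * (Gu x \<bullet> classical_grad \<eta> x))"
    proof (rule integral_inner_tendsto[OF Gu g\<eta> g\<eta> _ _ bn(1)])
      show "AE x in lebesgue. (\<lambda>n. 2 * T 0 (W n x) * cn n x) \<longlonglongrightarrow> 2 * T 0 (w x) * c x"
        using lims by eventually_elim (simp add: mult.assoc tendsto_mult_left)
    qed auto
    show "(\<lambda>n. LINT x|lebesgue. (2 * \<eta> x * T 1 (W n x) * cn n x) * (Gu x \<bullet> classical_grad (W n) x))
        \<longlonglongrightarrow> (LINT x|lebesgue. (2 * \<eta> x * T 1 (w x) * c x) * (Gu x \<bullet> Gw x))"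
    proof (rule integral_inner_tendsto[OF Gu Gw sW limW _ bn(2)])
      show "AE x in lebesgue. (\<lambda>n. 2 * \<eta> x * T 1 (W n x) * cn n x) \<longlonglongrightarrow> 2 * \<eta> x * T 1 (w x) * c x"
        using lims by eventually_elim (simp only: mult.assoc tendsto_mult_left)
    qed auto
    show "(\<lambda>n. LINT x|lebesgue. (cn n x)\<^sup>2 * (Gu x \<bullet> classical_grad (U n) x))
        \<longlonglongrightarrow> (LINT x|lebesgue. (c x)\<^sup>2 * (Gu x \<bullet> Gu x))"
    proof (rule integral_inner_tendsto[OF Gu Gu sU limU _ bn(3)])
      show "AE x in lebesgue. (\<lambda>n. (cn n x)\<^sup>2) \<longlonglongrightarrow> (c x)\<^sup>2"
        using lims by eventually_elim (simp add: tendsto_power)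
    qed auto
  qed
  moreover have "(LINT x|lebesgue. Gu x \<bullet> classical_grad (\<phi> n) x)
      = (LINT x|lebesgue. (2 * T 0 (W n x) * cn n x) * (Gu x \<bullet> classical_grad \<eta> x))
        + (LINT x|lebesgue. (2 * \<eta> x * T 1 (W n x) * cn n x) * (Gu x \<bullet> classical_grad (W n) x))
        - (LINT x|lebesgue. (cn n x)\<^sup>2 * (Gu x \<bullet> classical_grad (U n) x))" for n
  proof -
    have "integrable lebesgue (\<lambda>x. (2 * T 0 (W n x) * cn n x) * (Gu x \<bullet> classical_grad \<eta> x))"
      by (rule integrable_bounded_mult[OF square_integrable_inner[OF Gu g\<eta>] _ AE_I2[OF bn(1)]]) measurable
    moreover have "integrable lebesgue (\<lambda>x. (2 * \<eta> x * T 1 (W n x) * cn n x) * (Gu x \<bullet> classical_grad (W n) x))"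
      by (rule integrable_bounded_mult[OF square_integrable_inner[OF Gu sW] _ AE_I2[OF bn(2)]]) measurable
    moreover have "integrable lebesgue (\<lambda>x. (cn n x)\<^sup>2 * (Gu x \<bullet> classical_grad (U n) x))"
      by (rule integrable_bounded_mult[OF square_integrable_inner[OF Gu sU] _ AE_I2[OF bn(3)]]) measurable
    ultimately show ?thesis
      unfolding grad inner_diff_right inner_add_right inner_scaleR_right by simp
  qed
  moreover have "(\<lambda>n. LINT x|lebesgue. q x * \<phi> n x)
      \<longlonglongrightarrow> (LINT x|lebesgue. q x * ((\<eta> x * T 0 (w x))\<^sup>2 / (u x + \<epsilon>)))"
  proof (rule integral_dominated_convergence)
    have "(\<lambda>x. \<eta> x * \<eta> x) \<in> Cc_infty" by (rule Cc_infty_mult[OF \<eta> Cc_infty_smooth[OF \<eta>]])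
    from integrable_abs[OF locally_integrable_Cc_mult[OF q this]]
    show "integrable lebesgue (\<lambda>x. (K\<^sup>2 / \<epsilon>) * \<bar>\<eta> x * \<eta> x * q x\<bar>)" by (rule integrable_mult_right)
    show "AE x in lebesgue. norm (q x * \<phi> n x) \<le> (K\<^sup>2 / \<epsilon>) * \<bar>\<eta> x * \<eta> x * q x\<bar>" for n
    proof (rule AE_I2)
      fix x
      have "\<bar>T 0 (W n x)\<bar>\<^sup>2 \<le> K\<^sup>2" by (intro power_mono TK) simp
      then have "(T 0 (W n x))\<^sup>2 / (U n x + \<epsilon>) \<le> K\<^sup>2 / \<epsilon>"
        using U(2)[of n x] e by (intro frac_le) auto
      then have "\<bar>\<eta> x * \<eta> x * q x\<bar> * ((T 0 (W n x))\<^sup>2 / (U n x + \<epsilon>)) \<le> \<bar>\<eta> x * \<eta> x * q x\<bar> * (K\<^sup>2 / \<epsilon>)"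
        by (rule mult_left_mono) simp
      moreover have "norm (q x * \<phi> n x) = \<bar>\<eta> x * \<eta> x * q x\<bar> * ((T 0 (W n x))\<^sup>2 / (U n x + \<epsilon>))"
      proof -
        have "norm (q x * \<phi> n x) = \<bar>q x\<bar> * ((\<eta> x)\<^sup>2 * (T 0 (W n x))\<^sup>2 / (U n x + \<epsilon>))"
          using U(2)[of n x] e by (simp add: \<phi>_def abs_mult power_mult_distrib)
        moreover have "\<bar>\<eta> x * \<eta> x * q x\<bar> = (\<eta> x)\<^sup>2 * \<bar>q x\<bar>"
          by (simp add: abs_mult power2_eq_square)
        ultimately show ?thesis by simp
      qed
      ultimately show "norm (q x * \<phi> n x) \<le> (K\<^sup>2 / \<epsilon>) * \<bar>\<eta> x * \<eta> x * q x\<bar>" by (simp only: mult.commute)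
    qed
    show "AE x in lebesgue. (\<lambda>n. q x * \<phi> n x) \<longlonglongrightarrow> q x * ((\<eta> x * T 0 (w x))\<^sup>2 / (u x + \<epsilon>))"
      using lims
    proof eventually_elim
      case (elim x)
      have "(\<lambda>n. q x * ((T 0 (W n x) * \<eta> x) * cn n x)) \<longlonglongrightarrow> q x * ((T 0 (w x) * \<eta> x) * c x)"
        by (rule tendsto_mult[OF tendsto_const tendsto_mult]) (use elim in auto)
      then show ?case by (simp add: \<phi>_def cn_def C_def c_def power2_eq_square mult_ac)
    qed
  qed (use Cc_infty_borel[OF \<phi>] in measurable)
  ultimately have lim_eq: "(LINT x|lebesgue. (2 * T 0 (w x) * c x) * (Gu x \<bullet> classical_grad \<eta> x))
        + (LINT x|lebesgue. (2 * \<eta> x * T 1 (w x) * c x) * (Gu x \<bullet> Gw x))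
        - (LINT x|lebesgue. (c x)\<^sup>2 * (Gu x \<bullet> Gu x))
      = (LINT x|lebesgue. q x * ((\<eta> x * T 0 (w x))\<^sup>2 / (u x + \<epsilon>)))"
    using eq[OF \<phi>] by (simp add: LIMSEQ_unique)
  have "(LINT x|lebesgue. (norm (Z x))\<^sup>2) - (LINT x|lebesgue. (norm (Z x - c x *\<^sub>R Gu x))\<^sup>2)
      = (LINT x|lebesgue. (norm (Z x))\<^sup>2 - (norm (Z x - c x *\<^sub>R Gu x))\<^sup>2)"
    by (rule Bochner_Integration.integral_diff[symmetric])
      (intro square_integrable_integrable sZ sD)+
  also have "\<dots> = (LINT x|lebesgue. (2 * T 0 (w x) * c x) * (Gu x \<bullet> classical_grad \<eta> x)
        + (2 * \<eta> x * T 1 (w x) * c x) * (Gu x \<bullet> Gw x) - (c x)\<^sup>2 * (Gu x \<bullet> Gu x))"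
    unfolding Z_def norm_diff_picone by (simp add: mult.assoc)
  also have "\<dots> = (LINT x|lebesgue. (2 * T 0 (w x) * c x) * (Gu x \<bullet> classical_grad \<eta> x))
        + (LINT x|lebesgue. (2 * \<eta> x * T 1 (w x) * c x) * (Gu x \<bullet> Gw x))
        - (LINT x|lebesgue. (c x)\<^sup>2 * (Gu x \<bullet> Gu x))"
  proof -
    have "integrable lebesgue (\<lambda>x. (2 * T 0 (w x) * c x) * (Gu x \<bullet> classical_grad \<eta> x))"
      by (rule integrable_bounded_mult[OF square_integrable_inner[OF Gu g\<eta>] _ b(1)]) measurable
    moreover have "integrable lebesgue (\<lambda>x. (2 * \<eta> x * T 1 (w x) * c x) * (Gu x \<bullet> Gw x))"
      by (rule integrable_bounded_mult[OF square_integrable_inner[OF Gu Gw] _ b(2)]) measurable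
    moreover have "integrable lebesgue (\<lambda>x. (c x)\<^sup>2 * (Gu x \<bullet> Gu x))"
      by (rule integrable_bounded_mult[OF square_integrable_inner[OF Gu Gu] _ b(3)]) measurable
    ultimately show ?thesis by simp
  qed
  finally show "(LINT x|lebesgue. (norm (Z x))\<^sup>2) - (LINT x|lebesgue. (norm (Z x - c x *\<^sub>R Gu x))\<^sup>2)
       = (LINT x|lebesgue. q x * ((\<eta> x * T 0 (w x))\<^sup>2 / (u x + \<epsilon>)))"
    using lim_eq by simp
qed

section \<open>Functions of finite Dirichlet energy and weak solutions\<close>

lemma abs_powr_2: "\<bar>x::real\<bar> powr 2 = x\<^sup>2"
  by (cases "x = 0") (auto simp: powr_numeral)

lemma sobolev_exponent_ge_2:
  assumes "CARD('n::finite) \<ge> 3"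
  shows "sobolev_exponent TYPE('n) \<ge> 2"
proof -
  have "real CARD('n) - 2 > 0" using assms by linarith
  then show ?thesis by (simp add: sobolev_exponent_def field_simps)
qed

text \<open>
  Lower powers of \<open>u\<close> are controlled by \<open>1 + u\<^sup>p\<close>, hence are locally integrable against \<open>|h|\<close>.
\<close>

lemma powr_diff_le:
  fixes t a p :: real
  assumes "t \<ge> 0" "0 \<le> a" "a \<le> p"
  shows "t powr (p - a) \<le> 1 + t powr p"
proof (cases "t \<le> 1")
  case True
  have "t powr (p - a) \<le> 1" using True assms by (intro powr_le1) auto
  then show ?thesis using powr_ge_zero[of t p] by linarith
next
  case False
  then have "t powr (p - a) \<le> t powr p" using assms by (intro powr_mono) auto
  then show ?thesis by linarith
qed

lemma power2_le_powr: "s \<ge> 2 \<Longrightarrow> t\<^sup>2 \<le> 1 + \<bar>t\<bar> powr s" for t s :: real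
  using powr_diff_le[of "\<bar>t\<bar>" "s - 2" s] by (simp add: abs_powr_2)

text \<open>
  Membership in \<open>L\<^sup>2\<^sup>*\<close> gives local square integrability because \<open>2\<^sup>* \<ge> 2\<close>.
\<close>

lemma D12_finite_energy:
  fixes u :: "real^'n::finite \<Rightarrow> real"
  assumes N: "CARD('n) \<ge> 3" and u: "u \<in> D12"
  shows "finite_energy u (weak_grad u)"
  unfolding finite_energy_def
proof (intro conjI allI)
  show wg: "has_weak_gradient u (weak_grad u)"
    using u someI_ex[of "has_weak_gradient u"] unfolding weak_grad_def by (simp add: D12_def)
  show "square_integrable (weak_grad u)"
    using u wg by (auto simp: square_integrable_def D12_def has_weak_gradient_def
        intro: locally_integrable_measurable)
  fix R
  have u': "u \<in> borel_measurable lebesgue" "integrable lebesgue (\<lambda>x. \<bar>u x\<bar> powr sobolev_exponent TYPE('n))"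
    using u by (auto simp: D12_def weighted_Lq_def)
  show "square_integrable (\<lambda>x. indicator (cball 0 R) x * u x)"
  proof (rule square_integrable_bound)
    show "(\<lambda>x. indicator (cball 0 R) x * u x) \<in> borel_measurable lebesgue"
      using u'(1) by (intro borel_measurable_times borel_measurable_indicator fmeasurableD lmeasurable_cball)
    show "integrable lebesgue (\<lambda>x. indicator (cball 0 R) x + \<bar>u x\<bar> powr sobolev_exponent TYPE('n))"
      using u'(2) indicator_cball_integrable[of "0::real^'n" R] by (intro Bochner_Integration.integrable_add)
    show "AE x in lebesgue. (norm (indicat_real (cball 0 R) x * u x))\<^sup>2
        \<le> indicator (cball 0 R) x + \<bar>u x\<bar> powr sobolev_exponent TYPE('n)"
      using power2_le_powr[OF sobolev_exponent_ge_2[OF N]] by (intro AE_I2) (auto simp: indicator_def)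
  qed
qed

text \<open>
  Throughout the arguments below a positive weak solution is fixed; \<open>rhs\<close> is the right-hand side of
  \<open>-\<Delta>u = l V u - h u\<^sup>p\<^sup>-\<^sup>1\<close>, a locally integrable function because \<open>u\<close> belongs to \<open>L\<^sup>2(|V|)\<close> and
  \<open>L\<^sup>p(|h|)\<close> and the weights are continuous.
\<close>

locale positive_solution =
  fixes p :: real and h V :: "real^'n::finite \<Rightarrow> real" and l :: real and u :: "real^'n \<Rightarrow> real"
  assumes dim: "CARD('n) \<ge> 3" and p: "p > 2" and h: "continuous_on UNIV h" and V: "continuous_on UNIV V"
    and solution: "positive_weak_solution p V h l u"
begin

abbreviation Gu where "Gu \<equiv> weak_grad u"

abbreviation rhs where "rhs x \<equiv> l * (V x * u x) - h x * u x powr (p - 1)"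

lemma u_pos: "AE x in lebesgue. 0 < u x"
  using solution by (simp add: positive_weak_solution_def)

lemma u_nonneg: "AE x in lebesgue. 0 \<le> u x"
  using u_pos by eventually_elim simp

lemma u_integrable_V: "integrable lebesgue (\<lambda>x. \<bar>V x\<bar> * \<bar>u x\<bar> powr 2)"
  and u_integrable_h: "integrable lebesgue (\<lambda>x. \<bar>h x\<bar> * \<bar>u x\<bar> powr p)"
  using solution by (auto simp: positive_weak_solution_def weak_solution_def energy_space_def weighted_Lq_def)

lemma finite_energy_u: "finite_energy u Gu"
  using solution
  by (intro D12_finite_energy dim) (simp add: positive_weak_solution_def weak_solution_def energy_space_def)

lemma square_integrable_Gu: "square_integrable Gu"
  using finite_energy_u by (simp add: finite_energy_def)

lemmas solution_measurable [measurable] = finite_energy_measurable[OF finite_energy_u]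
  square_integrable_measurable[OF square_integrable_Gu]
  continuous_lebesgue_measurable(1)[OF h] continuous_lebesgue_measurable(1)[OF V]

lemma
  shows locally_integrable_Vu: "locally_integrable (\<lambda>x. V x * u x)"
    and locally_integrable_hu: "locally_integrable (\<lambda>x. h x * u x powr (p - 1))"
    and locally_integrable_rhs: "locally_integrable rhs"
    and weak_equation: "\<And>\<phi>. \<phi> \<in> Cc_infty \<Longrightarrow>
      (LINT x|lebesgue. Gu x \<bullet> classical_grad \<phi> x) = (LINT x|lebesgue. rhs x * \<phi> x)"
proof -
  show lV: "locally_integrable (\<lambda>x. V x * u x)"
  proof (rule locally_integrable_dominated[OF _ locally_integrable_continuous[OF V] u_integrable_V])
    have "\<bar>V x * u x\<bar> \<le> \<bar>V x\<bar> + \<bar>V x\<bar> * \<bar>u x\<bar> powr 2" for x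
    proof -
      have "\<bar>u x\<bar> \<le> 1 + (u x)\<^sup>2"
        using sum_squares_bound[of 1 "\<bar>u x\<bar>"] abs_ge_zero[of "u x"] unfolding one_power2 mult_1_right power2_abs
        by linarith
      from mult_left_mono[OF this abs_ge_zero[of "V x"]] show ?thesis
        by (simp add: abs_mult abs_powr_2 ring_distribs)
    qed
    then show "AE x in lebesgue. norm (V x * u x) \<le> \<bar>V x\<bar> + \<bar>\<bar>V x\<bar> * \<bar>u x\<bar> powr 2\<bar>"
      by (intro AE_I2) simp
  qed measurable
  show lh: "locally_integrable (\<lambda>x. h x * u x powr (p - 1))"
  proof (rule locally_integrable_dominated[OF _ locally_integrable_continuous[OF h] u_integrable_h])
    show "AE x in lebesgue. norm (h x * u x powr (p - 1)) \<le> \<bar>h x\<bar> + \<bar>\<bar>h x\<bar> * \<bar>u x\<bar> powr p\<bar>"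
      using u_nonneg
    proof eventually_elim
      case (elim x)
      from mult_left_mono[OF powr_diff_le[OF elim, of 1 p] abs_ge_zero[of "h x"]] p
      show ?case using elim by (simp add: abs_mult ring_distribs)
    qed
  qed measurable
  have iV: "integrable lebesgue (\<lambda>x. \<phi> x * (V x * u x))"
    and ih: "integrable lebesgue (\<lambda>x. \<phi> x * (h x * u x powr (p - 1)))" if "\<phi> \<in> Cc_infty" for \<phi>
    using locally_integrable_Cc_mult[OF lV that] locally_integrable_Cc_mult[OF lh that] by auto
  show "locally_integrable rhs"
    using lV lh unfolding locally_integrable_def set_integrable_def
    by (auto simp: right_diff_distrib mult.left_commute)
  show "(LINT x|lebesgue. Gu x \<bullet> classical_grad \<phi> x) = (LINT x|lebesgue. rhs x * \<phi> x)"
    if \<phi>: "\<phi> \<in> Cc_infty" for \<phi>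
  proof -
    have "(LINT x|lebesgue. rhs x * \<phi> x)
        = (LINT x|lebesgue. l * (\<phi> x * (V x * u x)) - \<phi> x * (h x * u x powr (p - 1)))"
      by (simp add: algebra_simps)
    also have "\<dots> = l * (LINT x|lebesgue. V x * u x * \<phi> x) - (LINT x|lebesgue. h x * u x powr (p - 1) * \<phi> x)"
      using iV[OF \<phi>] ih[OF \<phi>] by (simp add: mult_ac)
    moreover have "(LINT x|lebesgue. Gu x \<bullet> classical_grad \<phi> x)
        - l * (LINT x|lebesgue. V x * u x * \<phi> x)
        + (LINT x|lebesgue. h x * u x powr (p - 1) * \<phi> x) = 0"
      using solution \<phi> by (simp add: positive_weak_solution_def weak_solution_def)
    ultimately show ?thesis by linarith
  qed
qed

end

section \<open>Cutoff functions\<close>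

text \<open>
  A rescaled bump with value \<open>1\<close> at the origin. It need not equal \<open>1\<close> on a neighbourhood of the
  origin: its pointwise convergence to \<open>1\<close> and a gradient of order \<open>1/n\<close> on a ball of radius of order
  \<open>n\<close> suffice.
\<close>

definition cutoff :: "nat \<Rightarrow> real^'n::finite \<Rightarrow> real" where
  "cutoff n x = bump ((1 / real (Suc n)) *\<^sub>R x) * inverse (bump (0 :: real^'n))"

lemma bump_0_pos: "bump 0 > 0"
  by (simp only: bump_pos_iff) simp

lemma cutoff_Cc: "cutoff n \<in> Cc_infty"
  unfolding cutoff_def[abs_def] by (rule Cc_infty_mult[OF bump_scaled_Cc smooth_const]) simp

lemma cutoff_nonneg: "cutoff n x \<ge> 0"
  unfolding cutoff_def by (intro mult_nonneg_nonneg bump_nonneg) (simp add: bump_nonneg)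

lemma cutoff_le_1: "cutoff n (x :: real^'n::finite) \<le> 1"
proof -
  have "cutoff n x \<le> bump (0 :: real^'n) * inverse (bump (0 :: real^'n))"
    unfolding cutoff_def by (intro mult_right_mono bump_le) (simp add: bump_nonneg)
  then show ?thesis using bump_0_pos[where 'a = 'n] by simp
qed

lemma inverse_Suc_tendsto_0: "(\<lambda>n. 1 / real (Suc n)) \<longlonglongrightarrow> 0"
  using LIMSEQ_inverse_real_of_nat by (simp add: inverse_eq_divide)

lemma cutoff_tendsto: "(\<lambda>n. cutoff n (x :: real^'n::finite)) \<longlonglongrightarrow> 1"
proof -
  have "(\<lambda>n. (1 / real (Suc n)) *\<^sub>R x) \<longlonglongrightarrow> 0 *\<^sub>R x"
    by (intro tendsto_scaleR inverse_Suc_tendsto_0 tendsto_const)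
  then have "(\<lambda>n. bump ((1 / real (Suc n)) *\<^sub>R x)) \<longlonglongrightarrow> bump (0 *\<^sub>R x)"
    using continuous_on_tendsto_compose[OF smooth_imp_continuous[OF smooth_bump]] by auto
  then have "(\<lambda>n. cutoff n x) \<longlonglongrightarrow> bump (0 *\<^sub>R x) * inverse (bump (0 :: real^'n))"
    unfolding cutoff_def by (intro tendsto_mult tendsto_const)
  then show ?thesis using bump_0_pos[where 'a = 'n] by simp
qed

lemma cutoff_grad_bound:
  obtains M where "M > 0"
    "\<And>n (x :: real^'n::finite). norm (classical_grad (cutoff n) x) \<le> M / real (Suc n)"
    "\<And>n (x :: real^'n::finite). norm x > real (Suc n) \<Longrightarrow> classical_grad (cutoff n) x = 0"
proof -
  let ?g = "classical_grad (bump :: real^'n \<Rightarrow> real)"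
  have g0: "?g x = 0" if "norm x > 1" for x
  proof -
    have "bump x = 0" if "norm x > 1" for x :: "real^'n"
      using bump_zero[of x] that by simp
    from partial_deriv_zero_outside[OF this that] show ?thesis
      by (simp add: classical_grad_def vec_eq_iff)
  qed
  obtain M where M: "M > 0" "\<And>x. norm (?g x) \<le> M"
    using compact_support_bounded[OF smooth_continuous_grad[OF smooth_bump] g0] by metis
  let ?b = "inverse (bump (0 :: real^'n))"
  have b: "?b > 0" using bump_0_pos by simp
  have grad: "classical_grad (cutoff n) x = (?b * (1 / real (Suc n))) *\<^sub>R ?g ((1 / real (Suc n)) *\<^sub>R x)" for n and x :: "real^'n"
  proof (rule classical_grad_eq)
    have "((\<lambda>x::real^'n. bump ((1 / real (Suc n)) *\<^sub>R x)) has_derivative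
        (\<lambda>h. ?g ((1 / real (Suc n)) *\<^sub>R x) \<bullet> ((1 / real (Suc n)) *\<^sub>R h))) (at x)"
      by (rule has_derivative_compose[of _ _ _ _ bump, OF _ smooth_has_derivative[OF smooth_bump]])
        (intro has_derivative_scaleR_right has_derivative_ident)
    from has_derivative_mult_left[OF this, of ?b]
    show "(cutoff n has_derivative (\<lambda>h. ((?b * (1 / real (Suc n))) *\<^sub>R ?g ((1 / real (Suc n)) *\<^sub>R x)) \<bullet> h)) (at x)"
      unfolding cutoff_def[abs_def] by (simp add: mult_ac)
  qed
  have "norm (classical_grad (cutoff n) x) \<le> ?b * M / real (Suc n)" for n and x :: "real^'n"
  proof -
    have "norm (classical_grad (cutoff n) x) = (?b * (1 / real (Suc n))) * norm (?g ((1 / real (Suc n)) *\<^sub>R x))"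
      unfolding grad norm_scaleR using b by (simp only: abs_mult abs_of_pos abs_of_nonneg) simp
    also have "\<dots> \<le> (?b * (1 / real (Suc n))) * M"
      using b by (intro mult_left_mono M) simp
    finally show ?thesis by simp
  qed
  moreover have "classical_grad (cutoff n) x = 0" if "norm x > real (Suc n)" for n and x :: "real^'n"
  proof -
    have "norm ((1 / real (Suc n)) *\<^sub>R x) > 1" using that by (simp add: field_simps del: of_nat_Suc)
    then show ?thesis unfolding grad by (simp only: g0) simp
  qed
  ultimately show ?thesis using that[of "?b * M"] M(1) b by simp
qed

text \<open>
  Young's inequality with the exponents \<open>N/(N-2)\<close> and \<open>N/2\<close>, up to the constants. If
  \<open>t\<^sup>2 \<le> \<delta> b\<^sup>N\<^sup>-\<^sup>2\<close>, the first summand suffices; otherwise \<open>b\<close> is bounded by a power of \<open>t\<close>, and the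
  second one does.
\<close>

lemma sobolev_young:
  fixes t b \<delta> :: real
  assumes N: "N \<ge> 3" and \<delta>: "\<delta> > 0" and b: "b > 0"
  shows "t\<^sup>2 * b\<^sup>2 \<le> \<delta> * b ^ N + \<delta> powr (- 2 / (real N - 2)) * \<bar>t\<bar> powr (2 * real N / (real N - 2))"
proof -
  have N2: "real N - 2 > 0" using N by linarith
  have "N - 2 + 2 = N" using N by simp
  then have bN: "b ^ N = b ^ (N - 2) * b\<^sup>2" using power_add[of b "N - 2" 2] by metis
  show ?thesis
  proof (cases "t\<^sup>2 \<le> \<delta> * b ^ (N - 2)")
    case True
    then have "t\<^sup>2 * b\<^sup>2 \<le> \<delta> * b ^ (N - 2) * b\<^sup>2" by (intro mult_right_mono) auto
    also have "\<dots> = \<delta> * b ^ N" by (simp add: bN)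
    finally show ?thesis using mult_nonneg_nonneg[OF powr_ge_zero powr_ge_zero] by (simp add: add_increasing2)
  next
    case False
    then have t: "\<bar>t\<bar> > 0" using \<delta> b by auto
    have "b ^ (N - 2) < t\<^sup>2 / \<delta>" using False \<delta> by (simp add: field_simps)
    then have "b powr (real N - 2) \<le> t\<^sup>2 / \<delta>" using b N by (simp flip: powr_realpow add: of_nat_diff)
    then have "(b powr (real N - 2)) powr (2 / (real N - 2)) \<le> (t\<^sup>2 / \<delta>) powr (2 / (real N - 2))"
      using N2 by (intro powr_mono2) auto
    moreover have "(b powr (real N - 2)) powr (2 / (real N - 2)) = b\<^sup>2"
    proof -
      have "(real N - 2) * (2 / (real N - 2)) = 2"
        using nonzero_mult_div_cancel_left[OF less_imp_neq[OF N2, symmetric], of 2]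
        by (simp only: times_divide_eq_right)
      then show ?thesis unfolding powr_powr using abs_powr_2[of b] b by simp
    qed
    ultimately have "b\<^sup>2 \<le> (t\<^sup>2 / \<delta>) powr (2 / (real N - 2))" by simp
    also have "\<dots> = (\<bar>t\<bar> powr 2) powr (2 / (real N - 2)) * \<delta> powr (- 2 / (real N - 2))"
    proof -
      have "\<delta> powr (- 2 / (real N - 2)) = 1 / \<delta> powr (2 / (real N - 2))"
        using powr_minus_divide[of \<delta> "2 / (real N - 2)"] by simp
      then show ?thesis
        using powr_divide[of "t\<^sup>2" \<delta> "2 / (real N - 2)"] \<delta> by (simp add: abs_powr_2)
    qed
    finally have "b\<^sup>2 \<le> \<bar>t\<bar> powr (2 * (2 / (real N - 2))) * \<delta> powr (- 2 / (real N - 2))"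
      unfolding powr_powr .
    then have "t\<^sup>2 * b\<^sup>2 \<le> \<bar>t\<bar> powr 2 * (\<bar>t\<bar> powr (2 * (2 / (real N - 2))) * \<delta> powr (- 2 / (real N - 2)))"
      unfolding abs_powr_2 by (rule mult_left_mono) simp
    also have "\<dots> = \<delta> powr (- 2 / (real N - 2)) * \<bar>t\<bar> powr (2 + 2 * (2 / (real N - 2)))"
      by (simp add: powr_add)
    also have "2 + 2 * (2 / (real N - 2)) = 2 * real N / (real N - 2)"
      using N2 by (simp add: field_simps)
    finally show ?thesis using \<delta> b by (simp add: add_increasing)
  qed
qed

text \<open>
  The gradient of the cutoff is bounded by \<open>M/n\<close> on a ball of volume \<open>v n\<^sup>N\<close>, so the integral of
  \<open>|\<nabla>\<eta>|\<^sup>N\<close> stays bounded but does not tend to \<open>0\<close>. Young's inequality therefore splits off a part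
  with integral at most \<open>\<delta> M\<^sup>N v\<close>; what exceeds it is dominated by a multiple of \<open>|w|\<^sup>2\<^sup>*\<close> and tends to
  \<open>0\<close> pointwise.
\<close>

lemma cutoff_grad_tendsto:
  fixes w :: "real^'n::finite \<Rightarrow> real"
  assumes N: "CARD('n) \<ge> 3" and w: "w \<in> borel_measurable lebesgue"
    "integrable lebesgue (\<lambda>x. \<bar>w x\<bar> powr sobolev_exponent TYPE('n))"
  shows "(\<lambda>n. LINT x|lebesgue. (w x)\<^sup>2 * (norm (classical_grad (cutoff n) x))\<^sup>2) \<longlonglongrightarrow> 0"
proof -
  note [measurable] = w(1)
  obtain M where M: "M > 0" "\<And>n (x :: real^'n). norm (classical_grad (cutoff n) x) \<le> M / real (Suc n)"
    "\<And>n (x :: real^'n). norm x > real (Suc n) \<Longrightarrow> classical_grad (cutoff n) x = 0"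
    by (rule cutoff_grad_bound) blast
  let ?s = "sobolev_exponent TYPE('n)" and ?N = "CARD('n)"
  define v where "v = measure lebesgue (cball (0 :: real^'n) 1)"
  have v: "v \<ge> 0" by (simp add: v_def)
  define f where "f n x = (w x)\<^sup>2 * (norm (classical_grad (cutoff n) x))\<^sup>2" for n x
  have [measurable]: "classical_grad (cutoff n) \<in> borel_measurable lebesgue" for n :: nat
    by (intro continuous_lebesgue_measurable smooth_continuous_grad Cc_infty_smooth cutoff_Cc)
  have fm [measurable]: "f n \<in> borel_measurable lebesgue" for n unfolding f_def by measurable
  have fle: "f n x \<le> (w x)\<^sup>2 * (M / real (Suc n))\<^sup>2" for n x
    unfolding f_def by (intro mult_left_mono power_mono M(2)) auto
  have f0: "f n x \<ge> 0" for n x by (simp add: f_def)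
  have lim0: "(\<lambda>n. f n x) \<longlonglongrightarrow> 0" for x
  proof (rule tendsto_sandwich[OF _ _ tendsto_const])
    have "(\<lambda>n. (w x)\<^sup>2 * (M * (1 / real (Suc n)))\<^sup>2) \<longlonglongrightarrow> (w x)\<^sup>2 * (M * 0)\<^sup>2"
      by (intro tendsto_intros inverse_Suc_tendsto_0)
    then show "(\<lambda>n. (w x)\<^sup>2 * (M / real (Suc n))\<^sup>2) \<longlonglongrightarrow> 0" by simp
  qed (use fle f0 in auto)
  define b where "b n x = (M / real (Suc n)) ^ ?N * indicator (cball 0 (real (Suc n))) x" for n and x :: "real^'n"
  have bi: "integrable lebesgue (b n)" for n
    unfolding b_def by (intro integrable_mult_right indicator_cball_integrable)
  have b_int: "(LINT x|lebesgue. b n x) = M ^ ?N * v" for n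
  proof -
    have "measure lebesgue (cball (0 :: real^'n) (real (Suc n))) = real (Suc n) ^ ?N * v"
      by (simp add: v_def content_cball measure_completion del: of_nat_Suc)
    then show ?thesis by (simp add: b_def power_divide del: of_nat_Suc)
  qed
  show ?thesis
    unfolding f_def[symmetric]
  proof (rule LIMSEQ_I)
    fix e :: real assume e: "e > 0"
    define \<delta> where "\<delta> = e / (2 * (M ^ ?N * v + 1))"
    have Mv: "M ^ ?N * v \<ge> 0" using M(1) v by simp
    then have \<delta>: "\<delta> > 0" using e by (simp add: \<delta>_def)
    define C where "C = \<delta> powr (- 2 / (real ?N - 2))"
    have young: "f n x \<le> \<delta> * b n x + C * \<bar>w x\<bar> powr ?s" for n x
    proof (cases "x \<in> cball 0 (real (Suc n))")
      case True
      have "f n x \<le> (w x)\<^sup>2 * (M / real (Suc n))\<^sup>2" by (rule fle)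
      also have "\<dots> \<le> \<delta> * (M / real (Suc n)) ^ ?N + C * \<bar>w x\<bar> powr ?s"
        unfolding C_def sobolev_exponent_def using M(1) by (intro sobolev_young N \<delta>) simp
      finally show ?thesis using True by (simp add: b_def)
    next
      case False
      then have "f n x = 0" using M(3)[of n x] by (simp add: f_def)
      then show ?thesis using False by (simp add: b_def C_def)
    qed
    have Ci: "integrable lebesgue (\<lambda>x. C * \<bar>w x\<bar> powr ?s)" using w(2) by simp
    \<comment> \<open>the part of \<open>f n\<close> in excess of \<open>\<delta> b n\<close>, to which dominated convergence applies\<close>
    define g where "g n x = max 0 (f n x - \<delta> * b n x)" for n x
    have [measurable]: "b n \<in> borel_measurable lebesgue" for n
      using bi by (rule borel_measurable_integrable)
    have gm [measurable]: "g n \<in> borel_measurable lebesgue" for n unfolding g_def by measurable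
    have gC: "norm (g n x) \<le> C * \<bar>w x\<bar> powr ?s" for n x
      using young[of n x] by (auto simp: g_def C_def)
    have gi: "integrable lebesgue (g n)" for n
      by (rule Bochner_Integration.integrable_bound[OF Ci gm]) (use gC order_trans[OF gC abs_ge_self] in auto)
    have "(\<lambda>n. LINT x|lebesgue. g n x) \<longlonglongrightarrow> (LINT x|(lebesgue :: (real^'n) measure). 0)"
    proof (rule integral_dominated_convergence[OF _ gm Ci])
      have "(\<lambda>n. g n x) \<longlonglongrightarrow> 0" for x
      proof (rule tendsto_sandwich[OF _ _ tendsto_const lim0[of x]])
        have "b n x \<ge> 0" for n using M(1) by (simp add: b_def)
        then show "\<forall>\<^sub>F n in sequentially. g n x \<le> f n x"
          using \<delta> f0 by (intro always_eventually allI) (simp add: g_def)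
      qed (simp add: g_def)
      then show "AE x in lebesgue. (\<lambda>n. g n x) \<longlonglongrightarrow> 0" by simp
    qed (use gC in auto)
    then have "\<forall>\<^sub>F n in sequentially. (LINT x|lebesgue. g n x) < e / 2"
      using e by (intro order_tendstoD(2)[where y = 0]) auto
    then obtain K where K: "\<And>n. n \<ge> K \<Longrightarrow> (LINT x|lebesgue. g n x) < e / 2"
      by (auto simp: eventually_sequentially)
    have "norm ((LINT x|lebesgue. f n x) - 0) < e" if "n \<ge> K" for n
    proof -
      have le: "f n x \<le> g n x + \<delta> * b n x" for x by (simp add: g_def)
      have i: "integrable lebesgue (\<lambda>x. g n x + \<delta> * b n x)" using gi bi by simp
      have "(LINT x|lebesgue. f n x) \<le> (LINT x|lebesgue. g n x + \<delta> * b n x)"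
        by (rule integral_mono'[OF i]) (use le f0 order_trans[OF f0 le] in auto)
      also have "\<dots> = (LINT x|lebesgue. g n x) + \<delta> * (M ^ ?N * v)"
        using gi bi by (simp add: b_int)
      also have "\<dots> < e / 2 + e / 2"
      proof (rule add_less_le_mono[OF K[OF that]])
        have "\<delta> * (M ^ ?N * v) = e / 2 * (M ^ ?N * v / (M ^ ?N * v + 1))" by (simp add: \<delta>_def)
        also have "\<dots> \<le> e / 2 * 1" using Mv e by (intro mult_left_mono) auto
        finally show "\<delta> * (M ^ ?N * v) \<le> e / 2" by simp
      qed
      finally show ?thesis using integral_nonneg_AE[of "f n" lebesgue] f0 by simp
    qed
    then show "\<exists>K. \<forall>n\<ge>K. norm ((LINT x|lebesgue. f n x) - 0) < e" by blast
  qed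
qed

section \<open>The energy inequality\<close>

lemma integral_norm_power2_tendsto:
  fixes G :: "real^'n::finite \<Rightarrow> 'b::euclidean_space"
  assumes G: "square_integrable G" and Z: "\<And>n. square_integrable (Z n)"
    and lim: "(\<lambda>n. LINT x|lebesgue. (norm (Z n x - G x))\<^sup>2) \<longlonglongrightarrow> 0"
  shows "(\<lambda>n. LINT x|lebesgue. (norm (Z n x))\<^sup>2) \<longlonglongrightarrow> (LINT x|lebesgue. (norm (G x))\<^sup>2)"
proof -
  note d = square_integrable_diff[OF Z G]
  have "(norm (Z n x))\<^sup>2 = (norm (G x))\<^sup>2 + 2 * (1 * (G x \<bullet> (Z n x - G x))) + (norm (Z n x - G x))\<^sup>2" for n x
    unfolding power2_norm_eq_inner
    by (simp add: inner_diff_left inner_diff_right inner_commute)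
  then have "(LINT x|lebesgue. (norm (Z n x))\<^sup>2)
      = (LINT x|lebesgue. (norm (G x))\<^sup>2) + 2 * (LINT x|lebesgue. 1 * (G x \<bullet> (Z n x - G x)))
        + (LINT x|lebesgue. (norm (Z n x - G x))\<^sup>2)" for n
    using square_integrable_integrable[OF G] square_integrable_integrable[OF d, of n]
      square_integrable_inner[OF G d, of n] by simp
  moreover have "(\<lambda>n. LINT x|lebesgue. 1 * (G x \<bullet> (Z n x - G x))) \<longlonglongrightarrow> 0"
    by (rule integral_inner_tendsto_0[OF G d lim, where K = 1]) auto
  then have "(\<lambda>n. (LINT x|lebesgue. (norm (G x))\<^sup>2) + 2 * (LINT x|lebesgue. 1 * (G x \<bullet> (Z n x - G x)))
        + (LINT x|lebesgue. (norm (Z n x - G x))\<^sup>2)) \<longlonglongrightarrow> (LINT x|lebesgue. (norm (G x))\<^sup>2) + 2 * 0 + 0"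
    by (intro tendsto_add tendsto_mult tendsto_const lim)
  ultimately show ?thesis by simp
qed

text \<open>
  The successive derivatives of \<open>k sin(t/k)\<close> with \<open>k = n + 1\<close>, a bounded function that is dominated
  by \<open>|t|\<close> and tends to \<open>t\<close>.
\<close>

definition sine_truncation :: "nat \<Rightarrow> nat \<Rightarrow> real \<Rightarrow> real" where
  "sine_truncation n j t = real (Suc n) * (1 / real (Suc n)) ^ j * sin (t / real (Suc n) + of_nat j * (pi / 2))"

lemma sine_truncation_derivs: "truncation_derivs (real (Suc n)) (sine_truncation n)"
  using truncation_derivs_sin[of "real (Suc n)"] by (simp add: sine_truncation_def[abs_def])

lemma sine_truncation_0: "sine_truncation n 0 t = real (Suc n) * sin (t / real (Suc n))"
  by (simp add: sine_truncation_def)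

lemma sine_truncation_1: "sine_truncation n 1 t = cos (t / real (Suc n))"
  by (simp add: sine_truncation_def sin_add)

lemma sine_truncation_le: "\<bar>sine_truncation n 0 t\<bar> \<le> \<bar>t\<bar>"
proof -
  have "\<bar>sine_truncation n 0 t\<bar> = real (Suc n) * \<bar>sin (t / real (Suc n))\<bar>"
    unfolding sine_truncation_0 abs_mult by (simp only: abs_of_nat)
  also have "\<dots> \<le> real (Suc n) * \<bar>t / real (Suc n)\<bar>"
    by (intro mult_left_mono abs_sin_x_le_abs_x) simp
  also have "\<dots> = \<bar>t\<bar>" by (simp add: abs_divide del: of_nat_Suc)
  finally show ?thesis .
qed

lemma sine_truncation_tendsto: "(\<lambda>n. sine_truncation n 0 t) \<longlonglongrightarrow> t"
proof -
  have "((\<lambda>s. sin (t * s)) has_real_derivative t) (at 0)"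
    by (auto intro!: derivative_eq_intros)
  then have "((\<lambda>s. sin (t * s) / s) \<longlongrightarrow> t) (at 0)"
    by (simp add: has_field_derivative_iff)
  moreover have "filterlim (\<lambda>n. 1 / real (Suc n)) (at 0) sequentially"
    unfolding filterlim_at using inverse_Suc_tendsto_0 by auto
  ultimately have "(\<lambda>n. sin (t * (1 / real (Suc n))) / (1 / real (Suc n))) \<longlonglongrightarrow> t"
    by (rule filterlim_compose)
  then show ?thesis by (simp add: sine_truncation_0 mult.commute)
qed

lemma sine_truncation_deriv_tendsto: "(\<lambda>n. sine_truncation n 1 t) \<longlonglongrightarrow> 1"
proof -
  have "(\<lambda>n. cos (t * (1 / real (Suc n)))) \<longlonglongrightarrow> cos (t * 0)"
    by (intro tendsto_intros inverse_Suc_tendsto_0)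
  then show ?thesis unfolding sine_truncation_1 by simp
qed

lemma cutoff_grad_tendsto_0: "(\<lambda>n. classical_grad (cutoff n) (x :: real^'n::finite)) \<longlonglongrightarrow> 0"
proof -
  obtain M where M: "M > 0" "\<And>n (x :: real^'n). norm (classical_grad (cutoff n) x) \<le> M / real (Suc n)"
    "\<And>n (x :: real^'n). norm x > real (Suc n) \<Longrightarrow> classical_grad (cutoff n) x = 0"
    by (rule cutoff_grad_bound) blast
  have le: "\<forall>n. norm (classical_grad (cutoff n) x) \<le> M / real (Suc n)"
    using M(2) by blast
  have "(\<lambda>n. M / real (Suc n)) \<longlonglongrightarrow> 0"
    using tendsto_mult[OF tendsto_const inverse_Suc_tendsto_0, of M] by simp
  then show ?thesis
    by (rule Lim_null_comparison[OF always_eventually[OF le]])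
qed

text \<open>
  In Picone's identity the term with \<open>h\<close> has a sign: where \<open>h > 0\<close>, also \<open>w = 0\<close> and so
  \<open>T(w) = k sin(w/k) = 0\<close>. Hence the defect is at most \<open>\<integral>|Z|\<^sup>2 - l \<integral>V u (\<eta> T(w))\<^sup>2/(u + \<epsilon>)\<close>, which
  converges to the energy of \<open>w\<close> minus \<open>l \<integral>V w\<^sup>2\<close>. The defect is nonnegative, so this limit is, and if
  the limit is \<open>0\<close>, then the defect tends to \<open>0\<close> and \<open>Z - c \<nabla>u\<close> to \<open>0\<close> almost everywhere along a
  subsequence, while its pointwise limit is \<open>\<nabla>w - (w/u)\<nabla>u\<close>.
\<close>

lemma (in positive_solution)
  assumes w: "w \<in> D12" "w \<in> weighted_Lq 2 (\<lambda>x. \<bar>V x\<bar>)"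
    and wh: "AE x in lebesgue. h x > 0 \<longrightarrow> w x = 0"
  shows energy_ge: "l * (LINT x|lebesgue. V x * (w x)\<^sup>2) \<le> dirichlet_energy w"
    and energy_eq_imp_grad: "l * (LINT x|lebesgue. V x * (w x)\<^sup>2) = dirichlet_energy w \<Longrightarrow>
      AE x in lebesgue. weak_grad w x = (w x / u x) *\<^sub>R Gu x"
proof -
  let ?Gw = "weak_grad w"
  note fw = D12_finite_energy[OF dim w(1)]
  have Gw: "square_integrable ?Gw" using fw by (simp add: finite_energy_def)
  note [measurable] = finite_energy_measurable[OF fw] Cc_infty_borel[OF cutoff_Cc] square_integrable_measurable[OF Gw]
  have [measurable]: "sine_truncation n j \<in> borel_measurable borel" for n j
    by (rule borel_measurable_continuous_onI[OF truncation_derivs_continuous[OF sine_truncation_derivs]])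
  let ?T = sine_truncation and ?e = "\<lambda>n. 1 / real (Suc n)"
  have e: "?e n > 0" for n by simp
  define Z where "Z n x = ?T n 0 (w x) *\<^sub>R classical_grad (cutoff n) x + (cutoff n x * ?T n 1 (w x)) *\<^sub>R ?Gw x" for n x
  define c where "c n x = cutoff n x * ?T n 0 (w x) / (u x + ?e n)" for n x
  define \<zeta> where "\<zeta> n x = (cutoff n x * ?T n 0 (w x))\<^sup>2 / (u x + ?e n)" for n x
  note P = finite_energy_u u_nonneg fw cutoff_Cc sine_truncation_derivs e locally_integrable_rhs weak_equation
  have picone: "(LINT x|lebesgue. (norm (Z n x))\<^sup>2) - (LINT x|lebesgue. (norm (Z n x - c n x *\<^sub>R Gu x))\<^sup>2)
       = (LINT x|lebesgue. rhs x * \<zeta> n x)" for n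
    unfolding Z_def c_def \<zeta>_def
    by (rule picone_identity[OF P])
  have sZ: "square_integrable (Z n)" for n
    unfolding Z_def[abs_def]
    by (rule picone_square_integrable[OF P])
  have sD: "square_integrable (\<lambda>x. Z n x - c n x *\<^sub>R Gu x)" for n
    unfolding Z_def[abs_def] c_def[abs_def]
    by (rule picone_defect_square_integrable[OF P])

  have sine_le: "(?T n 0 t)\<^sup>2 \<le> t\<^sup>2" for n t
    using power_mono[OF sine_truncation_le[of n t], of 2] by simp
  have "(\<lambda>n. LINT x|lebesgue. (norm (Z n x - ?Gw x))\<^sup>2) \<longlonglongrightarrow> 0"
  proof -
    \<comment> \<open>\<open>a\<close> bounds the part of \<open>Z - \<nabla>w\<close> with \<open>\<nabla>\<eta>\<close>, and \<open>b\<close> is the part with \<open>(\<eta> T'(w) - 1)\<nabla>w\<close>\<close>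
    define a where "a n x = (w x)\<^sup>2 * (norm (classical_grad (cutoff n) x))\<^sup>2" for n x
    define b where "b n x = (cutoff n x * ?T n 1 (w x) - 1)\<^sup>2 * (norm (?Gw x))\<^sup>2" for n x
    have wS: "integrable lebesgue (\<lambda>x. \<bar>w x\<bar> powr sobolev_exponent TYPE('n))"
      using w(1) by (simp add: D12_def weighted_Lq_def)
    have la: "(\<lambda>n. LINT x|lebesgue. a n x) \<longlonglongrightarrow> 0"
      unfolding a_def by (rule cutoff_grad_tendsto[OF dim _ wS]) measurable
    have ia: "integrable lebesgue (a n)" for n
    proof -
      obtain M where M: "M > 0" "\<And>n (x :: real^'n). norm (classical_grad (cutoff n) x) \<le> M / real (Suc n)"
        "\<And>n (x :: real^'n). norm x > real (Suc n) \<Longrightarrow> classical_grad (cutoff n) x = 0"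
        by (rule cutoff_grad_bound) blast
      have i: "square_integrable (\<lambda>x. indicator (cball 0 (real (Suc n))) x * w x)"
        using fw by (auto simp: finite_energy_def)
      have "square_integrable (\<lambda>x. norm (classical_grad (cutoff n) x) *\<^sub>R (indicator (cball 0 (real (Suc n))) x * w x))"
      proof (rule square_integrable_bounded_scaleR[OF i])
        show "(\<lambda>x::real^'n. norm (classical_grad (cutoff n) x)) \<in> borel_measurable lebesgue"
          using continuous_lebesgue_measurable(1)[OF smooth_continuous_grad[OF Cc_infty_smooth[OF cutoff_Cc]]]
          by measurable
        show "AE x::real^'n in lebesgue. \<bar>norm (classical_grad (cutoff n) x)\<bar> \<le> M / real (Suc n)"
          using M(2) by simp
      qed
      from square_integrable_integrable[OF this]
      have "integrable lebesgue (\<lambda>x. (norm (norm (classical_grad (cutoff n) x) *\<^sub>R (indicat_real (cball 0 (real (Suc n))) x * w x)))\<^sup>2)" .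
      moreover have "(norm (norm (classical_grad (cutoff n) x) *\<^sub>R (indicat_real (cball 0 (real (Suc n))) x * w x)))\<^sup>2 = a n x" for x
      proof (cases "x \<in> cball 0 (real (Suc n))")
        case False
        then show ?thesis using M(3)[of n x] by (simp add: a_def)
      qed (simp add: a_def power_mult_distrib)
      ultimately show ?thesis by simp
    qed
    have b4: "(cutoff n x * ?T n 1 (w x) - 1)\<^sup>2 \<le> 4" for n x
    proof -
      have "\<bar>cutoff n x * ?T n 1 (w x)\<bar> \<le> 1 * 1"
        unfolding abs_mult sine_truncation_1
        using cutoff_nonneg[of n x] cutoff_le_1[of n x] by (intro mult_mono) auto
      then have "\<bar>cutoff n x * ?T n 1 (w x) - 1\<bar> \<le> 2" by linarith
      from power_mono[OF this, of 2] show ?thesis by simp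
    qed
    have b_le: "norm (b n x) \<le> 4 * (norm (?Gw x))\<^sup>2" for n x
      unfolding b_def using b4[of n x] by (simp add: mult_right_mono)
    have i4: "integrable lebesgue (\<lambda>x. 4 * (norm (?Gw x))\<^sup>2)"
      using square_integrable_integrable[OF Gw] by simp
    have [measurable]: "b n \<in> borel_measurable lebesgue" for n unfolding b_def by measurable
    have ib: "integrable lebesgue (b n)" for n
      by (rule Bochner_Integration.integrable_bound[OF i4]) (use b_le in auto)
    have lb: "(\<lambda>n. LINT x|lebesgue. b n x) \<longlonglongrightarrow> (LINT x|(lebesgue::(real^'n) measure). 0)"
    proof (rule integral_dominated_convergence[OF _ _ i4])
      have "(\<lambda>n. b n x) \<longlonglongrightarrow> (1 * 1 - 1)\<^sup>2 * (norm (?Gw x))\<^sup>2" for x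
        unfolding b_def by (intro tendsto_intros cutoff_tendsto sine_truncation_deriv_tendsto)
      then show "AE x in lebesgue. (\<lambda>n. b n x) \<longlonglongrightarrow> 0" by simp
    qed (use b_le in auto)
    show ?thesis
    proof (rule tendsto_sandwich[OF _ _ tendsto_const])
      show "(\<lambda>n. 2 * (LINT x|lebesgue. a n x) + 2 * (LINT x|lebesgue. b n x)) \<longlonglongrightarrow> 0"
        using tendsto_add[OF tendsto_mult[OF tendsto_const la] tendsto_mult[OF tendsto_const lb], of 2 2] by simp
      have le: "(norm (Z n x - ?Gw x))\<^sup>2 \<le> 2 * a n x + 2 * b n x" for n x
      proof -
        have "Z n x - ?Gw x = ?T n 0 (w x) *\<^sub>R classical_grad (cutoff n) x + (cutoff n x * ?T n 1 (w x) - 1) *\<^sub>R ?Gw x"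
          by (simp add: Z_def algebra_simps)
        then have "(norm (Z n x - ?Gw x))\<^sup>2 \<le> 2 * (norm (?T n 0 (w x) *\<^sub>R classical_grad (cutoff n) x))\<^sup>2
            + 2 * (norm ((cutoff n x * ?T n 1 (w x) - 1) *\<^sub>R ?Gw x))\<^sup>2"
          by (metis norm_add_power2_le)
        also have "(norm (?T n 0 (w x) *\<^sub>R classical_grad (cutoff n) x))\<^sup>2 \<le> a n x"
          unfolding a_def using sine_le[of n "w x"] by (simp add: power_mult_distrib mult_right_mono)
        also have "(norm ((cutoff n x * ?T n 1 (w x) - 1) *\<^sub>R ?Gw x))\<^sup>2 = b n x"
          by (simp add: b_def power_mult_distrib)
        finally show ?thesis by simp
      qed
      have "(LINT x|lebesgue. (norm (Z n x - ?Gw x))\<^sup>2) \<le> (LINT x|lebesgue. 2 * a n x + 2 * b n x)" for n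
        using ia ib by (intro integral_mono le square_integrable_integrable square_integrable_diff sZ Gw) auto
      then show "\<forall>\<^sub>F n in sequentially. (LINT x|lebesgue. (norm (Z n x - ?Gw x))\<^sup>2)
          \<le> 2 * (LINT x|lebesgue. a n x) + 2 * (LINT x|lebesgue. b n x)"
        using ia ib by simp
    qed (auto intro!: always_eventually integral_nonneg_AE)
  qed
  from integral_norm_power2_tendsto[OF Gw sZ this]
  have limZ: "(\<lambda>n. LINT x|lebesgue. (norm (Z n x))\<^sup>2) \<longlonglongrightarrow> dirichlet_energy w"
    by (simp add: dirichlet_energy_def)

  define J where "J n = (LINT x|lebesgue. V x * u x * \<zeta> n x)" for n
  have [measurable]: "\<zeta> n \<in> borel_measurable lebesgue" for n unfolding \<zeta>_def by measurable
  have Vw: "integrable lebesgue (\<lambda>x. \<bar>V x\<bar> * (w x)\<^sup>2)"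
    using w(2) by (simp add: weighted_Lq_def abs_powr_2)
  have limJ: "J \<longlonglongrightarrow> (LINT x|lebesgue. V x * (w x)\<^sup>2)"
    unfolding J_def
  proof (rule integral_dominated_convergence[OF _ _ Vw])
    show "AE x in lebesgue. (\<lambda>n. V x * u x * \<zeta> n x) \<longlonglongrightarrow> V x * (w x)\<^sup>2"
      using u_pos
    proof eventually_elim
      case (elim x)
      have "(\<lambda>n. V x * u x * \<zeta> n x) \<longlonglongrightarrow> V x * u x * ((1 * w x)\<^sup>2 / (u x + 0))"
        unfolding \<zeta>_def using elim
        by (intro tendsto_intros cutoff_tendsto sine_truncation_tendsto inverse_Suc_tendsto_0) auto
      then show ?case using elim by simp
    qed
    show "AE x in lebesgue. norm (V x * u x * \<zeta> n x) \<le> \<bar>V x\<bar> * (w x)\<^sup>2" for n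
      using u_pos
    proof eventually_elim
      case (elim x)
      have "u x * \<zeta> n x = (cutoff n x)\<^sup>2 * ((?T n 0 (w x))\<^sup>2 * (u x / (u x + ?e n)))"
        by (simp add: \<zeta>_def power_mult_distrib)
      also have "\<dots> \<le> 1 * ((w x)\<^sup>2 * 1)"
      proof (intro mult_mono sine_le)
        show "(cutoff n x)\<^sup>2 \<le> 1"
          using power_mono[OF cutoff_le_1 cutoff_nonneg, of n x 2] by simp
        have "u x + ?e n > 0" using elim e[of n] by (rule add_pos_pos)
        then show "u x / (u x + ?e n) \<le> 1" using e[of n] by (simp only: divide_le_eq_1_pos)
      qed (use elim in auto)
      finally have "u x * \<zeta> n x \<le> (w x)\<^sup>2" by simp
      moreover have "u x * \<zeta> n x \<ge> 0" using elim by (simp add: \<zeta>_def)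
      ultimately have "\<bar>V x\<bar> * \<bar>u x * \<zeta> n x\<bar> \<le> \<bar>V x\<bar> * (w x)\<^sup>2" by (intro mult_left_mono) auto
      then show ?case by (simp add: abs_mult mult.assoc)
    qed
  qed measurable
  have qJ: "(LINT x|lebesgue. rhs x * \<zeta> n x) \<ge> l * J n" for n
  proof -
    have bd: "integrable lebesgue (\<lambda>x. f x * \<zeta> n x)" if f: "locally_integrable f" for f
    proof -
      have "(\<lambda>x::real^'n. cutoff n x * cutoff n x) \<in> Cc_infty"
        by (rule Cc_infty_mult[OF cutoff_Cc Cc_infty_smooth[OF cutoff_Cc]])
      note i = locally_integrable_Cc_mult[OF f this]
      have "integrable lebesgue (\<lambda>x. ((?T n 0 (w x))\<^sup>2 / (u x + ?e n)) * (cutoff n x * cutoff n x * f x))"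
      proof (rule integrable_bounded_mult[OF i])
        show "AE x in lebesgue. \<bar>(?T n 0 (w x))\<^sup>2 / (u x + ?e n)\<bar> \<le> (real (Suc n))\<^sup>2 / ?e n"
          using u_nonneg
        proof eventually_elim
          case (elim x)
          have "\<bar>?T n 0 (w x)\<bar> \<le> real (Suc n)"
            using sine_truncation_derivs[of n] by (simp only: truncation_derivs_def)
          from power_mono[OF this, of 2] have "(?T n 0 (w x))\<^sup>2 \<le> (real (Suc n))\<^sup>2" by simp
          then have "(?T n 0 (w x))\<^sup>2 / (u x + ?e n) \<le> (real (Suc n))\<^sup>2 / ?e n"
            using elim e[of n] by (intro frac_le) auto
          then show ?case using elim e[of n] by (simp only: abs_of_nonneg divide_nonneg_nonneg zero_le_power2 add_nonneg_nonneg less_imp_le)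
        qed
      qed measurable
      then show ?thesis by (simp add: \<zeta>_def power2_eq_square mult_ac)
    qed
    have "(LINT x|lebesgue. rhs x * \<zeta> n x) = (LINT x|lebesgue. l * (V x * u x * \<zeta> n x) - (h x * u x powr (p - 1)) * \<zeta> n x)"
      by (simp add: left_diff_distrib mult.assoc)
    also have "\<dots> = l * J n - (LINT x|lebesgue. (h x * u x powr (p - 1)) * \<zeta> n x)"
      unfolding J_def using bd[OF locally_integrable_Vu] bd[OF locally_integrable_hu] by simp
    finally have split: "(LINT x|lebesgue. rhs x * \<zeta> n x)
        = l * J n - (LINT x|lebesgue. (h x * u x powr (p - 1)) * \<zeta> n x)" .
    have "(LINT x|lebesgue. (h x * u x powr (p - 1)) * \<zeta> n x) \<le> 0"
    proof -
      have "(LINT x|lebesgue. - ((h x * u x powr (p - 1)) * \<zeta> n x)) \<ge> 0"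
      proof (rule integral_nonneg_AE)
        show "AE x in lebesgue. 0 \<le> - ((h x * u x powr (p - 1)) * \<zeta> n x)"
          using u_nonneg wh
        proof eventually_elim
          case (elim x)
          have z: "\<zeta> n x \<ge> 0" using elim(1) by (simp add: \<zeta>_def)
          show ?case
          proof (cases "h x > 0")
            case True
            then have "\<zeta> n x = 0" using elim(2) by (simp add: \<zeta>_def sine_truncation_0)
            then show ?thesis by simp
          next
            case False
            then have "h x * (u x powr (p - 1) * \<zeta> n x) \<le> 0"
              using z by (intro mult_nonpos_nonneg mult_nonneg_nonneg) auto
            then show ?thesis by (simp add: mult.assoc)
          qed
        qed
      qed
      then show ?thesis by simp
    qed
    then show ?thesis unfolding split by simp
  qed
  define D where "D n = (LINT x|lebesgue. (norm (Z n x - c n x *\<^sub>R Gu x))\<^sup>2)" for n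
  have D0: "D n \<ge> 0" for n unfolding D_def by (intro integral_nonneg_AE) simp
  have D: "D n \<le> (LINT x|lebesgue. (norm (Z n x))\<^sup>2) - l * J n" for n
    using picone[of n] qJ[of n] unfolding D_def by linarith
  have lim: "(\<lambda>n. (LINT x|lebesgue. (norm (Z n x))\<^sup>2) - l * J n)
      \<longlonglongrightarrow> dirichlet_energy w - l * (LINT x|lebesgue. V x * (w x)\<^sup>2)"
    by (intro tendsto_intros limZ limJ)
  have "0 \<le> dirichlet_energy w - l * (LINT x|lebesgue. V x * (w x)\<^sup>2)"
    by (rule LIMSEQ_le_const[OF lim]) (use order_trans[OF D0 D] in blast)
  then show "l * (LINT x|lebesgue. V x * (w x)\<^sup>2) \<le> dirichlet_energy w" by simp
  show "AE x in lebesgue. ?Gw x = (w x / u x) *\<^sub>R Gu x"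
    if "l * (LINT x|lebesgue. V x * (w x)\<^sup>2) = dirichlet_energy w"
  proof -
    have "D \<longlonglongrightarrow> 0"
      by (rule tendsto_sandwich[OF _ _ tendsto_const]) (use D0 D lim that in auto)
    then have "(\<lambda>n. LINT x|lebesgue. norm ((norm (Z n x - c n x *\<^sub>R Gu x))\<^sup>2)) \<longlonglongrightarrow> 0"
      by (simp add: D_def[abs_def])
    from tendsto_L1_AE_subseq[OF square_integrable_integrable[OF sD] this]
    obtain r where r: "strict_mono r"
      "AE x in lebesgue. (\<lambda>n. (norm (Z (r n) x - c (r n) x *\<^sub>R Gu x))\<^sup>2) \<longlonglongrightarrow> 0" by blast
    show ?thesis
      using r(2) u_pos
    proof eventually_elim
      case (elim x)
      have "(\<lambda>n. Z n x - c n x *\<^sub>R Gu x)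
          \<longlonglongrightarrow> (w x *\<^sub>R 0 + (1 * 1) *\<^sub>R ?Gw x) - (1 * w x / (u x + 0)) *\<^sub>R Gu x"
        unfolding Z_def c_def using elim(2)
        by (intro tendsto_intros cutoff_tendsto sine_truncation_tendsto sine_truncation_deriv_tendsto
            inverse_Suc_tendsto_0 cutoff_grad_tendsto_0) auto
      then have "(\<lambda>n. (norm (Z n x - c n x *\<^sub>R Gu x))\<^sup>2) \<longlonglongrightarrow> (norm (?Gw x - (w x / u x) *\<^sub>R Gu x))\<^sup>2"
        by (intro tendsto_power tendsto_norm) simp
      from LIMSEQ_subseq_LIMSEQ[OF this r(1)] elim(1)
      have "(norm (?Gw x - (w x / u x) *\<^sub>R Gu x))\<^sup>2 = 0"
        by (intro LIMSEQ_unique[of "\<lambda>n. (norm (Z (r n) x - c (r n) x *\<^sub>R Gu x))\<^sup>2"]) (simp_all add: o_def)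
      then show ?case by simp
    qed
  qed
qed

section \<open>The equality case\<close>

lemma square_integrable_Fatou:
  fixes f :: "real^'n::finite \<Rightarrow> 'b::euclidean_space"
  assumes f: "f \<in> borel_measurable lebesgue" and fn: "\<And>n. square_integrable (fn n)"
    and lim: "AE x in lebesgue. (\<lambda>n. fn n x) \<longlonglongrightarrow> f x"
    and C: "\<And>n. (LINT x|lebesgue. (norm (fn n x))\<^sup>2) \<le> C"
  shows "square_integrable f"
  unfolding square_integrable_def
proof (intro conjI f integrableI_nonneg)
  note [measurable] = f square_integrable_measurable[OF fn]
  show "(\<lambda>x. (norm (f x))\<^sup>2) \<in> borel_measurable lebesgue" by measurable
  have "(\<integral>\<^sup>+ x. ennreal ((norm (f x))\<^sup>2) \<partial>lebesgue) = (\<integral>\<^sup>+ x. liminf (\<lambda>n. ennreal ((norm (fn n x))\<^sup>2)) \<partial>lebesgue)"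
  proof (rule nn_integral_cong_AE)
    show "AE x in lebesgue. ennreal ((norm (f x))\<^sup>2) = liminf (\<lambda>n. ennreal ((norm (fn n x))\<^sup>2))"
      using lim
    proof eventually_elim
      case (elim x)
      then have "(\<lambda>n. ennreal ((norm (fn n x))\<^sup>2)) \<longlonglongrightarrow> ennreal ((norm (f x))\<^sup>2)"
        by (intro tendsto_ennrealI tendsto_power tendsto_norm)
      from lim_imp_Liminf[OF sequentially_bot this] show ?case by (rule sym)
    qed
  qed
  also have "\<dots> \<le> liminf (\<lambda>n. \<integral>\<^sup>+ x. ennreal ((norm (fn n x))\<^sup>2) \<partial>lebesgue)"
    by (rule nn_integral_liminf) measurable
  also have "\<dots> \<le> liminf (\<lambda>n. ennreal C)"
  proof (rule Liminf_mono, rule always_eventually, rule allI)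
    show "(\<integral>\<^sup>+ x. ennreal ((norm (fn n x))\<^sup>2) \<partial>lebesgue) \<le> ennreal C" for n
      using nn_integral_eq_integral[OF square_integrable_integrable[OF fn[of n]]] C[of n]
      by (simp add: ennreal_leI)
  qed
  also have "\<dots> = ennreal C" by (simp add: Liminf_const)
  also have "\<dots> < \<infinity>" by simp
  finally show "(\<integral>\<^sup>+ x. ennreal ((norm (f x))\<^sup>2) \<partial>lebesgue) < \<infinity>" .
qed simp

text \<open>
  Picone's identity with \<open>T = 1\<close>, that is, the test function \<open>\<eta>\<^sup>2/(u + \<epsilon>)\<close>, bounds
  \<open>\<integral>|\<nabla>\<eta> - \<eta> \<nabla>u/(u + \<epsilon>)|\<^sup>2\<close> by \<open>\<integral>|\<nabla>\<eta>|\<^sup>2\<close> minus a term that is bounded below uniformly in \<open>\<epsilon>\<close>: the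
  quotients \<open>u/(u + \<epsilon>)\<close> and \<open>u\<^sup>p\<^sup>-\<^sup>1/(u + \<epsilon>)\<close> are at most \<open>1\<close> and \<open>u\<^sup>p\<^sup>-\<^sup>2\<close>, and \<open>p > 2\<close>. Fatou's lemma
  removes \<open>\<epsilon>\<close>.
\<close>

lemma (in positive_solution) log_gradient_square_integrable:
  assumes \<eta>: "\<eta> \<in> Cc_infty"
  shows "square_integrable (\<lambda>x. (\<eta> x / u x) *\<^sub>R Gu x)"
proof -
  let ?e = "\<lambda>n. 1 / real (Suc n)"
  note [measurable] = Cc_infty_borel[OF \<eta>]
  note g\<eta> = grad_Cc_square_integrable[OF \<eta>]
  define c where "c n x = \<eta> x / (u x + ?e n)" for n x
  have e: "?e n > 0" for n by simp
  note P = finite_energy_u u_nonneg finite_energy_u \<eta> truncation_derivs_const e locally_integrable_rhs weak_equation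
  have picone: "(LINT x|lebesgue. (norm (classical_grad \<eta> x))\<^sup>2)
      - (LINT x|lebesgue. (norm (classical_grad \<eta> x - c n x *\<^sub>R Gu x))\<^sup>2)
      = (LINT x|lebesgue. rhs x * ((\<eta> x)\<^sup>2 / (u x + ?e n)))" for n
    using picone_identity[OF P, of n] by (simp add: c_def)
  have sD: "square_integrable (\<lambda>x. classical_grad \<eta> x - c n x *\<^sub>R Gu x)" for n
    using picone_defect_square_integrable[OF P, of n] by (simp add: c_def)
  have \<eta>2: "(\<lambda>x. \<eta> x * \<eta> x) \<in> Cc_infty" by (rule Cc_infty_mult[OF \<eta> Cc_infty_smooth[OF \<eta>]])
  obtain B where B: "B > 0" "\<And>x. \<bar>\<eta> x\<bar> \<le> B" using Cc_infty_bounded[OF \<eta>] by metis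
  \<comment> \<open>\<open>m\<close> dominates \<open>|rhs| \<eta>\<^sup>2/(u + \<epsilon>)\<close> for every \<open>\<epsilon>\<close>\<close>
  define m where "m x = (\<eta> x)\<^sup>2 * (\<bar>l\<bar> * \<bar>V x\<bar> + \<bar>h x\<bar> + \<bar>h x\<bar> * \<bar>u x\<bar> powr p)" for x
  have im: "integrable lebesgue m"
  proof -
    have "integrable lebesgue (\<lambda>x. \<eta> x * \<eta> x * \<bar>V x\<bar>)" "integrable lebesgue (\<lambda>x. \<eta> x * \<eta> x * \<bar>h x\<bar>)"
      by (intro locally_integrable_Cc_mult[OF _ \<eta>2] locally_integrable_continuous continuous_on_rabs V h)+
    moreover have "integrable lebesgue (\<lambda>x. (\<eta> x * \<eta> x) * (\<bar>h x\<bar> * \<bar>u x\<bar> powr p))"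
    proof (rule integrable_bounded_mult[OF u_integrable_h])
      show "AE x in lebesgue. \<bar>\<eta> x * \<eta> x\<bar> \<le> B * B"
        unfolding abs_mult using B by (intro AE_I2 mult_mono) auto
    qed measurable
    ultimately have "integrable lebesgue (\<lambda>x. \<bar>l\<bar> * (\<eta> x * \<eta> x * \<bar>V x\<bar>) + \<eta> x * \<eta> x * \<bar>h x\<bar>
        + (\<eta> x * \<eta> x) * (\<bar>h x\<bar> * \<bar>u x\<bar> powr p))" by simp
    then show ?thesis by (simp add: m_def[abs_def] power2_eq_square algebra_simps)
  qed
  have qm: "(LINT x|lebesgue. rhs x * ((\<eta> x)\<^sup>2 / (u x + ?e n))) \<ge> - (LINT x|lebesgue. m x)" for n
  proof -
    have iq: "integrable lebesgue (\<lambda>x. rhs x * ((\<eta> x)\<^sup>2 / (u x + ?e n)))"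
    proof -
      have "integrable lebesgue (\<lambda>x. (1 / (u x + ?e n)) * (\<eta> x * \<eta> x * rhs x))"
      proof (rule integrable_bounded_mult[OF locally_integrable_Cc_mult[OF locally_integrable_rhs \<eta>2]])
        show "AE x in lebesgue. \<bar>1 / (u x + ?e n)\<bar> \<le> 1 / ?e n"
          using u_nonneg
        proof eventually_elim
          case (elim x)
          have "1 / (u x + ?e n) \<le> 1 / ?e n" using elim e[of n] by (intro frac_le) auto
          then show ?case using elim e[of n] by (simp only: abs_of_nonneg divide_nonneg_nonneg zero_le_one add_nonneg_nonneg less_imp_le)
        qed
      qed measurable
      then show ?thesis by (simp add: power2_eq_square mult_ac)
    qed
    have "0 \<le> (LINT x|lebesgue. rhs x * ((\<eta> x)\<^sup>2 / (u x + ?e n)) + m x)"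
    proof (rule integral_nonneg_AE)
      show "AE x in lebesgue. 0 \<le> rhs x * ((\<eta> x)\<^sup>2 / (u x + ?e n)) + m x"
        using u_pos
      proof eventually_elim
        case (elim x)
        define s where "s = u x + ?e n"
        have s: "s > 0" "u x \<le> s" using elim e[of n] unfolding s_def by linarith+
        have us: "0 \<le> u x / s" "u x / s \<le> 1" using elim s by auto
        have "\<bar>l * (V x * u x) / s\<bar> = \<bar>l\<bar> * \<bar>V x\<bar> * (u x / s)" using elim s by (simp add: abs_mult)
        also have "\<dots> \<le> \<bar>l\<bar> * \<bar>V x\<bar> * 1" by (intro mult_left_mono us) auto
        finally have 1: "\<bar>l * (V x * u x) / s\<bar> \<le> \<bar>l\<bar> * \<bar>V x\<bar>" by simp
        have "u x powr (p - 1) = u x powr (p - 2) * u x"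
          using elim powr_add[of "u x" "p - 2" 1] by simp
        then have "\<bar>h x * u x powr (p - 1) / s\<bar> = \<bar>h x\<bar> * (u x powr (p - 2) * (u x / s))"
          using elim s by (simp add: abs_mult)
        also have "\<dots> \<le> \<bar>h x\<bar> * ((1 + u x powr p) * 1)"
          using p us elim by (intro mult_left_mono mult_mono powr_diff_le) auto
        finally have 2: "\<bar>h x * u x powr (p - 1) / s\<bar> \<le> \<bar>h x\<bar> + \<bar>h x\<bar> * \<bar>u x\<bar> powr p"
          using elim by (simp add: ring_distribs)
        have "\<bar>rhs x / s\<bar> \<le> \<bar>l\<bar> * \<bar>V x\<bar> + \<bar>h x\<bar> + \<bar>h x\<bar> * \<bar>u x\<bar> powr p"
          using 1 2 unfolding diff_divide_distrib by linarith
        from mult_left_mono[OF this zero_le_power2[of "\<eta> x"]]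
        have "\<bar>(\<eta> x)\<^sup>2 * (rhs x / s)\<bar> \<le> m x" by (simp only: abs_mult abs_power2 m_def)
        moreover have "rhs x * ((\<eta> x)\<^sup>2 / s) = (\<eta> x)\<^sup>2 * (rhs x / s)" by simp
        ultimately show ?case unfolding s_def by linarith
      qed
    qed
    also have "\<dots> = (LINT x|lebesgue. rhs x * ((\<eta> x)\<^sup>2 / (u x + ?e n))) + (LINT x|lebesgue. m x)"
      by (rule Bochner_Integration.integral_add[OF iq im])
    finally show ?thesis by linarith
  qed
  define C where "C = 4 * (LINT x|lebesgue. (norm (classical_grad \<eta> x))\<^sup>2) + 2 * (LINT x|lebesgue. m x)"
  have AEc: "AE x in lebesgue. \<bar>c n x\<bar> \<le> B / ?e n" for n
    using u_nonneg
  proof eventually_elim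
    case (elim x)
    have "\<bar>c n x\<bar> = \<bar>\<eta> x\<bar> / (u x + ?e n)"
      unfolding c_def abs_divide using elim e[of n] by (simp only: abs_of_nonneg add_nonneg_nonneg less_imp_le)
    also have "\<dots> \<le> B / ?e n" using elim e[of n] B by (intro frac_le) auto
    finally show ?case .
  qed
  have sc: "square_integrable (\<lambda>x. c n x *\<^sub>R Gu x)" for n
    by (rule square_integrable_bounded_scaleR[OF square_integrable_Gu _ AEc]) (simp add: c_def[abs_def])
  show ?thesis
  proof (rule square_integrable_Fatou[OF _ sc])
    show "(\<lambda>x. (\<eta> x / u x) *\<^sub>R Gu x) \<in> borel_measurable lebesgue" by measurable
    show "AE x in lebesgue. (\<lambda>n. c n x *\<^sub>R Gu x) \<longlonglongrightarrow> (\<eta> x / u x) *\<^sub>R Gu x"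
      using u_pos
    proof eventually_elim
      case (elim x)
      have "(\<lambda>n. c n x *\<^sub>R Gu x) \<longlonglongrightarrow> (\<eta> x / (u x + 0)) *\<^sub>R Gu x"
        unfolding c_def using elim by (intro tendsto_intros inverse_Suc_tendsto_0) auto
      then show ?case by simp
    qed
    show "(LINT x|lebesgue. (norm (c n x *\<^sub>R Gu x))\<^sup>2) \<le> C" for n
    proof -
      note i = square_integrable_integrable[OF g\<eta>] square_integrable_integrable[OF sD[of n]]
      have "(LINT x|lebesgue. (norm (c n x *\<^sub>R Gu x))\<^sup>2)
          \<le> (LINT x|lebesgue. 2 * (norm (classical_grad \<eta> x))\<^sup>2 + 2 * (norm (classical_grad \<eta> x - c n x *\<^sub>R Gu x))\<^sup>2)"
      proof (rule integral_mono[OF square_integrable_integrable[OF sc]])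
        show "(norm (c n x *\<^sub>R Gu x))\<^sup>2
            \<le> 2 * (norm (classical_grad \<eta> x))\<^sup>2 + 2 * (norm (classical_grad \<eta> x - c n x *\<^sub>R Gu x))\<^sup>2" for x
          using norm_add_power2_le[of "classical_grad \<eta> x" "- (classical_grad \<eta> x - c n x *\<^sub>R Gu x)"]
          by (simp only: norm_minus_cancel) simp
      qed (use i in simp)
      also have "\<dots> = 2 * (LINT x|lebesgue. (norm (classical_grad \<eta> x))\<^sup>2)
          + 2 * (LINT x|lebesgue. (norm (classical_grad \<eta> x - c n x *\<^sub>R Gu x))\<^sup>2)"
        using i by simp
      also have "\<dots> \<le> C" using picone[of n] qm[of n] unfolding C_def by linarith
      finally show ?thesis .
    qed
  qed
qed

text \<open>
  Bounds for the partial derivatives of \<open>s\<^sup>2/(s\<^sup>2 + b\<^sup>2)\<close>, a function that is homogeneous of degree \<open>0\<close>.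
\<close>

lemma quotient_square_le:
  fixes s b :: real
  assumes s: "s > 0"
  shows "\<bar>2 * s * b\<^sup>2 / (s\<^sup>2 + b\<^sup>2)\<^sup>2\<bar> \<le> 1 / s" and "\<bar>2 * s\<^sup>2 * b / (s\<^sup>2 + b\<^sup>2)\<^sup>2\<bar> \<le> 1 / s"
proof -
  let ?d = "s\<^sup>2 + b\<^sup>2"
  have d: "?d > 0" using s by (simp add: add_pos_nonneg)
  have "s * (2 * s * b\<^sup>2) \<le> ?d\<^sup>2"
  proof -
    have "?d\<^sup>2 = s * (2 * s * b\<^sup>2) + ((s\<^sup>2)\<^sup>2 + (b\<^sup>2)\<^sup>2)" by (simp add: power2_eq_square algebra_simps)
    then show ?thesis by simp
  qed
  then have "2 * s * b\<^sup>2 / ?d\<^sup>2 \<le> 1 / s" using d s by (simp add: divide_simps mult.commute)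
  then show "\<bar>2 * s * b\<^sup>2 / ?d\<^sup>2\<bar> \<le> 1 / s" using s by simp
  have "2 * s * \<bar>b\<bar> \<le> ?d" using sum_squares_bound[of s "\<bar>b\<bar>"] by simp
  then have "s\<^sup>2 * (2 * s * \<bar>b\<bar>) \<le> ?d * ?d" using s by (intro mult_mono) auto
  then have "2 * s\<^sup>2 * \<bar>b\<bar> / ?d\<^sup>2 \<le> 1 / s" using d s
    by (simp add: divide_simps power2_eq_square mult_ac)
  then show "\<bar>2 * s\<^sup>2 * b / ?d\<^sup>2\<bar> \<le> 1 / s" using s by (simp add: abs_mult)
qed

lemma quotient_grad:
  fixes U W :: "real^'n::finite \<Rightarrow> real"
  assumes U: "smooth U" "\<And>x. U x \<ge> 0" and W: "smooth W" and e: "\<epsilon> > 0"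
  defines "s \<equiv> \<lambda>x. U x + \<epsilon>"
  defines "F \<equiv> \<lambda>x. (s x)\<^sup>2 / ((s x)\<^sup>2 + (W x)\<^sup>2)"
  shows "smooth F"
    and "partial_deriv i F x = (2 * s x * (W x)\<^sup>2 / ((s x)\<^sup>2 + (W x)\<^sup>2)\<^sup>2) * classical_grad U x $ i
      - (2 * (s x)\<^sup>2 * W x / ((s x)\<^sup>2 + (W x)\<^sup>2)\<^sup>2) * classical_grad W x $ i"
proof -
  have s: "s x > 0" for x using U(2)[of x] e unfolding s_def by linarith
  have sm: "smooth s" unfolding s_def by (intro smooth_add U smooth_const)
  have pos: "(s x)\<^sup>2 + (W x)\<^sup>2 > 0" for x using s[of x] by (simp add: add_pos_nonneg)
  have "smooth (\<lambda>x. (s x)\<^sup>2 * inverse ((s x)\<^sup>2 + (W x)\<^sup>2))"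
    by (intro smooth_mult smooth_power sm smooth_inverse smooth_add W pos)
  then show "smooth F" by (simp add: F_def divide_inverse)
  have ds: "(s has_derivative (\<lambda>h. classical_grad U x \<bullet> h)) (at x)"
    using has_derivative_add[OF smooth_has_derivative[OF U(1)] has_derivative_const[of \<epsilon>]]
    by (simp add: s_def)
  note dW = smooth_has_derivative[OF W, of x]
  have "(F has_derivative (\<lambda>h. ((2 * s x * (W x)\<^sup>2 / ((s x)\<^sup>2 + (W x)\<^sup>2)\<^sup>2) *\<^sub>R classical_grad U x
      - (2 * (s x)\<^sup>2 * W x / ((s x)\<^sup>2 + (W x)\<^sup>2)\<^sup>2) *\<^sub>R classical_grad W x) \<bullet> h)) (at x)"
    unfolding F_def power2_eq_square
  proof (rule has_derivative_eq_rhs[OF has_derivative_divide'[OF has_derivative_mult[OF ds ds]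
        has_derivative_add[OF has_derivative_mult[OF ds ds] has_derivative_mult[OF dW dW]]]])
    show "s x * s x + W x * W x \<noteq> 0" using pos[of x] unfolding power2_eq_square by linarith
    have alg: "((t * a + a * t) * (t * t + w * w) - t * t * ((t * a + a * t) + (w * b + b * w))) / d
        = 2 * t * (w * w) / d * a - 2 * (t * t) * w / d * b" for t w a b d :: real
      by (simp add: diff_divide_distrib add_divide_distrib algebra_simps)
    show "(\<lambda>h. ((s x * (classical_grad U x \<bullet> h) + (classical_grad U x \<bullet> h) * s x) * (s x * s x + W x * W x)
        - s x * s x * ((s x * (classical_grad U x \<bullet> h) + (classical_grad U x \<bullet> h) * s x)
          + (W x * (classical_grad W x \<bullet> h) + (classical_grad W x \<bullet> h) * W x)))
        / ((s x * s x + W x * W x) * (s x * s x + W x * W x)))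
      = (\<lambda>h. ((2 * s x * (W x * W x) / ((s x * s x + W x * W x) * (s x * s x + W x * W x))) *\<^sub>R classical_grad U x
        - (2 * (s x * s x) * W x / ((s x * s x + W x * W x) * (s x * s x + W x * W x))) *\<^sub>R classical_grad W x) \<bullet> h)"
      unfolding inner_diff_left inner_scaleR_left alg ..
  qed
  from partial_deriv_eq[OF this] show "partial_deriv i F x = (2 * s x * (W x)\<^sup>2 / ((s x)\<^sup>2 + (W x)\<^sup>2)\<^sup>2) * classical_grad U x $ i
      - (2 * (s x)\<^sup>2 * W x / ((s x)\<^sup>2 + (W x)\<^sup>2)\<^sup>2) * classical_grad W x $ i"
    by (simp add: inner_diff_left inner_axis)
qed

text \<open>
  The chain rule for \<open>s\<^sup>2/(s\<^sup>2 + w\<^sup>2)\<close> with \<open>s = u + \<epsilon>\<close>, in the distributional sense: it holds for the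
  mollified functions by integration by parts, and since \<open>s \<ge> \<epsilon>\<close> the partial derivatives of the
  quotient stay bounded in the limit.
\<close>

lemma quotient_weak_derivative:
  fixes u w \<phi> :: "real^'n::finite \<Rightarrow> real"
  assumes u: "finite_energy u Gu" "AE x in lebesgue. 0 \<le> u x" and w: "finite_energy w Gw"
    and \<phi>: "\<phi> \<in> Cc_infty" and e: "\<epsilon> > 0"
  defines "s \<equiv> \<lambda>x. u x + \<epsilon>"
  shows "(LINT x|lebesgue. ((s x)\<^sup>2 / ((s x)\<^sup>2 + (w x)\<^sup>2)) * partial_deriv i \<phi> x)
    = - (LINT x|lebesgue. ((2 * s x * (w x)\<^sup>2 / ((s x)\<^sup>2 + (w x)\<^sup>2)\<^sup>2) * Gu x $ i
      - (2 * (s x)\<^sup>2 * w x / ((s x)\<^sup>2 + (w x)\<^sup>2)\<^sup>2) * Gw x $ i) * \<phi> x)"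
proof -
  obtain R where R: "\<And>x. norm x > R \<Longrightarrow> \<phi> x = 0"
    using Cc_infty_support[OF \<phi>] by metis
  note d\<phi> = Cc_infty_partial_deriv[OF \<phi>, of i]
  have dR: "partial_deriv i \<phi> x = 0" if "norm x > R" for x
    by (rule partial_deriv_zero_outside[OF R that])
  have Gu: "square_integrable Gu" and Gw: "square_integrable Gw"
    using u(1) w by (auto simp: finite_energy_def)
  note [measurable] = finite_energy_measurable[OF u(1)] finite_energy_measurable[OF w]
    Cc_infty_borel[OF \<phi>] Cc_infty_borel[OF d\<phi>]
  define g where "g x = \<phi> x *\<^sub>R axis i (1::real)" for x
  have g: "square_integrable g"
    by (rule continuous_compact_support_square_integrable[where R = R])
      (use R in \<open>auto simp: g_def intro!: continuous_intros Cc_infty_continuous[OF \<phi>]\<close>)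
  have gi: "g x \<bullet> v = v $ i * \<phi> x" for x and v :: "real^'n"
    by (simp add: g_def inner_axis' mult.commute)
  obtain U W where U: "\<And>n. smooth (U n)" "\<And>n x. U n x \<ge> 0" and W: "\<And>n. smooth (W n)"
    and sU: "\<And>n. square_integrable (classical_grad (U n))" and sW: "\<And>n. square_integrable (classical_grad (W n))"
    and limU: "(\<lambda>n. LINT x|lebesgue. (norm (classical_grad (U n) x - Gu x))\<^sup>2) \<longlonglongrightarrow> 0"
    and limW: "(\<lambda>n. LINT x|lebesgue. (norm (classical_grad (W n) x - Gw x))\<^sup>2) \<longlonglongrightarrow> 0"
    and lim: "AE x in lebesgue. norm x \<le> R \<longrightarrow> (\<lambda>n. U n x) \<longlonglongrightarrow> u x \<and> (\<lambda>n. W n x) \<longlonglongrightarrow> w x"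
    by (rule smooth_approximations[OF u w, where R = R]) blast
  note [measurable] = continuous_lebesgue_measurable(1)[OF smooth_imp_continuous[OF U(1)]]
    continuous_lebesgue_measurable(1)[OF smooth_imp_continuous[OF W]]
  define F where "F a b = (a + \<epsilon>)\<^sup>2 / ((a + \<epsilon>)\<^sup>2 + b\<^sup>2)" for a b
  \<comment> \<open>convergence is only known on the ball that contains the support of \<open>\<phi>\<close>, so the
      coefficients are cut off to this ball; the factor \<open>\<phi>\<close> keeps the integrals unchanged\<close>
  define A where "A x a b = indicat_real (cball 0 R) x * (2 * (a + \<epsilon>) * b\<^sup>2 / ((a + \<epsilon>)\<^sup>2 + b\<^sup>2)\<^sup>2)" for x :: "real^'n" and a b
  define B where "B x a b = indicat_real (cball 0 R) x * (2 * (a + \<epsilon>)\<^sup>2 * b / ((a + \<epsilon>)\<^sup>2 + b\<^sup>2)\<^sup>2)" for x :: "real^'n" and a b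
  have [measurable]: "indicat_real (cball (0::real^'n) R) \<in> borel_measurable lebesgue"
    by (intro borel_measurable_indicator fmeasurableD lmeasurable_cball)
  have AB: "\<bar>A x a b\<bar> \<le> 1 / \<epsilon>" "\<bar>B x a b\<bar> \<le> 1 / \<epsilon>" if "a \<ge> 0" for x a b
  proof -
    have "1 / (a + \<epsilon>) \<le> 1 / \<epsilon>" using that e by (intro frac_le) auto
    then show "\<bar>A x a b\<bar> \<le> 1 / \<epsilon>" "\<bar>B x a b\<bar> \<le> 1 / \<epsilon>"
      using quotient_square_le[of "a + \<epsilon>" b] that e
      by (auto simp: A_def B_def indicator_def)
  qed
  have F1: "\<bar>F a b\<bar> \<le> 1" for a b
  proof (cases "(a + \<epsilon>)\<^sup>2 + b\<^sup>2 > 0")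
    case True
    then show ?thesis by (simp add: F_def divide_le_eq_1)
  next
    case False
    then have "(a + \<epsilon>)\<^sup>2 + b\<^sup>2 = 0" using sum_power2_ge_zero[of "a + \<epsilon>" b] by linarith
    then show ?thesis unfolding F_def by simp
  qed
  have lims: "AE x in lebesgue. (\<lambda>n. F (U n x) (W n x) * partial_deriv i \<phi> x) \<longlonglongrightarrow> F (u x) (w x) * partial_deriv i \<phi> x \<and>
      (\<lambda>n. A x (U n x) (W n x)) \<longlonglongrightarrow> A x (u x) (w x) \<and> (\<lambda>n. B x (U n x) (W n x)) \<longlonglongrightarrow> B x (u x) (w x)"
    using lim u(2)
  proof eventually_elim
    case (elim x)
    show ?case
    proof (cases "norm x \<le> R")
      case True
      then have l: "(\<lambda>n. U n x) \<longlonglongrightarrow> u x" "(\<lambda>n. W n x) \<longlonglongrightarrow> w x"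
        using elim(1) by auto
      have "u x + \<epsilon> > 0" using elim(2) e by linarith
      then have "(u x + \<epsilon>)\<^sup>2 + (w x)\<^sup>2 > 0" by (simp add: add_pos_nonneg)
      then have nz: "(u x + \<epsilon>)\<^sup>2 + (w x)\<^sup>2 \<noteq> 0" by linarith
      note nz = nz power_not_zero[OF nz, of 2]
      show ?thesis
        unfolding F_def A_def B_def by (intro conjI tendsto_intros l nz)
    qed (simp add: A_def B_def dR)
  qed
  have 1: "(\<lambda>n. LINT x|lebesgue. F (U n x) (W n x) * partial_deriv i \<phi> x)
      \<longlonglongrightarrow> (LINT x|lebesgue. F (u x) (w x) * partial_deriv i \<phi> x)"
  proof (rule integral_dominated_convergence)
    show "integrable lebesgue (\<lambda>x. \<bar>partial_deriv i \<phi> x\<bar>)"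
      using Cc_infty_integrable[OF d\<phi>] by simp
    show "AE x in lebesgue. norm (F (U n x) (W n x) * partial_deriv i \<phi> x) \<le> \<bar>partial_deriv i \<phi> x\<bar>" for n
      using F1 by (intro AE_I2) (simp add: abs_mult mult_left_le_one_le)
    show "AE x in lebesgue. (\<lambda>n. F (U n x) (W n x) * partial_deriv i \<phi> x) \<longlonglongrightarrow> F (u x) (w x) * partial_deriv i \<phi> x"
      using lims by eventually_elim blast
    show "(\<lambda>x. F (u x) (w x) * partial_deriv i \<phi> x) \<in> borel_measurable lebesgue"
      unfolding F_def by measurable
    show "(\<lambda>x. F (U n x) (W n x) * partial_deriv i \<phi> x) \<in> borel_measurable lebesgue" for n
      unfolding F_def by measurable
  qed
  have mA: "(\<lambda>x. A x (U n x) (W n x)) \<in> borel_measurable lebesgue"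
    "(\<lambda>x. B x (U n x) (W n x)) \<in> borel_measurable lebesgue" for n
    unfolding A_def B_def by measurable
  have mA': "(\<lambda>x. A x (u x) (w x)) \<in> borel_measurable lebesgue"
    "(\<lambda>x. B x (u x) (w x)) \<in> borel_measurable lebesgue"
    unfolding A_def B_def by measurable
  have 2: "(\<lambda>n. LINT x|lebesgue. A x (U n x) (W n x) * (g x \<bullet> classical_grad (U n) x))
      \<longlonglongrightarrow> (LINT x|lebesgue. A x (u x) (w x) * (g x \<bullet> Gu x))"
    by (rule integral_inner_tendsto[OF g Gu sU limU mA(1) AB(1)[OF U(2)] mA'(1)])
      (use lims in \<open>auto elim: eventually_mono\<close>)
  have 3: "(\<lambda>n. LINT x|lebesgue. B x (U n x) (W n x) * (g x \<bullet> classical_grad (W n) x))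
      \<longlonglongrightarrow> (LINT x|lebesgue. B x (u x) (w x) * (g x \<bullet> Gw x))"
    by (rule integral_inner_tendsto[OF g Gw sW limW mA(2) AB(2)[OF U(2)] mA'(2)])
      (use lims in \<open>auto elim: eventually_mono\<close>)
  have ind: "indicat_real (cball 0 R) x * \<phi> x = \<phi> x" for x
    using R[of x] by (auto simp: indicator_def)
  have pw: "(2 * (a + \<epsilon>) * b\<^sup>2 / ((a + \<epsilon>)\<^sup>2 + b\<^sup>2)\<^sup>2 * v $ i - 2 * (a + \<epsilon>)\<^sup>2 * b / ((a + \<epsilon>)\<^sup>2 + b\<^sup>2)\<^sup>2 * v' $ i) * \<phi> x
      = A x a b * (g x \<bullet> v) - B x a b * (g x \<bullet> v')" for a b x and v v' :: "real^'n"
  proof -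
    have "\<alpha> * v $ i * \<phi> x = (indicat_real (cball 0 R) x * \<alpha>) * (v $ i * \<phi> x)" for \<alpha> and v :: "real^'n"
      by (metis ind mult.assoc mult.left_commute)
    then show ?thesis unfolding A_def B_def gi left_diff_distrib by metis
  qed
  have "(LINT x|lebesgue. F (U n x) (W n x) * partial_deriv i \<phi> x)
      = - ((LINT x|lebesgue. A x (U n x) (W n x) * (g x \<bullet> classical_grad (U n) x))
        - (LINT x|lebesgue. B x (U n x) (W n x) * (g x \<bullet> classical_grad (W n) x)))" for n
  proof -
    have "integrable lebesgue (\<lambda>x. A x (U n x) (W n x) * (g x \<bullet> classical_grad (U n) x))"
      by (rule integrable_bounded_mult[OF square_integrable_inner[OF g sU] mA(1) AE_I2[OF AB(1)[OF U(2)]]])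
    moreover have "integrable lebesgue (\<lambda>x. B x (U n x) (W n x) * (g x \<bullet> classical_grad (W n) x))"
      by (rule integrable_bounded_mult[OF square_integrable_inner[OF g sW] mA(2) AE_I2[OF AB(2)[OF U(2)]]])
    ultimately show ?thesis
      using integration_by_parts[OF quotient_grad(1)[OF U(1,2) W e, of n n] \<phi>, of i]
      unfolding quotient_grad(2)[OF U(1,2) W e] pw F_def by simp
  qed
  with tendsto_minus[OF tendsto_diff[OF 2 3]] 1
  have "(LINT x|lebesgue. F (u x) (w x) * partial_deriv i \<phi> x)
      = - ((LINT x|lebesgue. A x (u x) (w x) * (g x \<bullet> Gu x)) - (LINT x|lebesgue. B x (u x) (w x) * (g x \<bullet> Gw x)))"
    by (simp add: LIMSEQ_unique)
  also have "\<dots> = - (LINT x|lebesgue. A x (u x) (w x) * (g x \<bullet> Gu x) - B x (u x) (w x) * (g x \<bullet> Gw x))"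
  proof -
    have "AE x in lebesgue. \<bar>A x (u x) (w x)\<bar> \<le> 1 / \<epsilon>" "AE x in lebesgue. \<bar>B x (u x) (w x)\<bar> \<le> 1 / \<epsilon>"
      by (rule eventually_mono[OF u(2)], erule AB)+
    from integrable_bounded_mult[OF square_integrable_inner[OF g Gu] mA'(1) this(1)]
      integrable_bounded_mult[OF square_integrable_inner[OF g Gw] mA'(2) this(2)]
    show ?thesis by simp
  qed
  finally show ?thesis unfolding s_def pw F_def .
qed

text \<open>
  Convolution with a small bump turns the weak gradient into a classical one, so the convolution is
  constant. If the support of the bump is the size of a ball inside \<open>S\<close>, then at the centre of this
  ball the convolution only sees values of \<open>f\<close> in \<open>S\<close> and is \<open>0\<close>. Hence it is \<open>0\<close> everywhere, and as
  \<open>f \<ge> 0\<close>, the function vanishes almost everywhere on every ball of that size.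
\<close>

lemma zero_weak_gradient_vanishes:
  fixes f :: "real^'n::finite \<Rightarrow> real"
  assumes f: "has_weak_gradient f (\<lambda>_. 0)" "AE x in lebesgue. 0 \<le> f x"
    and S: "open S" "S \<noteq> {}" "AE x in lebesgue. x \<in> S \<longrightarrow> f x = 0"
  shows "AE x in lebesgue. f x = 0"
proof -
  obtain x0 d where d: "d > 0" "ball x0 d \<subseteq> S"
    using S(1,2) by (meson all_not_in_conv openE)
  define r where "r x = bump ((1 / d) *\<^sub>R x)" for x :: "real^'n"
  have r: "r \<in> Cc_infty" unfolding r_def[abs_def] by (rule bump_scaled_Cc) (use d in simp)
  have r0: "r x \<ge> 0" for x by (simp add: r_def bump_nonneg)
  have rpos: "r x > 0 \<longleftrightarrow> norm x < d" for x
    unfolding r_def bump_pos_iff using d(1) by simp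
  have lf: "locally_integrable f" using f(1) by (simp add: has_weak_gradient_def)
  have "(conv r f has_derivative (\<lambda>h. 0)) (at x)" for x
  proof -
    have "classical_grad (conv r f) x = 0"
      unfolding conv_weak_gradient[OF r f(1)] by (simp add: conv_def vec_eq_iff)
    then show ?thesis using smooth_has_derivative[OF smooth_conv[OF r lf], of x] by simp
  qed
  then obtain k where k: "\<And>x. conv r f x = k"
    using has_derivative_zero_constant[of UNIV "conv r f"] by auto
  have "conv r f x0 = 0"
    unfolding conv_def
  proof (rule integral_eq_zero_AE)
    show "AE y in lebesgue. r (x0 - y) * f y = 0"
      using S(3)
    proof eventually_elim
      case (elim y)
      show ?case
      proof (cases "y \<in> S")
        case False
        then have "\<not> norm (x0 - y) < d" using d(2) by (auto simp: dist_norm)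
        then show ?thesis using rpos[of "x0 - y"] r0[of "x0 - y"] by simp
      qed (use elim in simp)
    qed
  qed
  then have k0: "conv r f x = 0" for x using k by metis
  have "negligible {y. y \<in> ball x d \<and> f y \<noteq> 0}" for x
  proof -
    have "AE y in lebesgue. r (x - y) * f y = 0"
    proof -
      have "AE y in lebesgue. 0 \<le> r (x - y) * f y"
        using f(2) by eventually_elim (simp add: r0)
      then show ?thesis
        using k0[of x] integral_nonneg_eq_0_iff_AE[OF conv_integrable[OF r lf, of x]]
        by (simp add: conv_def)
    qed
    then obtain N where N: "negligible N" "{y. \<not> (r (x - y) * f y = 0)} \<subseteq> N"
      by (auto simp: eventually_ae_filter_negligible)
    have "{y. y \<in> ball x d \<and> f y \<noteq> 0} \<subseteq> N"
      using N(2) rpos by (force simp: dist_norm)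
    then show ?thesis using N(1) negligible_subset by blast
  qed
  then have "negligible {y. f y \<noteq> 0}"
    unfolding locally_negligible_alt[of "{y. f y \<noteq> 0}"]
  proof (intro ballI)
    fix x assume "x \<in> {y. f y \<noteq> 0}"
    then show "\<exists>U. openin (top_of_set {y. f y \<noteq> 0}) U \<and> x \<in> U \<and> negligible U"
      using \<open>negligible {y. y \<in> ball x d \<and> f y \<noteq> 0}\<close> d(1)
      by (intro exI[of _ "{y. y \<in> ball x d \<and> f y \<noteq> 0}"])
        (auto simp: openin_open intro!: exI[of _ "ball x d"])
  qed
  then show ?thesis
    unfolding eventually_ae_filter_negligible by blast
qed

text \<open>
  The function is invariant under a common scaling of \<open>u\<close> and \<open>w\<close>, and \<open>\<nabla>w = (w/u)\<nabla>u\<close> says that the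
  pair \<open>(\<nabla>u, \<nabla>w)\<close> points in the direction of such a scaling. To differentiate, \<open>u\<close> is replaced by
  \<open>s = u + \<epsilon>\<close>; the invariance then fails by the term \<open>a \<nabla>u/u\<close> with
  \<open>a = 2 s w\<^sup>2 \<epsilon>/(s\<^sup>2 + w\<^sup>2)\<^sup>2\<close>. As \<open>\<epsilon> \<le> s\<close>, the factor \<open>a\<close> is at most \<open>1\<close>, and it tends to \<open>0\<close>, so
  dominated convergence applies because \<open>|\<nabla>u|/u\<close> is locally integrable.
\<close>

lemma (in positive_solution) quotient_zero_weak_gradient:
  assumes w: "w \<in> D12" and grad: "AE x in lebesgue. weak_grad w x = (w x / u x) *\<^sub>R Gu x"
  shows "has_weak_gradient (\<lambda>x. (w x)\<^sup>2 / ((u x)\<^sup>2 + (w x)\<^sup>2)) (\<lambda>_. 0)"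
proof -
  let ?Gw = "weak_grad w" and ?e = "\<lambda>n. 1 / real (Suc n)"
  have e: "?e n > 0" for n by simp
  note fw = D12_finite_energy[OF dim w]
  have Gw: "square_integrable ?Gw" using fw by (simp add: finite_energy_def)
  note [measurable] = finite_energy_measurable[OF fw]
    square_integrable_measurable[OF square_integrable_component[OF square_integrable_Gu]]
  define f where "f x = (w x)\<^sup>2 / ((u x)\<^sup>2 + (w x)\<^sup>2)" for x
  define F where "F x = (u x)\<^sup>2 / ((u x)\<^sup>2 + (w x)\<^sup>2)" for x
  have q1: "\<bar>a / (a + b)\<bar> \<le> 1" if "a \<ge> 0" "b \<ge> 0" for a b :: real
    using that by (cases "a + b = 0") (auto simp: divide_le_eq_1)
  have "locally_integrable f"
  proof (rule locally_integrable_dominated[OF _ locally_integrable_const[of 1] integrable_zero])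
    show "f \<in> borel_measurable lebesgue" unfolding f_def by measurable
    show "AE x in lebesgue. norm (f x) \<le> \<bar>1\<bar> + \<bar>0\<bar>"
    proof (rule AE_I2)
      show "norm (f x) \<le> \<bar>1\<bar> + \<bar>0\<bar>" for x
        using q1[of "(w x)\<^sup>2" "(u x)\<^sup>2"] by (simp add: f_def add.commute)
    qed
  qed
  moreover have "locally_integrable (\<lambda>_. 0 :: real^'n)"
    by (simp add: locally_integrable_def set_integrable_def)
  moreover have "(LINT x|lebesgue. f x * partial_deriv i \<phi> x) = 0" if \<phi>: "\<phi> \<in> Cc_infty" for \<phi> i
  proof -
    note d\<phi> = Cc_infty_partial_deriv[OF \<phi>, of i]
    note [measurable] = Cc_infty_borel[OF \<phi>] Cc_infty_borel[OF d\<phi>]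
    obtain R where R: "\<And>x. norm x > R \<Longrightarrow> \<phi> x = 0"
      using Cc_infty_support[OF \<phi>] by metis
    define s where "s n x = u x + ?e n" for n x
    define k where "k x = (\<phi> x / u x) * Gu x $ i" for x
    define a where "a n x = 2 * s n x * (w x)\<^sup>2 * ?e n / ((s n x)\<^sup>2 + (w x)\<^sup>2)\<^sup>2" for n x
    have ik: "integrable lebesgue (\<lambda>x. \<bar>k x\<bar>)"
    proof -
      have sk: "square_integrable k"
        using square_integrable_component[OF log_gradient_square_integrable[OF \<phi>], of i]
        by (simp add: k_def[abs_def])
      have "integrable lebesgue k"
      proof (rule Bochner_Integration.integrable_bound)
        show "integrable lebesgue (\<lambda>x. indicator (cball 0 R) x + (norm (k x))\<^sup>2)"
          by (intro Bochner_Integration.integrable_add indicator_cball_integrable square_integrable_integrable sk)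
        show "k \<in> borel_measurable lebesgue" by (rule square_integrable_measurable[OF sk])
        have "\<bar>k x\<bar> \<le> indicator (cball 0 R) x + (k x)\<^sup>2" for x
        proof (cases "norm x \<le> R")
          case True
          have "2 * \<bar>k x\<bar> \<le> 1 + (k x)\<^sup>2" using sum_squares_bound[of 1 "\<bar>k x\<bar>"] by simp
          then show ?thesis using True abs_ge_zero[of "k x"] by (simp add: indicator_def)
        qed (use R[of x] in \<open>simp add: k_def\<close>)
        then show "AE x in lebesgue. norm (k x) \<le> norm (indicator (cball 0 R) x + (norm (k x))\<^sup>2)"
          by (intro AE_I2) (simp add: indicator_def)
      qed
      then show ?thesis by (rule integrable_abs)
    qed
    have "(LINT x|lebesgue. ((s n x)\<^sup>2 / ((s n x)\<^sup>2 + (w x)\<^sup>2)) * partial_deriv i \<phi> x)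
        = (LINT x|lebesgue. a n x * k x)" for n
    proof -
      have "(LINT x|lebesgue. ((2 * s n x * (w x)\<^sup>2 / ((s n x)\<^sup>2 + (w x)\<^sup>2)\<^sup>2) * Gu x $ i
          - (2 * (s n x)\<^sup>2 * w x / ((s n x)\<^sup>2 + (w x)\<^sup>2)\<^sup>2) * ?Gw x $ i) * \<phi> x)
        = (LINT x|lebesgue. - (a n x * k x))"
      proof (rule integral_cong_AE)
        show "AE x in lebesgue. ((2 * s n x * (w x)\<^sup>2 / ((s n x)\<^sup>2 + (w x)\<^sup>2)\<^sup>2) * Gu x $ i
          - (2 * (s n x)\<^sup>2 * w x / ((s n x)\<^sup>2 + (w x)\<^sup>2)\<^sup>2) * ?Gw x $ i) * \<phi> x = - (a n x * k x)"
          using grad u_pos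
        proof eventually_elim
          case (elim x)
          have G: "?Gw x $ i = (w x / u x) * Gu x $ i" using elim(1) by simp
          define D where "D = ((s n x)\<^sup>2 + (w x)\<^sup>2)\<^sup>2"
          have alg: "((2 * t * b\<^sup>2 / D) * g - (2 * t\<^sup>2 * b / D) * ((b / c) * g)) * m
              = - ((2 * t * b\<^sup>2 * (t - c) / D) * ((m / c) * g))" if "c \<noteq> 0" for t b c g m :: real
          proof (cases "D = 0")
            case False
            with that show ?thesis by (simp add: divide_simps power2_eq_square) (simp add: algebra_simps)
          qed simp
          have "?e n = s n x - u x" by (simp add: s_def)
          then show ?case
            unfolding G a_def k_def D_def[symmetric] using elim(2) by (simp only: alg[OF less_imp_neq[symmetric]])
        qed
        show "(\<lambda>x. ((2 * s n x * (w x)\<^sup>2 / ((s n x)\<^sup>2 + (w x)\<^sup>2)\<^sup>2) * Gu x $ i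
          - (2 * (s n x)\<^sup>2 * w x / ((s n x)\<^sup>2 + (w x)\<^sup>2)\<^sup>2) * ?Gw x $ i) * \<phi> x) \<in> borel_measurable lebesgue"
          using square_integrable_measurable[OF square_integrable_component[OF Gw, of i]]
          unfolding s_def by measurable
        show "(\<lambda>x. - (a n x * k x)) \<in> borel_measurable lebesgue"
          unfolding a_def k_def s_def by measurable
      qed
      then show ?thesis
        using quotient_weak_derivative[OF finite_energy_u u_nonneg fw \<phi> e[of n], of i] unfolding s_def by simp
    qed
    moreover have "(\<lambda>n. LINT x|lebesgue. a n x * k x) \<longlonglongrightarrow> (LINT x|(lebesgue :: (real^'n) measure). 0)"
    proof (rule integral_dominated_convergence[OF _ _ ik])
      show "(\<lambda>x. a n x * k x) \<in> borel_measurable lebesgue" for n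
        unfolding a_def k_def s_def by measurable
      show "AE x in lebesgue. norm (a n x * k x) \<le> \<bar>k x\<bar>" for n
        using u_pos
      proof eventually_elim
        case (elim x)
        have s: "s n x > 0" "?e n \<le> s n x" using elim e[of n] unfolding s_def by linarith+
        have "2 * s n x * (w x)\<^sup>2 * ?e n \<le> 2 * s n x * (w x)\<^sup>2 * s n x"
          using s by (intro mult_left_mono) auto
        also have "\<dots> \<le> ((s n x)\<^sup>2 + (w x)\<^sup>2)\<^sup>2"
        proof -
          have "((s n x)\<^sup>2 + (w x)\<^sup>2)\<^sup>2 = 2 * s n x * (w x)\<^sup>2 * s n x + (((s n x)\<^sup>2)\<^sup>2 + ((w x)\<^sup>2)\<^sup>2)"
            by (simp add: power2_eq_square algebra_simps)
          then show ?thesis by simp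
        qed
        finally have le: "2 * s n x * (w x)\<^sup>2 * ?e n \<le> ((s n x)\<^sup>2 + (w x)\<^sup>2)\<^sup>2" .
        have "(s n x)\<^sup>2 + (w x)\<^sup>2 > 0" using s(1) by (simp add: add_pos_nonneg)
        then have "((s n x)\<^sup>2 + (w x)\<^sup>2)\<^sup>2 > 0" by (rule zero_less_power)
        then have "a n x \<le> 1" unfolding a_def using le by (simp only: divide_le_eq_1_pos)
        moreover have "a n x \<ge> 0" unfolding a_def using s(1) e[of n]
          by (intro divide_nonneg_nonneg mult_nonneg_nonneg) auto
        ultimately show ?case by (simp add: abs_mult mult_left_le_one_le)
      qed
      show "AE x in lebesgue. (\<lambda>n. a n x * k x) \<longlonglongrightarrow> 0"
        using u_pos
      proof eventually_elim
        case (elim x)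
        have "(u x + 0)\<^sup>2 + (w x)\<^sup>2 > 0" using elim by (simp add: add_pos_nonneg)
        then have nz: "((u x + 0)\<^sup>2 + (w x)\<^sup>2)\<^sup>2 \<noteq> 0" using power_not_zero by (metis less_irrefl)
        have "(\<lambda>n. a n x * k x) \<longlonglongrightarrow> (2 * (u x + 0) * (w x)\<^sup>2 * 0 / ((u x + 0)\<^sup>2 + (w x)\<^sup>2)\<^sup>2) * k x"
          unfolding a_def s_def by (intro tendsto_intros inverse_Suc_tendsto_0 nz)
        then show ?case by simp
      qed
    qed simp
    moreover have "(\<lambda>n. LINT x|lebesgue. ((s n x)\<^sup>2 / ((s n x)\<^sup>2 + (w x)\<^sup>2)) * partial_deriv i \<phi> x)
        \<longlonglongrightarrow> (LINT x|lebesgue. F x * partial_deriv i \<phi> x)"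
    proof (rule integral_dominated_convergence)
      show "integrable lebesgue (\<lambda>x. \<bar>partial_deriv i \<phi> x\<bar>)"
        using Cc_infty_integrable[OF d\<phi>] by simp
      show "AE x in lebesgue. norm (((s n x)\<^sup>2 / ((s n x)\<^sup>2 + (w x)\<^sup>2)) * partial_deriv i \<phi> x) \<le> \<bar>partial_deriv i \<phi> x\<bar>" for n
        unfolding real_norm_def abs_mult
        by (intro AE_I2 mult_left_le_one_le q1) auto
      show "AE x in lebesgue. (\<lambda>n. ((s n x)\<^sup>2 / ((s n x)\<^sup>2 + (w x)\<^sup>2)) * partial_deriv i \<phi> x) \<longlonglongrightarrow> F x * partial_deriv i \<phi> x"
        using u_pos
      proof eventually_elim
        case (elim x)
        have "(u x + 0)\<^sup>2 + (w x)\<^sup>2 > 0" using elim by (simp add: add_pos_nonneg)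
        then have nz: "(u x + 0)\<^sup>2 + (w x)\<^sup>2 \<noteq> 0" by linarith
        have "(\<lambda>n. ((s n x)\<^sup>2 / ((s n x)\<^sup>2 + (w x)\<^sup>2)) * partial_deriv i \<phi> x)
            \<longlonglongrightarrow> ((u x + 0)\<^sup>2 / ((u x + 0)\<^sup>2 + (w x)\<^sup>2)) * partial_deriv i \<phi> x"
          unfolding s_def by (intro tendsto_intros inverse_Suc_tendsto_0 nz)
        then show ?case by (simp add: F_def)
      qed
      show "(\<lambda>x. F x * partial_deriv i \<phi> x) \<in> borel_measurable lebesgue"
        unfolding F_def by measurable
      show "(\<lambda>x. ((s n x)\<^sup>2 / ((s n x)\<^sup>2 + (w x)\<^sup>2)) * partial_deriv i \<phi> x) \<in> borel_measurable lebesgue" for n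
        unfolding s_def by measurable
    qed
    ultimately have F0: "(LINT x|lebesgue. F x * partial_deriv i \<phi> x) = 0"
      by (simp add: LIMSEQ_unique)
    have iF: "integrable lebesgue (\<lambda>x. F x * partial_deriv i \<phi> x)"
      by (rule integrable_bounded_mult[OF Cc_infty_integrable[OF d\<phi>] _ AE_I2])
        (use q1[OF zero_le_power2 zero_le_power2] in \<open>auto simp: F_def\<close>)
    have "(LINT x|lebesgue. f x * partial_deriv i \<phi> x)
        = (LINT x|lebesgue. partial_deriv i \<phi> x - F x * partial_deriv i \<phi> x)"
    proof (rule integral_cong_AE)
      show "AE x in lebesgue. f x * partial_deriv i \<phi> x = partial_deriv i \<phi> x - F x * partial_deriv i \<phi> x"
        using u_pos
      proof eventually_elim
        case (elim x)
        have "(u x)\<^sup>2 + (w x)\<^sup>2 > 0" using elim by (simp add: add_pos_nonneg)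
        then have "f x + F x = 1"
          unfolding f_def F_def add_divide_distrib[symmetric] by (metis add.commute divide_self less_irrefl)
        then have "f x = 1 - F x" by linarith
        then show ?case by (simp add: left_diff_distrib)
      qed
      show "(\<lambda>x. f x * partial_deriv i \<phi> x) \<in> borel_measurable lebesgue"
        unfolding f_def by measurable
      show "(\<lambda>x. partial_deriv i \<phi> x - F x * partial_deriv i \<phi> x) \<in> borel_measurable lebesgue"
        unfolding F_def by measurable
    qed
    also have "\<dots> = 0"
      using F0 iF Cc_infty_integrable[OF d\<phi>] integral_partial_deriv_Cc[OF \<phi>, of i] by simp
    finally show ?thesis .
  qed
  ultimately show ?thesis
    unfolding has_weak_gradient_def f_def[abs_def] by simp
qed

section \<open>Nonexistence of positive solutions\<close>

theorem theorem1p7: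
  fixes h V :: "real^'n::finite \<Rightarrow> real" and p :: real
  assumes "CARD('n) \<ge> 3" and "p > 2"
    and "continuous_on UNIV h" and "continuous_on UNIV V"
    and "\<exists>x. max 0 (V x) \<noteq> 0" and "\<exists>x. max 0 (h x) \<noteq> 0"
  shows "(\<forall>l::real. ereal l > lambda1 {x. h x \<le> 0} V \<longrightarrow>
            \<not> (\<exists>u. positive_weak_solution p V h l u)) \<and>
         (lambda1 {x. h x \<le> 0} V < \<infinity> \<and> lambda1_attained {x. h x \<le> 0} V \<and> (\<exists>x. h x \<noteq> 0) \<longrightarrow>
            (\<forall>l::real. ereal l = lambda1 {x. h x \<le> 0} V \<longrightarrow>
               \<not> (\<exists>u. positive_weak_solution p V h l u)))"
proof -
  let ?\<Omega> = "{x. h x \<le> 0}"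
  have adm: "w \<in> D12" "w \<in> weighted_Lq 2 (\<lambda>x. \<bar>V x\<bar>)" "AE x in lebesgue. h x > 0 \<longrightarrow> w x = 0"
    "(LINT x|lebesgue. V x * (w x)\<^sup>2) = 1" if "w \<in> lambda1_admissible ?\<Omega> V" for w
    using that by (auto simp: lambda1_admissible_def D12_on_def not_le)
  have energy: "l \<le> dirichlet_energy w"
    if "positive_weak_solution p V h l u" "w \<in> lambda1_admissible ?\<Omega> V" for l u w
  proof -
    interpret positive_solution p h V l u by unfold_locales (use assms that in auto)
    show ?thesis using energy_ge[OF adm(1-3)[OF that(2)]] adm(4)[OF that(2)] by simp
  qed
  have "\<not> positive_weak_solution p V h l u" if l: "ereal l > lambda1 ?\<Omega> V" for l u
  proof
    assume u: "positive_weak_solution p V h l u"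
    obtain w where "w \<in> lambda1_admissible ?\<Omega> V" "dirichlet_energy w < l"
      using l by (auto simp: lambda1_def INF_less_iff)
    then show False using energy[OF u] by force
  qed
  moreover have "\<not> positive_weak_solution p V h l u"
    if att: "lambda1_attained ?\<Omega> V" and l: "ereal l = lambda1 ?\<Omega> V" for l u
  proof
    assume u: "positive_weak_solution p V h l u"
    interpret positive_solution p h V l u by unfold_locales (use assms u in auto)
    obtain w where w: "w \<in> lambda1_admissible ?\<Omega> V" "dirichlet_energy w = l"
      using att l by (auto simp: lambda1_attained_def) (metis ereal.inject)
    note a = adm[OF w(1)]
    have grad: "AE x in lebesgue. weak_grad w x = (w x / u x) *\<^sub>R Gu x"
      by (rule energy_eq_imp_grad[OF a(1-3)]) (simp add: a(4) w(2))
    let ?f = "\<lambda>x. (w x)\<^sup>2 / ((u x)\<^sup>2 + (w x)\<^sup>2)"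
    have "AE x in lebesgue. ?f x = 0"
    proof (rule zero_weak_gradient_vanishes[OF quotient_zero_weak_gradient[OF a(1) grad]])
      show "open {x. h x > 0}"
        using open_Collect_less[OF continuous_on_const assms(3)] .
      show "{x. h x > 0} \<noteq> {}" using assms(6) by (auto simp: max_def less_le split: if_splits)
      show "AE x in lebesgue. x \<in> {x. h x > 0} \<longrightarrow> ?f x = 0"
        using a(3) by eventually_elim simp
    qed simp
    then have "AE x in lebesgue. w x = 0"
      using u_pos
    proof eventually_elim
      case (elim x)
      have "(u x)\<^sup>2 + (w x)\<^sup>2 > 0" using elim(2) by (simp add: add_pos_nonneg)
      then show ?case using elim(1) by auto
    qed
    then have "(LINT x|lebesgue. V x * (w x)\<^sup>2) = 0"
      by (intro integral_eq_zero_AE) (auto elim: eventually_mono)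
    then show False using a(4) by simp
  qed
  ultimately show ?thesis by blast
qed

end
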